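(* Let $T\in(0,\infty)$, and let $\alpha\in(0,1)$ and $p,q\in(1,\infty)$ satisfy $$p<\min\{1/\alpha,d\},\qquad p<q<q^*:=\frac{1/\alpha+d}{1/(\alpha p)+d/p-1}.$$ Then $$\|\psi\|_{L_q(\mathbb R^d_T)}\le N\|D_x\psi\|_{L_p(\mathbb R^d_T)}^{\theta}\,\|\partial_t^\alpha\psi\|_{L_p(\mathbb R^d_T)}^{\tau(1-\theta)}\,\|\psi\|_{L_p(\mathbb R^d_T)}^{(1-\tau)(1-\theta)}$$ for all $\psi\in\mathbb H_{p,0}^{\alpha,1}(\mathbb R^d_T)$, where $$\theta=d\Big(\frac1p-\frac1q\Big)\in(0,1),\qquad\tau=\frac1{\alpha d}\,\frac{\theta}{1-\theta}\in(0,1),$$ and $N=N(d,\alpha,p,q)$ is independent of $T$. If $q=q^*$ (with the same condition $p<\min\{1/\alpha,d\}$), then $$\|\psi\|_{L_q(\mathbb R^d_T)}\le N\|D_x\psi\|_{L_p(\mathbb R^d_T)}^{\alpha d/(1+\alpha d)}\,\|\partial_t^\alpha\psi\|_{L_p(\mathbb R^d_T)}^{1/(1+\alpha d)}.$$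
   Context: $\mathbb R^d_T=(0,T)\times\mathbb R^d$; $D_x\psi$ is the spatial gradient. $N=N(\cdots)$ is a constant depending only on the listed quantities. For $\mathcal D\subset\mathbb R^k$, $C_0^\infty(\mathcal D)$ denotes infinitely differentiable functions on $\mathcal D$ with compact support contained in $\mathcal D$. $I_0^{1-\alpha}u(t,x)=\frac1{\Gamma(1-\alpha)}\int_0^t(t-s)^{-\alpha}u(s,x)\,ds$. For a domain $\Omega\subset\mathbb R^d$, $\mathbb H_p^{\alpha,1}((0,T)\times\Omega)$ is the set of $u\in L_p((0,T)\times\Omega)$ with $D_xu\in L_p$ and for which there is $g\in L_p((0,T)\times\Omega)$, denoted $\partial_tI_0^{1-\alpha}u$, such that $\int_0^T\!\int_\Omega g\varphi\,dx\,dt=-\int_0^T\!\int_\Omega I_0^{1-\alpha}u\,\partial_t\varphi\,dx\,dt$ for all $\varphi\in C_0^\infty([0,T)\times\Omega)$. Its norm is $\|\partial_tI_0^{1-\alpha}u\|_{L_p}+\|u\|_{L_p}+\|D_xu\|_{L_p}$. $\mathbb H_{p,0}^{\alpha,1}((0,T)\times\Omega)$ is the set of $u\in\mathbb H_p^{\alpha,1}((0,T)\times\Omega)$ that are limits in this norm of functions $u_n\in C^\infty([0,T]\times\Omega)$ which vanish for large $|x|$ and satisfy $u_n(0,x)=0$. For such $u$, $\partial_t^\alpha u=\partial_tI_0^{1-\alpha}u$. *)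

theory Defs
  imports "HOL-Analysis.Analysis"
begin

(* Derivatives are taken within D. In the intended applications D is open, or a product of
   [0,T] or [0,T) with an open set; there derivatives within D are unique, they are one-sided at
   the boundary times, and for such D this is the usual C^k(D), i.e. the derivatives of
   order at most k exist in the interior and extend continuously to D. *)
primrec Ck_on :: "nat \<Rightarrow> 'a::euclidean_space set \<Rightarrow> ('a \<Rightarrow> real) \<Rightarrow> bool" where
  "Ck_on 0 D f \<longleftrightarrow> continuous_on D f"
| "Ck_on (Suc k) D f \<longleftrightarrow>
     (\<exists>f'. (\<forall>z\<in>D. (f has_derivative f' z) (at z within D)) \<and> (\<forall>v. Ck_on k D (\<lambda>z. f' z v)))"

definition Cinf_on :: "'a::euclidean_space set \<Rightarrow> ('a \<Rightarrow> real) \<Rightarrow> bool" where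
  "Cinf_on D f \<longleftrightarrow> (\<forall>k. Ck_on k D f)"

(* Functions on D are represented by total functions whose values outside D are irrelevant. *)
definition test_functions :: "'a::euclidean_space set \<Rightarrow> ('a \<Rightarrow> real) set" where
  "test_functions D = {\<phi>. Cinf_on D \<phi> \<and>
     compact (closure {z\<in>D. \<phi> z \<noteq> 0}) \<and> closure {z\<in>D. \<phi> z \<noteq> 0} \<subseteq> D}"

definition Lp :: "real \<Rightarrow> 'a::euclidean_space set \<Rightarrow> ('a \<Rightarrow> 'b::euclidean_space) set" where
  "Lp p D = {f \<in> borel_measurable (lebesgue_on D).
     integrable (lebesgue_on D) (\<lambda>z. norm (f z) powr p)}"

(* Meaningful only for functions in Lp p D: the Bochner integral of a non-integrable function is 0. *)
definition Lp_norm :: "real \<Rightarrow> 'a::euclidean_space set \<Rightarrow> ('a \<Rightarrow> 'b::euclidean_space) \<Rightarrow> real" where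
  "Lp_norm p D f = (LINT z|lebesgue_on D. norm (f z) powr p) powr (1 / p)"

definition cylinder :: "real \<Rightarrow> (real^'n) set \<Rightarrow> (real \<times> (real^'n)) set" where
  "cylinder T \<Omega> = {0<..<T} \<times> \<Omega>"

definition is_weak_Dx ::
  "real \<Rightarrow> real \<Rightarrow> (real^'n) set \<Rightarrow> (real \<times> (real^'n) \<Rightarrow> real) \<Rightarrow> (real \<times> (real^'n) \<Rightarrow> real^'n) \<Rightarrow> bool" where
  "is_weak_Dx p T \<Omega> u G \<longleftrightarrow> G \<in> Lp p (cylinder T \<Omega>) \<and>
     (\<forall>\<phi> \<in> test_functions (cylinder T \<Omega>). \<forall>i.
        (LINT z|lebesgue_on (cylinder T \<Omega>). (G z $ i) * \<phi> z) =
        - (LINT z|lebesgue_on (cylinder T \<Omega>). u z * frechet_derivative \<phi> (at z) (0, axis i 1)))"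

definition I0 :: "real \<Rightarrow> (real \<times> (real^'n) \<Rightarrow> real) \<Rightarrow> real \<times> (real^'n) \<Rightarrow> real" where
  "I0 \<beta> u = (\<lambda>(t, x). 1 / Gamma \<beta> *
     (LINT s|lebesgue_on {0<..<t}. (t - s) powr (\<beta> - 1) * u (s, x)))"

(* The test functions need not vanish at t = 0. *)
definition is_weak_dt_I0 ::
  "real \<Rightarrow> real \<Rightarrow> real \<Rightarrow> (real^'n) set \<Rightarrow> (real \<times> (real^'n) \<Rightarrow> real) \<Rightarrow> (real \<times> (real^'n) \<Rightarrow> real) \<Rightarrow> bool" where
  "is_weak_dt_I0 \<alpha> p T \<Omega> u g \<longleftrightarrow> g \<in> Lp p (cylinder T \<Omega>) \<and>
     (\<forall>\<phi> \<in> test_functions ({0..<T} \<times> \<Omega>).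
        (LINT z|lebesgue_on (cylinder T \<Omega>). g z * \<phi> z) =
        - (LINT z|lebesgue_on (cylinder T \<Omega>). I0 (1 - \<alpha>) u z * frechet_derivative \<phi> (at z) (1, 0)))"

(* Both weak derivatives are unique up to null sets, so Lp norms do not depend on the choice. *)
definition weak_Dx ::
  "real \<Rightarrow> real \<Rightarrow> (real^'n) set \<Rightarrow> (real \<times> (real^'n) \<Rightarrow> real) \<Rightarrow> real \<times> (real^'n) \<Rightarrow> real^'n" where
  "weak_Dx p T \<Omega> u = (SOME G. is_weak_Dx p T \<Omega> u G)"

definition dt_alpha ::
  "real \<Rightarrow> real \<Rightarrow> real \<Rightarrow> (real^'n) set \<Rightarrow> (real \<times> (real^'n) \<Rightarrow> real) \<Rightarrow> real \<times> (real^'n) \<Rightarrow> real" where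
  "dt_alpha \<alpha> p T \<Omega> u = (SOME g. is_weak_dt_I0 \<alpha> p T \<Omega> u g)"

definition H_space ::
  "real \<Rightarrow> real \<Rightarrow> real \<Rightarrow> (real^'n) set \<Rightarrow> (real \<times> (real^'n) \<Rightarrow> real) set" where
  "H_space \<alpha> p T \<Omega> = {u. u \<in> Lp p (cylinder T \<Omega>) \<and>
     (\<exists>G. is_weak_Dx p T \<Omega> u G) \<and> (\<exists>g. is_weak_dt_I0 \<alpha> p T \<Omega> u g)}"

definition H_norm ::
  "real \<Rightarrow> real \<Rightarrow> real \<Rightarrow> (real^'n) set \<Rightarrow> (real \<times> (real^'n) \<Rightarrow> real) \<Rightarrow> real" where
  "H_norm \<alpha> p T \<Omega> u = Lp_norm p (cylinder T \<Omega>) (dt_alpha \<alpha> p T \<Omega> u) +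
     Lp_norm p (cylinder T \<Omega>) u + Lp_norm p (cylinder T \<Omega>) (weak_Dx p T \<Omega> u)"

(* The approximants are required to lie in H_space, so that the norm of the difference is meaningful. *)
definition H0_space ::
  "real \<Rightarrow> real \<Rightarrow> real \<Rightarrow> (real^'n) set \<Rightarrow> (real \<times> (real^'n) \<Rightarrow> real) set" where
  "H0_space \<alpha> p T \<Omega> = {u \<in> H_space \<alpha> p T \<Omega>. \<exists>U :: nat \<Rightarrow> real \<times> (real^'n) \<Rightarrow> real.
     (\<forall>n. U n \<in> H_space \<alpha> p T \<Omega> \<and> Cinf_on ({0..T} \<times> \<Omega>) (U n) \<and>
        (\<exists>R. \<forall>t\<in>{0..T}. \<forall>x\<in>\<Omega>. R < norm x \<longrightarrow> U n (t, x) = 0) \<and>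
        (\<forall>x\<in>\<Omega>. U n (0, x) = 0)) \<and>
     (\<lambda>n. H_norm \<alpha> p T \<Omega> (\<lambda>z. U n z - u z)) \<longlonglongrightarrow> 0}"

end

theory Submission
  imports Defs
begin

text \<open>
The inequality interpolates between an embedding in space and an embedding in time. In space, each slice satisfies
the Sobolev inequality \<open>\<parallel>\<psi>(t)\<parallel>\<^sub>s \<le> C \<parallel>D\<^sub>x \<psi>(t)\<parallel>\<^sub>p\<close> with \<open>1/s = 1/p - 1/d\<close> (\<open>sobolev_inequality\<close>). In
time, \<open>\<psi>\<close> is the fractional integral of order \<open>\<alpha>\<close> of \<open>g = \<partial>\<^sub>t\<^sup>\<alpha> \<psi>\<close> (\<open>time_representation\<close>), so by
Minkowski's inequality the function \<open>h(t) = \<parallel>\<psi>(t)\<parallel>\<^sub>p\<close> is dominated by the fractional integral of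
\<open>\<parallel>g(t)\<parallel>\<^sub>p\<close> and lies in the space of exponent \<open>r\<close> with \<open>1/r = 1/p - \<alpha>\<close> (\<open>fractional_integral_bound\<close>). Hoelder
in \<open>x\<close> gives \<open>\<parallel>\<psi>(t)\<parallel>\<^sub>q \<le> \<parallel>\<psi>(t)\<parallel>\<^sub>s\<^sup>\<theta> h(t)\<^sup>1\<^sup>-\<^sup>\<theta>\<close>, and Hoelder in \<open>t\<close> finishes the proof since
\<open>1/q = \<theta>/p + (1-\<theta>)(\<tau>/r + (1-\<tau>)/p)\<close> (\<open>smooth_interpolation\<close>). The endpoint \<open>q = q*\<close> is the case \<open>\<tau> = 1\<close>. Both
embeddings are estimates on the whole space and the whole line, hence the constant does not see \<open>T\<close>.

Both embeddings are instances of one Hardy-Littlewood-Sobolev inequality for kernels of weak type on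
two arbitrary sigma-finite spaces (\<open>weak_Young\<close>): for the kernel \<open>\<bar>x - y\<bar>\<^sup>1\<^sup>-\<^sup>d\<close>, applied to the gradient, and for the
kernel \<open>(t - s)\<^sup>\<alpha>\<^sup>-\<^sup>1\<close>. At the endpoint \<open>q = q*\<close> the strong type inequality is needed; it is obtained directly by splitting
the kernel and the function at heights that depend on the level under consideration.

Both weak derivatives are reduced to pointwise statements by testing with explicit products of smooth bumps
(\<open>fundamental_lemma\<close>). The time derivative is tested with backward fractional integrals of bumps; this
needs no smoothness of \<open>\<psi>\<close>. The Sobolev inequality is applied to the smooth approximants, whose classical gradient is their weak
gradient (\<open>gradient_unique\<close>), and the final estimate survives the limit by Fatou's lemma (\<open>H0_interpolation\<close>).
\<close>

section \<open>Hoelder's inequality and layer cake integration\<close>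

text \<open>Hoelder's inequality in the form in which it is used everywhere below: powers with weights adding up to
  one, and finite bounds in place of norms, so that no powers of extended reals are needed. It is the integrated
  weighted inequality of arithmetic and geometric means, applied to \<open>f / A\<close> and \<open>g / B\<close>.\<close>
lemma nn_integral_geometric_Holder:
  fixes f g :: "'a \<Rightarrow> real"
  assumes [measurable]: "f \<in> borel_measurable M" "g \<in> borel_measurable M"
    and nn: "\<And>x. 0 \<le> f x" "\<And>x. 0 \<le> g x"
    and ab: "0 < a" "0 < b" "a + b = 1" and AB: "0 \<le> A" "0 \<le> B"
    and f: "(\<integral>\<^sup>+x. ennreal (f x) \<partial>M) \<le> ennreal A"
    and g: "(\<integral>\<^sup>+x. ennreal (g x) \<partial>M) \<le> ennreal B"
  shows "(\<integral>\<^sup>+x. ennreal (f x powr a * g x powr b) \<partial>M) \<le> ennreal (A powr a * B powr b)"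
proof -
  consider "A = 0" | "B = 0" | "A > 0" "B > 0" using AB by linarith
  then show ?thesis
  proof cases
    case 1
    then have "(\<integral>\<^sup>+x. ennreal (f x) \<partial>M) = 0" using f by simp
    then have "AE x in M. f x = 0" using nn by (subst (asm) nn_integral_0_iff_AE) auto
    then have "(\<integral>\<^sup>+x. ennreal (f x powr a * g x powr b) \<partial>M) = (\<integral>\<^sup>+x. 0 \<partial>M)"
      by (intro nn_integral_cong_AE) auto
    then show ?thesis by simp
  next
    case 2
    then have "(\<integral>\<^sup>+x. ennreal (g x) \<partial>M) = 0" using g by simp
    then have "AE x in M. g x = 0" using nn by (subst (asm) nn_integral_0_iff_AE) auto
    then have "(\<integral>\<^sup>+x. ennreal (f x powr a * g x powr b) \<partial>M) = (\<integral>\<^sup>+x. 0 \<partial>M)"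
      by (intro nn_integral_cong_AE) auto
    then show ?thesis by simp
  next
    case 3
    define D where "D = A powr a * B powr b"
    have D: "D > 0" using 3 by (simp add: D_def)
    have pt: "f x powr a * g x powr b \<le> (D * a / A) * f x + (D * b / B) * g x" for x
    proof (cases "f x = 0 \<or> g x = 0")
      case True
      then show ?thesis using nn[of x] 3 ab D by auto
    next
      case False
      then have pos: "f x > 0" "g x > 0" using nn[of x] by (auto simp: less_le)
      have "(f x / A) powr a * (g x / B) powr b \<le> a * (f x / A) + b * (g x / B)"
        using ab pos 3 by (intro Youngs_inequality_0) auto
      then have "D * ((f x / A) powr a * (g x / B) powr b) \<le> D * (a * (f x / A) + b * (g x / B))"
        using D by (intro mult_left_mono) auto
      moreover have "D * ((f x / A) powr a * (g x / B) powr b) = f x powr a * g x powr b"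
        using pos 3 by (simp add: D_def powr_divide)
      ultimately show ?thesis by (simp add: algebra_simps)
    qed
    have "(\<integral>\<^sup>+x. ennreal (f x powr a * g x powr b) \<partial>M)
        \<le> (\<integral>\<^sup>+x. ennreal (D * a / A) * ennreal (f x) + ennreal (D * b / B) * ennreal (g x) \<partial>M)"
      using pt nn 3 D ab
      by (intro nn_integral_mono) (simp flip: ennreal_mult ennreal_plus)
    also have "\<dots> = ennreal (D * a / A) * (\<integral>\<^sup>+x. ennreal (f x) \<partial>M)
        + ennreal (D * b / B) * (\<integral>\<^sup>+x. ennreal (g x) \<partial>M)"
      by (simp add: nn_integral_add nn_integral_cmult)
    also have "\<dots> \<le> ennreal (D * a / A) * ennreal A + ennreal (D * b / B) * ennreal B"
      by (intro add_mono mult_left_mono f g) auto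
    also have "\<dots> = ennreal (D * a / A * A + D * b / B * B)"
      using 3 D ab by (simp flip: ennreal_mult ennreal_plus)
    also have "D * a / A * A + D * b / B * B = D * (a + b)" using 3 by (simp add: algebra_simps)
    finally show ?thesis using ab by (simp add: D_def)
  qed
qed

lemma nn_integral_powr_from_0:
  fixes q c :: real
  assumes "0 < q" "0 \<le> c"
  shows "(\<integral>\<^sup>+s. ennreal (s powr (q - 1)) * indicator {0<..<c} s \<partial>lborel) = ennreal (c powr q / q)"
proof -
  have "((\<lambda>x. x powr (q - 1)) has_integral (c powr q / q)) {0..c}"
    using has_integral_powr_from_0[of "q - 1" c] assms by simp
  then have "(\<integral>\<^sup>+x. indicator {0..c} x * ennreal (x powr (q - 1)) \<partial>lborel) = ennreal (c powr q / q)"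
    using nn_integral_has_integral_lebesgue[of "{0..c}" "\<lambda>x. x powr (q - 1)"] by (simp add: ennreal_indicator ennreal_mult')
  moreover have "(\<integral>\<^sup>+s. ennreal (s powr (q - 1)) * indicator {0<..<c} s \<partial>lborel)
      = (\<integral>\<^sup>+x. indicator {0..c} x * ennreal (x powr (q - 1)) \<partial>lborel)"
    using AE_lborel_singleton[of "0::real"] AE_lborel_singleton[of c]
    by (intro nn_integral_cong_AE) (auto split: split_indicator)
  ultimately show ?thesis by simp
qed

lemma nn_integral_powr_to_inf:
  fixes e a :: real
  assumes "e > 1" "a > 0"
  shows "(\<integral>\<^sup>+s. ennreal (s powr (- e)) * indicator {a..} s \<partial>lborel) = ennreal (a powr (1 - e) / (e - 1))"
proof -
  have "((\<lambda>x. x powr (-e)) has_integral (a powr (1 - e) / (e - 1))) {a..}"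
    using has_integral_powr_to_inf[of "-e" a] assms by (simp add: minus_divide_right)
  then have "(\<integral>\<^sup>+x. indicator {a..} x * ennreal (x powr (- e)) \<partial>lborel) = ennreal (a powr (1 - e) / (e - 1))"
    using nn_integral_has_integral_lebesgue[of "{a..}" "\<lambda>x. x powr (- e)"] by (simp add: ennreal_indicator ennreal_mult')
  then show ?thesis by (simp add: mult.commute)
qed

lemma layer_cake:
  fixes v :: "'a \<Rightarrow> real"
  assumes "sigma_finite_measure M" and [measurable]: "v \<in> borel_measurable M"
    and nn: "\<And>x. 0 \<le> v x" and q: "0 < q"
  shows "(\<integral>\<^sup>+x. ennreal (v x powr q) \<partial>M) =
    (\<integral>\<^sup>+s. ennreal (q * s powr (q - 1)) * indicator {0<..} s * emeasure M {x\<in>space M. s < v x} \<partial>lborel)"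
proof -
  interpret M: sigma_finite_measure M by fact
  interpret pair_sigma_finite M "lborel :: real measure" by unfold_locales
  have 1: "ennreal (v x powr q) = (\<integral>\<^sup>+s. ennreal (q * s powr (q - 1)) * indicator {0<..} s * indicator {y\<in>space M. s < v y} x \<partial>lborel)"
    if "x \<in> space M" for x
  proof -
    have "ennreal (v x powr q) = ennreal q * (\<integral>\<^sup>+s. ennreal (s powr (q - 1)) * indicator {0<..<v x} s \<partial>lborel)"
      using q nn[of x] by (subst nn_integral_powr_from_0) (auto simp flip: ennreal_mult)
    also have "\<dots> = (\<integral>\<^sup>+s. ennreal q * (ennreal (s powr (q - 1)) * indicator {0<..<v x} s) \<partial>lborel)"
      by (simp add: nn_integral_cmult)
    also have "\<dots> = (\<integral>\<^sup>+s. ennreal (q * s powr (q - 1)) * indicator {0<..} s * indicator {y\<in>space M. s < v y} x \<partial>lborel)"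
      using that q by (intro nn_integral_cong) (auto simp: ennreal_mult split: split_indicator)
    finally show ?thesis .
  qed
  have "(\<integral>\<^sup>+x. ennreal (v x powr q) \<partial>M) =
    (\<integral>\<^sup>+x. \<integral>\<^sup>+s. ennreal (q * s powr (q - 1)) * indicator {0<..} s * indicator {y\<in>space M. s < v y} x \<partial>lborel \<partial>M)"
    by (intro nn_integral_cong 1)
  also have "\<dots> = (\<integral>\<^sup>+s. \<integral>\<^sup>+x. ennreal (q * s powr (q - 1)) * indicator {0<..} s * indicator {y\<in>space M. s < v y} x \<partial>M \<partial>lborel)"
    by (rule Fubini'[symmetric]) measurable
  also have "\<dots> = (\<integral>\<^sup>+s. ennreal (q * s powr (q - 1)) * indicator {0<..} s * emeasure M {x\<in>space M. s < v x} \<partial>lborel)"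
    by (intro nn_integral_cong) (simp add: nn_integral_cmult)
  finally show ?thesis .
qed

section \<open>Kernels of weak type and the Hardy-Littlewood-Sobolev inequality\<close>

text \<open>Membership in the weak Lebesgue space of exponent \<open>r\<close>. The kernels \<open>\<bar>x - y\<bar>^(1-d)\<close> and
  \<open>(t - s)^(\<alpha>-1)\<close> are of this kind, with \<open>r = d/(d-1)\<close> and \<open>r = 1/(1-\<alpha>)\<close>, without being in the strong space.\<close>
definition weak_kernel :: "real \<Rightarrow> real \<Rightarrow> 'a measure \<Rightarrow> ('a \<Rightarrow> real) \<Rightarrow> bool" where
  "weak_kernel A r M k \<longleftrightarrow> (\<forall>s>0. emeasure M {x\<in>space M. s < k x} \<le> ennreal (A * s powr (- r)))"

text \<open>The part of the kernel below a height is in every strong space of larger exponent, the part above it is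
  integrable; both by integrating the level sets.\<close>
lemma weak_kernel_low:
  fixes k :: "'a \<Rightarrow> real"
  assumes sf: "sigma_finite_measure M" and [measurable]: "k \<in> borel_measurable M"
    and nn: "\<And>x. 0 \<le> k x" and wk: "weak_kernel A r M k"
    and A: "0 \<le> A" and b: "r < b" "0 < b" and m: "0 < m"
  shows "(\<integral>\<^sup>+x. ennreal ((if k x \<le> m then k x else 0) powr b) \<partial>M) \<le> ennreal (A * b / (b - r) * m powr (b - r))"
proof -
  have "(\<integral>\<^sup>+x. ennreal ((if k x \<le> m then k x else 0) powr b) \<partial>M)
    = (\<integral>\<^sup>+s. ennreal (b * s powr (b - 1)) * indicator {0<..} s *
        emeasure M {x\<in>space M. s < (if k x \<le> m then k x else 0)} \<partial>lborel)"
    using nn b by (intro layer_cake[OF sf]) auto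
  also have "\<dots> \<le> (\<integral>\<^sup>+s. ennreal (A * b) * (ennreal (s powr (b - r - 1)) * indicator {0<..<m} s) \<partial>lborel)"
  proof (rule nn_integral_mono)
    fix s :: real
    consider "s \<le> 0" | "0 < s" "s < m" | "0 < s" "m \<le> s" by linarith
    then show "ennreal (b * s powr (b - 1)) * indicator {0<..} s *
        emeasure M {x\<in>space M. s < (if k x \<le> m then k x else 0)}
        \<le> ennreal (A * b) * (ennreal (s powr (b - r - 1)) * indicator {0<..<m} s)"
    proof cases
      case 2
      have "emeasure M {x\<in>space M. s < (if k x \<le> m then k x else 0)} \<le> emeasure M {x\<in>space M. s < k x}"
        using 2 by (intro emeasure_mono) (auto split: if_splits)
      also have "\<dots> \<le> ennreal (A * s powr (- r))" using wk 2 by (simp add: weak_kernel_def)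
      finally have "ennreal (b * s powr (b - 1)) * emeasure M {x\<in>space M. s < (if k x \<le> m then k x else 0)}
          \<le> ennreal (b * s powr (b - 1)) * ennreal (A * s powr (- r))" by (rule mult_left_mono) auto
      also have "\<dots> = ennreal (b * s powr (b - 1) * (A * s powr (- r)))" using b by (simp add: ennreal_mult')
      also have "b * s powr (b - 1) * (A * s powr (- r)) = A * b * (s powr (b - 1) * s powr (-r))" by simp
      also have "s powr (b - 1) * s powr (-r) = s powr (b - r - 1)" by (simp flip: powr_add add: algebra_simps)
      finally show ?thesis using 2 A b by (simp add: ennreal_mult)
    next
      case 3
      then have e: "{x\<in>space M. s < (if k x \<le> m then k x else 0)} = {}" by (auto split: if_splits)
      show ?thesis unfolding e by simp
    qed auto
  qed
  also have "\<dots> = ennreal (A * b) * ennreal (m powr (b - r) / (b - r))"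
    using b m by (subst nn_integral_cmult) (auto simp: nn_integral_powr_from_0)
  also have "\<dots> = ennreal (A * b / (b - r) * m powr (b - r))"
    using A b by (simp flip: ennreal_mult)
  finally show ?thesis .
qed

lemma weak_kernel_high:
  fixes k :: "'a \<Rightarrow> real"
  assumes sf: "sigma_finite_measure M" and [measurable]: "k \<in> borel_measurable M"
    and nn: "\<And>x. 0 \<le> k x" and wk: "weak_kernel A r M k"
    and A: "0 \<le> A" and r: "1 < r" and m: "0 < m"
  shows "(\<integral>\<^sup>+x. ennreal (if m < k x then k x else 0) \<partial>M) \<le> ennreal (A * r / (r - 1) * m powr (1 - r))"
proof -
  have "(\<integral>\<^sup>+x. ennreal (if m < k x then k x else 0) \<partial>M) = (\<integral>\<^sup>+x. ennreal ((if m < k x then k x else 0) powr 1) \<partial>M)"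
    using nn by (intro nn_integral_cong) auto
  also have "\<dots> = (\<integral>\<^sup>+s. ennreal (1 * s powr (1 - 1)) * indicator {0<..} s *
        emeasure M {x\<in>space M. s < (if m < k x then k x else 0)} \<partial>lborel)"
    using nn by (intro layer_cake[OF sf]) auto
  also have "\<dots> \<le> (\<integral>\<^sup>+s. ennreal (A * m powr (- r)) * indicator {0<..<m} s + ennreal A * (ennreal (s powr (- r)) * indicator {m..} s) \<partial>lborel)"
  proof (rule nn_integral_mono)
    fix s :: real
    have *: "emeasure M {x\<in>space M. s < (if m < k x then k x else 0)} \<le> ennreal (A * t powr (- r))"
      if "0 < s" "0 < t" "t \<le> m \<or> t \<le> s" for t
    proof -
      have "emeasure M {x\<in>space M. s < (if m < k x then k x else 0)} \<le> emeasure M {x\<in>space M. t < k x}"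
        using that by (intro emeasure_mono) (auto split: if_splits)
      also have "\<dots> \<le> ennreal (A * t powr (- r))" using wk that by (simp add: weak_kernel_def)
      finally show ?thesis .
    qed
    define E where "E = emeasure M {x\<in>space M. s < (if m < k x then k x else 0)}"
    have "ennreal (1 * s powr (1 - 1)) * indicator {0<..} s * E
        \<le> ennreal (A * m powr (- r)) * indicator {0<..<m} s + ennreal A * (ennreal (s powr (- r)) * indicator {m..} s)"
      using *[of m] *[of s] m A unfolding E_def[symmetric] by (auto split: split_indicator simp flip: ennreal_mult)
    then show "ennreal (1 * s powr (1 - 1)) * indicator {0<..} s *
        emeasure M {x\<in>space M. s < (if m < k x then k x else 0)}
        \<le> ennreal (A * m powr (- r)) * indicator {0<..<m} s + ennreal A * (ennreal (s powr (- r)) * indicator {m..} s)"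
      by (simp add: E_def)
  qed
  also have "\<dots> = ennreal (A * m powr (- r)) * ennreal m + ennreal A * ennreal (m powr (1 - r) / (r - 1))"
    using m r by (simp add: nn_integral_add nn_integral_cmult nn_integral_powr_to_inf)
  also have "\<dots> = ennreal (A * m powr (- r) * m + A * (m powr (1 - r) / (r - 1)))"
    using m r A by (simp flip: ennreal_mult ennreal_plus)
  also have "m powr (- r) * m = m powr (1 - r)"
    using m by (simp add: powr_diff powr_minus field_simps)
  then have "A * m powr (- r) * m + A * (m powr (1 - r) / (r - 1)) = A * r / (r - 1) * m powr (1 - r)"
    using r by (simp add: field_simps)
  finally show ?thesis .
qed

text \<open>The heart of the Hardy-Littlewood-Sobolev inequality: a bound on one level set of \<open>v\<close>. Split the kernel at
  height \<open>m\<close> and \<open>f\<close> at height \<open>H\<close>. The low part of the kernel contributes at most \<open>s/4\<close> by Hoelder, the high part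
  against the low part of \<open>f\<close> at most \<open>s/4\<close> because it is integrable; so on \<open>{v > s}\<close> the high part of the kernel
  against the high part of \<open>f\<close> is at least \<open>s/2\<close>, and Markov's inequality applies.\<close>
lemma weak_Young_level:
  fixes K :: "'a \<Rightarrow> 'b \<Rightarrow> real"
  assumes sfM: "sigma_finite_measure M" and sfN: "sigma_finite_measure N"
    and K[measurable]: "(\<lambda>(x, y). K x y) \<in> borel_measurable (M \<Otimes>\<^sub>M N)"
    and Knn: "\<And>x y. 0 \<le> K x y"
    and wk1: "\<And>x. x \<in> space M \<Longrightarrow> weak_kernel A r N (K x)"
    and wk2: "\<And>y. y \<in> space N \<Longrightarrow> weak_kernel A r M (\<lambda>x. K x y)"
    and A: "0 < A" and r: "1 < r" and p: "1 < p" and p': "1 / p + 1 / p' = 1" "r < p'"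
    and f[measurable]: "f \<in> borel_measurable N" and fnn: "\<And>y. 0 \<le> f y"
    and v[measurable]: "v \<in> borel_measurable M"
    and vK: "AE x in M. ennreal (v x) \<le> (\<integral>\<^sup>+y. ennreal (K x y * f y) \<partial>N)"
    and f1: "(\<integral>\<^sup>+y. ennreal (f y powr p) \<partial>N) \<le> 1"
    and s: "0 < s" and m: "0 < m" and H: "0 < H"
    and ms: "(A * p' / (p' - r) * m powr (p' - r)) powr (1 / p') = s / 4"
    and Hs: "H * (A * r / (r - 1) * m powr (1 - r)) = s / 4"
  shows "emeasure M {x\<in>space M. s < v x} \<le> ennreal (1 / (2 * H)) * (\<integral>\<^sup>+y. ennreal (if H < f y then f y else 0) \<partial>N)"
proof -
  interpret M: sigma_finite_measure M by fact
  interpret N: sigma_finite_measure N by fact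
  interpret MN: pair_sigma_finite M N by unfold_locales
  have p'0: "0 < p'" using p'(2) r by simp
  define D where "D = A * r / (r - 1) * m powr (1 - r)"
  define kl where "kl x y = (if K x y \<le> m then K x y else 0)" for x y
  define kh where "kh x y = (if m < K x y then K x y else 0)" for x y
  define fh where "fh y = (if H < f y then f y else 0)" for y
  define W where "W x = (\<integral>\<^sup>+y. ennreal (kh x y * fh y) \<partial>N)" for x
  have [measurable]: "(\<lambda>(x, y). kl x y) \<in> borel_measurable (M \<Otimes>\<^sub>M N)"
      "(\<lambda>(x, y). kh x y) \<in> borel_measurable (M \<Otimes>\<^sub>M N)" "fh \<in> borel_measurable N"
    unfolding kl_def kh_def fh_def by measurable
  have W[measurable]: "W \<in> borel_measurable M" unfolding W_def by measurable
  have HD: "H * D = s / 4" using Hs unfolding D_def .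
  have D0: "D > 0" using A r m by (simp add: D_def)
  have nn: "0 \<le> kl x y" "0 \<le> kh x y" "0 \<le> fh y" for x y using Knn fnn by (auto simp: kl_def kh_def fh_def)
  have key: "ennreal (s / 2) \<le> W x" if x: "x \<in> space M" and sv: "s < v x"
    and le: "ennreal (v x) \<le> (\<integral>\<^sup>+y. ennreal (K x y * f y) \<partial>N)" for x
  proof -
    have [measurable]: "K x \<in> borel_measurable N" "kl x \<in> borel_measurable N" "kh x \<in> borel_measurable N"
      using x by (simp_all add: kl_def kh_def)
    have low: "(\<integral>\<^sup>+y. ennreal (kl x y * f y) \<partial>N) \<le> ennreal (s / 4)"
    proof -
      have "(\<integral>\<^sup>+y. ennreal (kl x y * f y) \<partial>N)
          = (\<integral>\<^sup>+y. ennreal ((kl x y powr p') powr (1 / p') * (f y powr p) powr (1 / p)) \<partial>N)"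
        using nn fnn p p'0 by (intro nn_integral_cong) (simp add: powr_powr)
      also have "\<dots> \<le> ennreal ((A * p' / (p' - r) * m powr (p' - r)) powr (1 / p') * 1 powr (1 / p))"
      proof (rule nn_integral_geometric_Holder)
        show "(\<integral>\<^sup>+ y. ennreal (kl x y powr p') \<partial>N) \<le> ennreal (A * p' / (p' - r) * m powr (p' - r))"
          unfolding kl_def using A p' p'0 m Knn x
          by (intro weak_kernel_low[OF sfN _ _ wk1[OF x]]) auto
      qed (use f1 p p' p'0 A in auto)
      finally show ?thesis unfolding ms by simp
    qed
    have high: "(\<integral>\<^sup>+y. ennreal (kh x y) \<partial>N) \<le> ennreal D"
      unfolding kh_def D_def using A r m Knn x by (intro weak_kernel_high[OF sfN _ _ wk1[OF x]]) auto
    have "ennreal s \<le> ennreal (v x)" using sv by (intro ennreal_leI) simp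
    also note le
    also have "(\<integral>\<^sup>+y. ennreal (K x y * f y) \<partial>N)
        \<le> (\<integral>\<^sup>+y. (ennreal (kl x y * f y) + ennreal H * ennreal (kh x y)) + ennreal (kh x y * fh y) \<partial>N)"
    proof (rule nn_integral_mono)
      fix y
      have "K x y * f y \<le> kl x y * f y + H * kh x y + kh x y * fh y"
      proof (cases "H < f y")
        case True then show ?thesis using Knn[of x y] fnn[of y] H by (auto simp: kl_def kh_def fh_def)
      next
        case False
        then have "K x y * f y \<le> K x y * H" using Knn[of x y] by (intro mult_left_mono) auto
        then show ?thesis using Knn[of x y] fnn[of y] H False by (auto simp: kl_def kh_def fh_def mult.commute)
      qed
      then show "ennreal (K x y * f y) \<le> (ennreal (kl x y * f y) + ennreal H * ennreal (kh x y)) + ennreal (kh x y * fh y)"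
        using nn(1,2)[of x y] nn(3)[of y] fnn[of y] H by (simp flip: ennreal_mult ennreal_plus)
    qed
    also have "\<dots> = ((\<integral>\<^sup>+y. ennreal (kl x y * f y) \<partial>N) + ennreal H * (\<integral>\<^sup>+y. ennreal (kh x y) \<partial>N)) + W x"
      by (simp add: nn_integral_add nn_integral_cmult W_def)
    also have "\<dots> \<le> (ennreal (s / 4) + ennreal H * ennreal D) + W x"
      by (intro add_mono low mult_left_mono high) auto
    also have "ennreal (s / 4) + ennreal H * ennreal D = ennreal (s / 2)"
      using H D0 s HD by (simp flip: ennreal_mult ennreal_plus)
    finally have "ennreal (s / 2) + ennreal (s / 2) \<le> ennreal (s / 2) + W x"
      using s by (simp flip: ennreal_plus)
    then show ?thesis by (simp add: ennreal_add_left_cancel_le)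
  qed
  have "emeasure M {x\<in>space M. s < v x} \<le> emeasure M {x\<in>space M. 1 \<le> ennreal (2 / s) * W x}"
  proof (rule emeasure_mono_AE)
    show "AE x in M. x \<in> {x \<in> space M. s < v x} \<longrightarrow> x \<in> {x \<in> space M. 1 \<le> ennreal (2 / s) * W x}"
      using vK
    proof eventually_elim
      case (elim x)
      show ?case
      proof safe
        assume "x \<in> space M" "s < v x"
        from key[OF this elim] have "ennreal (2 / s) * ennreal (s / 2) \<le> ennreal (2 / s) * W x"
          by (rule mult_left_mono) auto
        then show "1 \<le> ennreal (2 / s) * W x" using s by (simp flip: ennreal_mult)
      qed
    qed
  qed measurable
  also have "\<dots> \<le> ennreal (2 / s) * (\<integral>\<^sup>+x. W x * indicator (space M) x \<partial>M)"
    using nn_integral_Markov_inequality[of W "space M" M "ennreal (2 / s)"] by simp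
  also have "(\<integral>\<^sup>+x. W x * indicator (space M) x \<partial>M) = (\<integral>\<^sup>+x. W x \<partial>M)"
    by (intro nn_integral_cong) simp
  also have "\<dots> = (\<integral>\<^sup>+y. \<integral>\<^sup>+x. ennreal (kh x y * fh y) \<partial>M \<partial>N)"
    unfolding W_def by (rule MN.Fubini'[symmetric]) measurable
  also have "\<dots> \<le> (\<integral>\<^sup>+y. ennreal D * ennreal (fh y) \<partial>N)"
  proof (rule nn_integral_mono)
    fix y assume y: "y \<in> space N"
    have [measurable]: "(\<lambda>x. K x y) \<in> borel_measurable M" "(\<lambda>x. kh x y) \<in> borel_measurable M"
      using y by (auto simp: kh_def)
    have "(\<integral>\<^sup>+x. ennreal (kh x y * fh y) \<partial>M) = (\<integral>\<^sup>+x. ennreal (kh x y) \<partial>M) * ennreal (fh y)"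
      using nn by (simp add: ennreal_mult nn_integral_multc)
    also have "(\<integral>\<^sup>+x. ennreal (kh x y) \<partial>M) \<le> ennreal D"
      unfolding kh_def D_def using A r m Knn y by (intro weak_kernel_high[OF sfM _ _ wk2[OF y]]) auto
    finally show "(\<integral>\<^sup>+x. ennreal (kh x y * fh y) \<partial>M) \<le> ennreal D * ennreal (fh y)"
      by (simp add: mult_right_mono)
  qed
  also have "\<dots> = ennreal D * (\<integral>\<^sup>+y. ennreal (fh y) \<partial>N)" by (simp add: nn_integral_cmult)
  finally have "emeasure M {x\<in>space M. s < v x} \<le> ennreal (2 / s) * (ennreal D * (\<integral>\<^sup>+y. ennreal (fh y) \<partial>N))"
    by (simp add: mult_left_mono)
  also have "\<dots> = ennreal (2 / s * D) * (\<integral>\<^sup>+y. ennreal (fh y) \<partial>N)"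
    using s D0 by (subst mult.assoc[symmetric], subst ennreal_mult[symmetric]) auto
  also have "2 / s * D = 1 / (2 * H)" using HD H s D0 by (simp add: field_simps)
  finally show ?thesis by (simp add: fh_def)
qed

text \<open>The Hardy-Littlewood-Sobolev inequality for general kernels of weak type, also known as the weak Young
  inequality. The level estimate, multiplied by \<open>q * s^(q-1)\<close> and integrated over \<open>s\<close>, gives the integral of
  \<open>f\<close> against \<open>s^(q - q/p - 1)\<close> over \<open>H s < f\<close>, which is a multiple of \<open>f^p\<close>. Choosing both splitting heights
  as powers of \<open>s\<close> gives the strong type bound at once, without maximal functions or an interpolation theorem.\<close>
theorem weak_Young:
  fixes K :: "'a \<Rightarrow> 'b \<Rightarrow> real"
  assumes sfM: "sigma_finite_measure M" and sfN: "sigma_finite_measure N"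
    and K[measurable]: "(\<lambda>(x, y). K x y) \<in> borel_measurable (M \<Otimes>\<^sub>M N)"
    and Knn: "\<And>x y. 0 \<le> K x y"
    and wk1: "\<And>x. x \<in> space M \<Longrightarrow> weak_kernel A r N (K x)"
    and wk2: "\<And>y. y \<in> space N \<Longrightarrow> weak_kernel A r M (\<lambda>x. K x y)"
    and A: "0 < A" and r: "1 < r" and p: "1 < p" and q: "0 < q" "1 / q = 1 / p + 1 / r - 1"
  shows "\<exists>C>0. \<forall>f\<in>borel_measurable N. \<forall>v\<in>borel_measurable M. \<forall>F>0.
      (\<forall>y. 0 \<le> f y) \<longrightarrow> (\<forall>x. 0 \<le> v x) \<longrightarrow>
      (AE x in M. ennreal (v x) \<le> (\<integral>\<^sup>+y. ennreal (K x y * f y) \<partial>N)) \<longrightarrow>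
      (\<integral>\<^sup>+y. ennreal (f y powr p) \<partial>N) \<le> ennreal (F powr p) \<longrightarrow>
      (\<integral>\<^sup>+x. ennreal (v x powr q) \<partial>M) \<le> ennreal ((C * F) powr q)"
proof -
  interpret M: sigma_finite_measure M by fact
  interpret N: sigma_finite_measure N by fact
  interpret NL: pair_sigma_finite N "lborel :: real measure" by unfold_locales
  define p' where "p' = p / (p - 1)"
  have p': "1 / p + 1 / p' = 1" using p by (simp add: p'_def field_simps)
  have p'0: "0 < p'" using p by (simp add: p'_def)
  have "1 / p' < 1 / r" using q p' by (smt (verit) divide_pos_pos)
  then have rp': "r < p'" using r p'0 by (simp add: field_simps)
  have q1: "1 / q = 1 / r - 1 / p'" using q p' by linarith
  have "1 / q = (p' - r) / (r * p')" using q1 r p'0 by (simp add: field_simps)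
  then have "q = r * p' / (p' - r)" by (metis div_by_1 divide_divide_eq_right mult_1 times_divide_eq_right)
  then have e1: "p' / (p' - r) = q / r" using r by simp
  have e2: "1 + q / r * (r - 1) = q / p"
  proof -
    have "q / p = q * (1 / q + 1 - 1 / r)" using q by simp
    then show ?thesis using q r by (simp add: field_simps)
  qed
  have qp: "q / p > 1" using e2 q r by (smt (verit) divide_pos_pos mult_pos_pos)
  have qqp: "q - q / p > 0" using p q by (simp add: field_simps)
  define B where "B = A * p' / (p' - r)"
  define G where "G = A * r / (r - 1)"
  have B0: "B > 0" and G0: "G > 0" using A p'0 rp' r by (auto simp: B_def G_def)
  \<comment> \<open>The splitting heights at level \<open>s\<close> are \<open>m = cm * s powr (q / r)\<close> for the kernel and
    \<open>H = cH * s powr (q / p)\<close> for \<open>f\<close>; the constants are forced by the two equations required in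
    \<open>weak_Young_level\<close>, which are verified as \<open>ms\<close> and \<open>Hs\<close>.\<close>
  define cm where "cm = ((1 / 4) powr p' / B) powr (1 / (p' - r))"
  define cH where "cH = cm powr (r - 1) / (4 * G)"
  have cm0: "cm > 0" using B0 by (simp add: cm_def)
  have cH0: "cH > 0" using cm0 G0 by (simp add: cH_def)
  define C3 where "C3 = q / (2 * cH) * (cH powr (1 - p) / (q - q / p))"
  have C30: "C3 > 0" using cH0 q qqp by (simp add: C3_def)
  have ms: "(B * (cm * s powr (q / r)) powr (p' - r)) powr (1 / p') = s / 4" if "s > 0" for s
  proof -
    have "cm powr (p' - r) = (1 / 4) powr p' / B" using rp' B0 by (simp add: cm_def powr_powr)
    moreover have "(s powr (q / r)) powr (p' - r) = s powr p'"
      using rp' by (simp add: powr_powr flip: e1)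
    ultimately have "B * (cm * s powr (q / r)) powr (p' - r) = (1 / 4 * s) powr p'"
      using cm0 that B0 by (simp add: powr_mult powr_divide)
    then show ?thesis using p'0 that by (simp add: powr_powr)
  qed
  have Hs: "cH * s powr (q / p) * (G * (cm * s powr (q / r)) powr (1 - r)) = s / 4" if "s > 0" for s
  proof -
    have "(cm * s powr (q / r)) powr (1 - r) = cm powr (1 - r) * s powr (q / r * (1 - r))"
      using cm0 that by (simp add: powr_mult powr_powr)
    then have "cH * s powr (q / p) * (G * (cm * s powr (q / r)) powr (1 - r))
        = (cH * G * cm powr (1 - r)) * (s powr (q / p) * s powr (q / r * (1 - r)))" by simp
    also have "s powr (q / p) * s powr (q / r * (1 - r)) = s powr (q / p + q / r * (1 - r))"
      by (simp add: powr_add)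
    also have "q / p + q / r * (1 - r) = 1" using e2 mult_minus_right[of "q / r" "r - 1"] by simp
    also have "cH * G * cm powr (1 - r) = (cm powr (r - 1) * cm powr (1 - r)) / 4" using G0 by (simp add: cH_def)
    also have "cm powr (r - 1) * cm powr (1 - r) = 1" using cm0 by (simp flip: powr_add)
    finally show ?thesis using that by simp
  qed
  have unit: "(\<integral>\<^sup>+x. ennreal (v x powr q) \<partial>M) \<le> ennreal C3"
    if f[measurable]: "f \<in> borel_measurable N" and fnn: "\<And>y. 0 \<le> f y"
    and v[measurable]: "v \<in> borel_measurable M" and vnn: "\<And>x. 0 \<le> v x"
    and vK: "AE x in M. ennreal (v x) \<le> (\<integral>\<^sup>+y. ennreal (K x y * f y) \<partial>N)"
    and f1: "(\<integral>\<^sup>+y. ennreal (f y powr p) \<partial>N) \<le> 1" for f v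
  proof -
    define c where "c = q / (2 * cH)"
    have c0: "c > 0" using q cH0 by (simp add: c_def)
    have "(\<integral>\<^sup>+x. ennreal (v x powr q) \<partial>M)
      = (\<integral>\<^sup>+s. ennreal (q * s powr (q - 1)) * indicator {0<..} s * emeasure M {x\<in>space M. s < v x} \<partial>lborel)"
      using q vnn by (intro layer_cake[OF sfM]) auto
    also have "\<dots> \<le> (\<integral>\<^sup>+s. (\<integral>\<^sup>+y. ennreal (c * s powr (q - q / p - 1) * f y) *
        (indicator {0<..} s * indicator {y. cH * s powr (q / p) < f y} y) \<partial>N) \<partial>lborel)"
    proof (rule nn_integral_mono)
      fix s :: real
      show "ennreal (q * s powr (q - 1)) * indicator {0<..} s * emeasure M {x\<in>space M. s < v x}
        \<le> (\<integral>\<^sup>+y. ennreal (c * s powr (q - q / p - 1) * f y) * (indicator {0<..} s * indicator {y. cH * s powr (q / p) < f y} y) \<partial>N)"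
      proof (cases "0 < s")
        case True
        define H where "H = cH * s powr (q / p)"
        have H0: "H > 0" using cH0 True by (simp add: H_def)
        have "emeasure M {x\<in>space M. s < v x} \<le> ennreal (1 / (2 * H)) * (\<integral>\<^sup>+y. ennreal (if H < f y then f y else 0) \<partial>N)"
          by (rule weak_Young_level[where m = "cm * s powr (q / r)", OF sfM sfN K Knn wk1 wk2 A r p p' rp' f fnn v vK f1 True _ H0])
            (use ms[OF True] Hs[OF True] cm0 True in \<open>auto simp: B_def G_def H_def\<close>)
        then have "ennreal (q * s powr (q - 1)) * emeasure M {x\<in>space M. s < v x}
          \<le> ennreal (q * s powr (q - 1)) * (ennreal (1 / (2 * H)) * (\<integral>\<^sup>+y. ennreal (if H < f y then f y else 0) \<partial>N))"
          by (rule mult_left_mono) simp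
        also have "\<dots> = ennreal (q * s powr (q - 1) * (1 / (2 * H))) * (\<integral>\<^sup>+y. ennreal (if H < f y then f y else 0) \<partial>N)"
          using H0 q by (subst mult.assoc[symmetric], subst ennreal_mult[symmetric]) auto
        also have "q * s powr (q - 1) * (1 / (2 * H)) = c * s powr (q - q / p - 1)"
          using True cH0 by (simp add: c_def H_def powr_diff)
        also have "ennreal (c * s powr (q - q / p - 1)) * (\<integral>\<^sup>+y. ennreal (if H < f y then f y else 0) \<partial>N)
          = (\<integral>\<^sup>+y. ennreal (c * s powr (q - q / p - 1)) * ennreal (if H < f y then f y else 0) \<partial>N)"
          by (rule nn_integral_cmult[symmetric]) measurable
        also have "\<dots> = (\<integral>\<^sup>+y. ennreal (c * s powr (q - q / p - 1) * f y) * (indicator {0<..} s * indicator {y. cH * s powr (q / p) < f y} y) \<partial>N)"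
          using True c0 fnn by (intro nn_integral_cong) (auto simp: H_def ennreal_mult split: split_indicator)
        finally show ?thesis using True by simp
      qed simp
    qed
    also have "\<dots> = (\<integral>\<^sup>+y. (\<integral>\<^sup>+s. ennreal (c * s powr (q - q / p - 1) * f y) *
        (indicator {0<..} s * indicator {y. cH * s powr (q / p) < f y} y) \<partial>lborel) \<partial>N)"
      by (rule NL.Fubini') measurable
    also have "\<dots> = (\<integral>\<^sup>+y. ennreal C3 * ennreal (f y powr p) \<partial>N)"
    proof (rule nn_integral_cong)
      fix y
      define b where "b = (f y / cH) powr (p / q)"
      have iff: "(0 < s \<and> cH * s powr (q / p) < f y) \<longleftrightarrow> (0 < s \<and> s < b)" for s
      proof (cases "0 < s \<and> 0 < f y")
        case True
        have "cH * s powr (q / p) < f y \<longleftrightarrow> s powr (q / p) < f y / cH" using cH0 by (simp add: field_simps)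
        also have "\<dots> \<longleftrightarrow> s < (f y / cH) powr (p / q)"
        proof -
          have "s = (s powr (q / p)) powr (p / q)" using True p q by (simp add: powr_powr)
          then have "s < (f y / cH) powr (p / q) \<longleftrightarrow> (s powr (q / p)) powr (p / q) < (f y / cH) powr (p / q)" by simp
          also have "\<dots> \<longleftrightarrow> s powr (q / p) < f y / cH"
            using True p q cH0 powr_less_mono2[of "p / q" "s powr (q / p)" "f y / cH"]
              powr_less_cancel2[of "p / q" "s powr (q / p)" "f y / cH"] by auto
          finally show ?thesis by simp
        qed
        finally show ?thesis by (simp add: b_def)
      next
        case False
        then have "0 < s \<Longrightarrow> f y = 0" using fnn[of y] by linarith
        moreover have "0 \<le> cH * s powr (q / p)" using cH0 by simp
        ultimately show ?thesis using p q by (auto simp: b_def)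
      qed
      have "(\<integral>\<^sup>+s. ennreal (c * s powr (q - q / p - 1) * f y) *
          (indicator {0<..} s * indicator {y. cH * s powr (q / p) < f y} y) \<partial>lborel)
        = (\<integral>\<^sup>+s. ennreal (c * f y) * (ennreal (s powr (q - q / p - 1)) * indicator {0<..<b} s) \<partial>lborel)"
        using iff c0 fnn[of y] by (intro nn_integral_cong) (auto simp: ennreal_mult mult_ac split: split_indicator)
      also have "\<dots> = ennreal (c * f y) * ennreal (b powr (q - q / p) / (q - q / p))"
        using qqp by (subst nn_integral_cmult) (auto simp: nn_integral_powr_from_0 b_def)
      also have "\<dots> = ennreal (c * f y * (b powr (q - q / p) / (q - q / p)))"
        using c0 fnn[of y] qqp by (subst ennreal_mult[symmetric]) auto
      also have "c * f y * (b powr (q - q / p) / (q - q / p)) = C3 * f y powr p"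
      proof (cases "f y = 0")
        case False
        then have fy: "f y > 0" using fnn[of y] by simp
        have "b powr (q - q / p) = (f y / cH) powr (p - 1)"
        proof -
          have "p / q * (q - q / p) = p - 1" using p q(1) by (simp add: right_diff_distrib)
          then show ?thesis by (simp add: b_def powr_powr)
        qed
        also have "\<dots> = f y powr (p - 1) * cH powr (1 - p)"
          using fy cH0 by (simp add: powr_divide powr_diff)
        finally have e: "b powr (q - q / p) = f y powr (p - 1) * cH powr (1 - p)" .
        have fp: "f y powr p = f y * f y powr (p - 1)" using fy by (simp add: powr_diff)
        show ?thesis unfolding e C3_def c_def fp by simp
      qed (use p in simp)
      finally show "(\<integral>\<^sup>+s. ennreal (c * s powr (q - q / p - 1) * f y) *
          (indicator {0<..} s * indicator {y. cH * s powr (q / p) < f y} y) \<partial>lborel) = ennreal C3 * ennreal (f y powr p)"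
        using C30 by (simp add: ennreal_mult)
    qed
    also have "\<dots> = ennreal C3 * (\<integral>\<^sup>+y. ennreal (f y powr p) \<partial>N)" by (simp add: nn_integral_cmult)
    also have "\<dots> \<le> ennreal C3 * 1" by (intro mult_left_mono f1) auto
    finally show ?thesis by simp
  qed
  show ?thesis
  proof (intro exI[of _ "C3 powr (1 / q)"] conjI ballI allI impI)
    show "0 < C3 powr (1 / q)" using C30 by simp
    fix f v and F :: real
    assume f[measurable]: "f \<in> borel_measurable N" and v[measurable]: "v \<in> borel_measurable M"
    and F: "0 < F" and "\<forall>y. (0::real) \<le> f y" and "\<forall>x. (0::real) \<le> v x"
    and vK: "AE x in M. ennreal (v x) \<le> (\<integral>\<^sup>+y. ennreal (K x y * f y) \<partial>N)"
    and f1: "(\<integral>\<^sup>+y. ennreal (f y powr p) \<partial>N) \<le> ennreal (F powr p)"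
    then have fnn: "\<And>y. 0 \<le> f y" and vnn: "\<And>x. 0 \<le> v x" by auto
    have "(\<integral>\<^sup>+x. ennreal ((v x / F) powr q) \<partial>M) \<le> ennreal C3"
    proof (rule unit[where f = "\<lambda>y. f y / F"])
      show "AE x in M. ennreal (v x / F) \<le> (\<integral>\<^sup>+y. ennreal (K x y * (f y / F)) \<partial>N)"
        using vK AE_space
      proof eventually_elim
        case (elim x)
        have "ennreal (v x / F) = ennreal (1 / F) * ennreal (v x)" using F vnn by (simp flip: ennreal_mult)
        also have "\<dots> \<le> ennreal (1 / F) * (\<integral>\<^sup>+y. ennreal (K x y * f y) \<partial>N)" by (rule mult_left_mono[OF elim(1)]) simp
        also have "\<dots> = (\<integral>\<^sup>+y. ennreal (1 / F) * ennreal (K x y * f y) \<partial>N)"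
          using elim(2) by (intro nn_integral_cmult[symmetric]) simp
        also have "\<dots> = (\<integral>\<^sup>+y. ennreal (K x y * (f y / F)) \<partial>N)"
          using F Knn fnn by (intro nn_integral_cong) (simp flip: ennreal_mult)
        finally show ?case .
      qed
      have "(\<integral>\<^sup>+y. ennreal ((f y / F) powr p) \<partial>N) = (\<integral>\<^sup>+y. ennreal (1 / F powr p) * ennreal (f y powr p) \<partial>N)"
        using F fnn by (intro nn_integral_cong) (simp add: powr_divide flip: ennreal_mult)
      also have "\<dots> = ennreal (1 / F powr p) * (\<integral>\<^sup>+y. ennreal (f y powr p) \<partial>N)" by (simp add: nn_integral_cmult)
      also have "\<dots> \<le> ennreal (1 / F powr p) * ennreal (F powr p)" by (intro mult_left_mono f1) auto
      finally show "(\<integral>\<^sup>+y. ennreal ((f y / F) powr p) \<partial>N) \<le> 1" using F by (simp flip: ennreal_mult)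
    qed (use F fnn vnn in auto)
    then have "ennreal (F powr q) * (\<integral>\<^sup>+x. ennreal ((v x / F) powr q) \<partial>M) \<le> ennreal (F powr q) * ennreal C3"
      by (rule mult_left_mono) simp
    also have "ennreal (F powr q) * (\<integral>\<^sup>+x. ennreal ((v x / F) powr q) \<partial>M) = (\<integral>\<^sup>+x. ennreal (v x powr q) \<partial>M)"
      using F vnn by (subst nn_integral_cmult[symmetric]) (auto intro!: nn_integral_cong simp: powr_divide simp flip: ennreal_mult)
    also have "ennreal (F powr q) * ennreal C3 = ennreal ((C3 powr (1 / q) * F) powr q)"
      using F C30 q(1) by (simp add: powr_mult powr_powr mult.commute flip: ennreal_mult)
    finally show "(\<integral>\<^sup>+x. ennreal (v x powr q) \<partial>M) \<le> ennreal ((C3 powr (1 / q) * F) powr q)" .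
  qed
qed

section \<open>The Sobolev inequality in space\<close>

lemma nn_integral_lborel_affine:
  fixes f :: "'a::euclidean_space \<Rightarrow> ennreal"
  assumes [measurable]: "f \<in> borel_measurable borel" and c: "0 < c"
  shows "(\<integral>\<^sup>+x. f x \<partial>lborel) = ennreal (c ^ DIM('a)) * (\<integral>\<^sup>+x. f (t + c *\<^sub>R x) \<partial>lborel)"
  using c by (subst lborel_affine[of c t])
    (auto simp: nn_integral_density nn_integral_distr nn_integral_cmult)

text \<open>Integration of the derivative along a ray that leaves the support.\<close>
lemma ray_bound:
  fixes v :: "'a::euclidean_space \<Rightarrow> real"
  assumes v': "\<And>x. (v has_derivative v' x) (at x)"
    and cont: "\<And>h. continuous_on UNIV (\<lambda>x. v' x h)"
    and g: "\<And>x h. \<bar>v' x h\<bar> \<le> g x * norm h"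
    and supp: "\<And>x. R < norm x \<Longrightarrow> v x = 0"
    and z: "z \<noteq> 0" "norm z \<le> 1" and gnn: "\<And>x. 0 \<le> g x"
  shows "ennreal \<bar>v x\<bar> \<le> (\<integral>\<^sup>+r. ennreal (g (x + r *\<^sub>R z)) * indicator {0<..} r \<partial>lborel)"
proof -
  define \<rho> where "\<rho> = (\<bar>R\<bar> + norm x + 1) / norm z"
  have \<rho>: "\<rho> > 0" using z by (simp add: \<rho>_def add_nonneg_pos)
  have "norm (x + \<rho> *\<^sub>R z) \<ge> norm (\<rho> *\<^sub>R z) - norm x" by (metis add.commute norm_diff_ineq)
  also have "norm (\<rho> *\<^sub>R z) = \<bar>R\<bar> + norm x + 1" using \<rho> z by (simp add: \<rho>_def add_nonneg_pos)
  finally have 0: "v (x + \<rho> *\<^sub>R z) = 0" by (intro supp) simp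
  define f where "f r = v' (x + r *\<^sub>R z) z" for r
  have "(f has_integral (v (x + \<rho> *\<^sub>R z) - v (x + 0 *\<^sub>R z))) {0..\<rho>}"
  proof (rule fundamental_theorem_of_calculus)
    fix r :: real
    have "((\<lambda>r. v (x + r *\<^sub>R z)) has_derivative (\<lambda>h. v' (x + r *\<^sub>R z) (h *\<^sub>R z))) (at r within {0..\<rho>})"
      by (rule has_derivative_compose[OF _ v']) (auto intro!: derivative_eq_intros)
    moreover have "v' (x + r *\<^sub>R z) (h *\<^sub>R z) = h *\<^sub>R f r" for h
      using linear_scale[OF has_derivative_linear[OF v']] by (simp add: f_def)
    ultimately show "((\<lambda>r. v (x + r *\<^sub>R z)) has_vector_derivative f r) (at r within {0..\<rho>})"
      by (simp add: has_vector_derivative_def)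
  qed (use \<rho> in simp)
  then have I: "(f has_integral (- v x)) {0..\<rho>}" using 0 by simp
  have "continuous_on {0..\<rho>} f" unfolding f_def
    by (rule continuous_on_compose2[OF cont]) (auto intro!: continuous_intros)
  then have "(\<lambda>r. \<bar>f r\<bar>) integrable_on {0..\<rho>}"
    by (intro integrable_continuous_interval continuous_intros)
  then obtain J where J: "((\<lambda>r. \<bar>f r\<bar>) has_integral J) {0..\<rho>}" by blast
  have "\<bar>v x\<bar> \<le> J"
    using has_integral_le[OF I J] has_integral_le[OF has_integral_neg[OF I] J] by (auto simp: abs_le_iff)
  then have "ennreal \<bar>v x\<bar> \<le> ennreal J" by (rule ennreal_leI)
  also have "\<dots> = (\<integral>\<^sup>+r. ennreal \<bar>f r\<bar> * indicator {0..\<rho>} r \<partial>lborel)"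
    using nn_integral_has_integral_lebesgue'[OF _ J] by simp
  also have "\<dots> \<le> (\<integral>\<^sup>+r. ennreal (g (x + r *\<^sub>R z)) * indicator {0<..} r \<partial>lborel)"
  proof (rule nn_integral_mono_AE)
    show "AE r in lborel. ennreal \<bar>f r\<bar> * indicator {0..\<rho>} r \<le> ennreal (g (x + r *\<^sub>R z)) * indicator {0<..} r"
      using AE_lborel_singleton[of "0::real"]
    proof eventually_elim
      case (elim r)
      have "\<bar>f r\<bar> \<le> g (x + r *\<^sub>R z) * norm z" unfolding f_def by (rule g)
      also have "\<dots> \<le> g (x + r *\<^sub>R z) * 1" using z gnn by (intro mult_left_mono) auto
      finally show ?case using elim by (auto split: split_indicator simp: ennreal_leI)
    qed
  qed
  finally show ?thesis .
qed

text \<open>Averaging \<open>ray_bound\<close> over the directions \<open>z\<close> in the unit ball and substituting \<open>y = x + r z\<close>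
  produces the Riesz potential of the gradient. Averaging over the ball instead of the sphere avoids polar coordinates.\<close>
lemma riesz_bound:
  fixes v :: "'a::euclidean_space \<Rightarrow> real"
  assumes v': "\<And>x. (v has_derivative v' x) (at x)"
    and cont: "\<And>h. continuous_on UNIV (\<lambda>x. v' x h)"
    and g: "\<And>x h. \<bar>v' x h\<bar> \<le> g x * norm h"
    and supp: "\<And>x. R < norm x \<Longrightarrow> v x = 0"
    and gnn: "\<And>x. 0 \<le> g x" and [measurable]: "g \<in> borel_measurable borel"
    and d: "2 \<le> DIM('a)"
  shows "ennreal (unit_ball_vol (real DIM('a)) * (real DIM('a) - 1)) * ennreal \<bar>v x\<bar>
    \<le> (\<integral>\<^sup>+y. ennreal (norm (x - y) powr (1 - real DIM('a)) * g y) \<partial>lborel)"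
proof -
  define d where "d = real DIM('a)"
  have d2: "d \<ge> 2" using d by (simp add: d_def)
  have "ennreal (unit_ball_vol d) * ennreal \<bar>v x\<bar> = (\<integral>\<^sup>+z. ennreal \<bar>v x\<bar> * indicator {..1} (norm z) \<partial>(lborel :: 'a measure))"
  proof -
    have "(\<integral>\<^sup>+z. ennreal \<bar>v x\<bar> * indicator {..1} (norm z) \<partial>(lborel :: 'a measure))
        = (\<integral>\<^sup>+z. ennreal \<bar>v x\<bar> * indicator (cball 0 1) z \<partial>(lborel :: 'a measure))"
      by (intro nn_integral_cong) (simp add: indicator_def)
    then show ?thesis
      by (subst (asm) nn_integral_cmult_indicator) (auto simp: emeasure_cball d_def mult.commute)
  qed
  also have "\<dots> \<le> (\<integral>\<^sup>+z. (\<integral>\<^sup>+r. ennreal (g (x + r *\<^sub>R z)) * indicator {0<..} r * indicator {..1} (norm z) \<partial>lborel) \<partial>lborel)"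
  proof (rule nn_integral_mono_AE)
    show "AE z in lborel. ennreal \<bar>v x\<bar> * indicator {..1} (norm z)
        \<le> (\<integral>\<^sup>+r. ennreal (g (x + r *\<^sub>R z)) * indicator {0<..} r * indicator {..1} (norm z) \<partial>lborel)"
      using AE_lborel_singleton[of "0::'a"]
    proof eventually_elim
      case (elim z)
      show ?case
      proof (cases "norm z \<le> 1")
        case True
        then show ?thesis using ray_bound[OF v' cont g supp elim _ gnn, where x = x] by simp
      qed simp
    qed
  qed
  also have "\<dots> = (\<integral>\<^sup>+r. (\<integral>\<^sup>+z. ennreal (g (x + r *\<^sub>R z)) * indicator {0<..} r * indicator {..1} (norm z) \<partial>lborel) \<partial>lborel)"
    by (rule lborel_pair.Fubini') measurable
  also have "\<dots> = (\<integral>\<^sup>+r. (\<integral>\<^sup>+y. ennreal (g y) * (ennreal (r powr (- d)) * indicator {0<..} r) * indicator {..r} (norm (x - y)) \<partial>lborel) \<partial>lborel)"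
  proof (rule nn_integral_cong)
    fix r :: real
    show "(\<integral>\<^sup>+z. ennreal (g (x + r *\<^sub>R z)) * indicator {0<..} r * indicator {..1} (norm z) \<partial>lborel)
      = (\<integral>\<^sup>+y. ennreal (g y) * (ennreal (r powr (- d)) * indicator {0<..} r) * indicator {..r} (norm (x - y)) \<partial>lborel)"
    proof (cases "0 < r")
      case True
      have "(\<integral>\<^sup>+y. ennreal (g y) * (ennreal (r powr (- d)) * indicator {0<..} r) * indicator {..r} (norm (x - y)) \<partial>lborel)
         = ennreal (r ^ DIM('a)) * (\<integral>\<^sup>+z. ennreal (g (x + r *\<^sub>R z)) * (ennreal (r powr (- d)) * indicator {0<..} r) * indicator {..r} (norm (x - (x + r *\<^sub>R z))) \<partial>lborel)"
        by (rule nn_integral_lborel_affine[OF _ True]) measurable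
      also have "\<dots> = (\<integral>\<^sup>+z. ennreal (r ^ DIM('a)) * (ennreal (g (x + r *\<^sub>R z)) * (ennreal (r powr (- d)) * indicator {0<..} r) * indicator {..r} (norm (x - (x + r *\<^sub>R z)))) \<partial>lborel)"
        by (rule nn_integral_cmult[symmetric]) measurable
      also have "\<dots> = (\<integral>\<^sup>+z. ennreal (g (x + r *\<^sub>R z)) * indicator {0<..} r * indicator {..1} (norm z) \<partial>lborel)"
      proof (rule nn_integral_cong)
        fix z :: 'a
        have "r ^ DIM('a) * r powr (-d) = 1"
          using True by (simp add: d_def powr_realpow[symmetric] powr_minus)
        then have e: "ennreal (r ^ DIM('a)) * ennreal (r powr (- d)) = 1"
          using True by (simp flip: ennreal_mult)
        have ind: "indicator {..r} (norm (x - (x + r *\<^sub>R z))) = (indicator {..1} (norm z) :: ennreal)"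
          using True by (simp add: indicator_def)
        have ac: "ennreal (r ^ DIM('a)) * (a * (ennreal (r powr (- d)) * b) * c) = (ennreal (r ^ DIM('a)) * ennreal (r powr (- d))) * (a * b * c)"
          for a b c by (simp add: mult_ac)
        show "ennreal (r ^ DIM('a)) * (ennreal (g (x + r *\<^sub>R z)) * (ennreal (r powr (- d)) * indicator {0<..} r) * indicator {..r} (norm (x - (x + r *\<^sub>R z))))
          = ennreal (g (x + r *\<^sub>R z)) * indicator {0<..} r * indicator {..1} (norm z)"
          unfolding ind ac e by simp
      qed
      finally show ?thesis by simp
    qed simp
  qed
  also have "\<dots> = (\<integral>\<^sup>+y. (\<integral>\<^sup>+r. ennreal (g y) * (ennreal (r powr (- d)) * indicator {0<..} r) * indicator {..r} (norm (x - y)) \<partial>lborel) \<partial>lborel)"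
  proof (rule lborel_pair.Fubini')
    have "{w \<in> space (lborel \<Otimes>\<^sub>M lborel). norm (x - fst w) \<le> snd w} \<in> sets (lborel \<Otimes>\<^sub>M lborel)" by measurable
    then have "indicator {w \<in> space (lborel \<Otimes>\<^sub>M lborel). norm (x - fst w) \<le> snd w} \<in> borel_measurable (lborel \<Otimes>\<^sub>M lborel)"
      by (rule borel_measurable_indicator)
    also have "indicator {w \<in> space (lborel \<Otimes>\<^sub>M lborel). norm (x - fst w) \<le> snd w} = (\<lambda>w. indicator {..snd w} (norm (x - fst w)) :: ennreal)"
      by (auto simp: fun_eq_iff space_pair_measure split: split_indicator)
    finally have m1: "(\<lambda>w. indicator {..snd w} (norm (x - fst w)) :: ennreal) \<in> borel_measurable (lborel \<Otimes>\<^sub>M lborel)" .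
    have m2: "(\<lambda>w. ennreal (g (fst w)) * (ennreal (snd w powr (- d)) * indicator {0<..} (snd w))) \<in> borel_measurable (lborel \<Otimes>\<^sub>M lborel)"
      by measurable
    show "(\<lambda>(y, r). ennreal (g y) * (ennreal (r powr (- d)) * indicator {0<..} r) * indicator {..r} (norm (x - y))) \<in> borel_measurable (lborel \<Otimes>\<^sub>M lborel)"
      using borel_measurable_times_ennreal[OF m2 m1] by (simp add: case_prod_beta')
  qed
  also have "\<dots> = (\<integral>\<^sup>+y. ennreal (1 / (d - 1)) * ennreal (norm (x - y) powr (1 - d) * g y) \<partial>lborel)"
  proof (rule nn_integral_cong_AE)
    show "AE y in lborel. (\<integral>\<^sup>+r. ennreal (g y) * (ennreal (r powr (- d)) * indicator {0<..} r) * indicator {..r} (norm (x - y)) \<partial>lborel)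
       = ennreal (1 / (d - 1)) * ennreal (norm (x - y) powr (1 - d) * g y)"
      using AE_lborel_singleton[of x]
    proof eventually_elim
      case (elim y)
      then have n: "norm (x - y) > 0" by simp
      then have n': "0 < r" if "norm (x - y) \<le> r" for r using that by linarith
      have "(\<integral>\<^sup>+r. ennreal (g y) * (ennreal (r powr (- d)) * indicator {0<..} r) * indicator {..r} (norm (x - y)) \<partial>lborel)
        = (\<integral>\<^sup>+r. ennreal (g y) * (ennreal (r powr (- d)) * indicator {norm (x - y)..} r) \<partial>lborel)"
        by (intro nn_integral_cong) (auto dest: n' split: split_indicator)
      also have "\<dots> = ennreal (g y) * ennreal (norm (x - y) powr (1 - d) / (d - 1))"
        using n d2 by (simp add: nn_integral_cmult nn_integral_powr_to_inf)
      also have "\<dots> = ennreal (1 / (d - 1)) * ennreal (norm (x - y) powr (1 - d) * g y)"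
        using d2 gnn[of y] by (simp add: ac_simps flip: ennreal_mult)
      finally show ?case .
    qed
  qed
  also have "\<dots> = ennreal (1 / (d - 1)) * (\<integral>\<^sup>+y. ennreal (norm (x - y) powr (1 - d) * g y) \<partial>lborel)"
    by (simp add: nn_integral_cmult)
  finally have "ennreal (d - 1) * (ennreal (unit_ball_vol d) * ennreal \<bar>v x\<bar>) \<le> ennreal (d - 1) * (ennreal (1 / (d - 1)) * (\<integral>\<^sup>+y. ennreal (norm (x - y) powr (1 - d) * g y) \<partial>lborel))"
    by (rule mult_left_mono) simp
  also have "\<dots> = ennreal ((d - 1) * (1 / (d - 1))) * (\<integral>\<^sup>+y. ennreal (norm (x - y) powr (1 - d) * g y) \<partial>lborel)"
    using d2 by (subst mult.assoc[symmetric], subst ennreal_mult[symmetric]) auto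
  also have "(d - 1) * (1 / (d - 1)) = 1" using d2 by simp
  finally show ?thesis using d2 by (simp add: d_def[symmetric] mult_ac ennreal_mult)
qed

text \<open>The Sobolev inequality as an instance of \<open>weak_Young\<close>, through the Riesz potential bound.\<close>
theorem sobolev_inequality:
  fixes p :: real
  assumes p: "1 < p" "p < real DIM('a::euclidean_space)" and ps: "1 / ps = 1 / p - 1 / real DIM('a)"
  shows "\<exists>C>0. \<forall>(v :: 'a \<Rightarrow> real) v' g R. \<forall>F>0. (\<forall>x. (v has_derivative v' x) (at x)) \<longrightarrow>
      (\<forall>h. continuous_on UNIV (\<lambda>x. v' x h)) \<longrightarrow> (\<forall>x h. \<bar>v' x h\<bar> \<le> g x * norm h) \<longrightarrow>
      (\<forall>x. R < norm x \<longrightarrow> v x = 0) \<longrightarrow> (\<forall>x. 0 \<le> g x) \<longrightarrow> g \<in> borel_measurable borel \<longrightarrow>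
      (\<integral>\<^sup>+x. ennreal (g x powr p) \<partial>lborel) \<le> ennreal (F powr p) \<longrightarrow>
      (\<integral>\<^sup>+x. ennreal (\<bar>v x\<bar> powr ps) \<partial>lborel) \<le> ennreal ((C * F) powr ps)"
proof -
  define d where "d = real DIM('a)"
  have "1 < d" using p by (simp add: d_def)
  then have d2: "2 \<le> DIM('a)" and d1: "d > 1" by (auto simp: d_def)
  define A where "A = unit_ball_vol d"
  have A: "A > 0" unfolding A_def d_def by simp
  define K where "K x y = norm (x - y) powr (1 - d)" for x y :: 'a
  have Km: "(\<lambda>(x, y). K x y) \<in> borel_measurable (lborel \<Otimes>\<^sub>M lborel)" unfolding K_def by measurable
  have wk: "weak_kernel A (d / (d - 1)) lborel (K x)" for x :: 'a
    unfolding weak_kernel_def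
  proof (intro allI impI)
    fix s :: real assume s: "s > 0"
    define \<rho> where "\<rho> = s powr (-1 / (d - 1))"
    have \<rho>: "\<rho> > 0" using s by (simp add: \<rho>_def)
    have "{y \<in> space lborel. s < K x y} \<subseteq> ball x \<rho>"
    proof safe
      fix y assume y: "s < K x y"
      then have n: "norm (x - y) > 0" using s by (auto simp: K_def)
      have "norm (x - y) = (norm (x - y) powr (1 - d)) powr (-1 / (d - 1))"
      proof -
        have "(1 - d) * (-1 / (d - 1)) = 1" using d1 by (simp add: field_simps)
        then show ?thesis using n by (simp only: powr_powr) simp
      qed
      also have "\<dots> < s powr (-1 / (d - 1))"
        using y s d1 n unfolding K_def by (intro powr_less_mono2_neg) (auto simp: field_simps)
      finally show "y \<in> ball x \<rho>" by (simp add: \<rho>_def dist_norm)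
    qed
    then have "emeasure lborel {y \<in> space lborel. s < K x y} \<le> emeasure lborel (ball x \<rho>)"
      by (rule emeasure_mono) simp
    also have "\<dots> = ennreal (A * \<rho> ^ DIM('a))" using \<rho> by (simp add: emeasure_ball A_def d_def)
    also have "\<rho> ^ DIM('a) = s powr (- (d / (d - 1)))"
      using \<rho> s by (simp add: d_def powr_realpow[symmetric] \<rho>_def powr_powr)
    finally show "emeasure lborel {y \<in> space lborel. s < K x y} \<le> ennreal (A * s powr - (d / (d - 1)))" .
  qed
  have sym: "(\<lambda>x. K x y) = K y" for y by (auto simp: K_def norm_minus_commute)
  have wk2: "weak_kernel A (d / (d - 1)) lborel (\<lambda>x. K x y)" for y unfolding sym by (rule wk)
  have Knn: "0 \<le> K x y" for x y by (simp add: K_def)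
  have r: "1 < d / (d - 1)" using d1 by simp
  have "1 / real DIM('a) < 1 / p" using p by (intro divide_strict_left_mono) auto
  then have "1 / ps > 0" using ps by linarith
  then have ps0: "ps > 0" by simp
  have pse: "1 / ps = 1 / p + 1 / (d / (d - 1)) - 1" using ps d1 by (simp add: d_def field_simps)
  obtain C where C: "0 < C" and
    "\<forall>f\<in>borel_measurable lborel. \<forall>v\<in>borel_measurable lborel. \<forall>F>0.
      (\<forall>y. 0 \<le> f y) \<longrightarrow> (\<forall>x. 0 \<le> v x) \<longrightarrow>
      (AE x in lborel. ennreal (v x) \<le> (\<integral>\<^sup>+y. ennreal (K x y * f y) \<partial>lborel)) \<longrightarrow>
      (\<integral>\<^sup>+y. ennreal (f y powr p) \<partial>lborel) \<le> ennreal (F powr p) \<longrightarrow>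
      (\<integral>\<^sup>+x. ennreal (v x powr ps) \<partial>lborel) \<le> ennreal ((C * F) powr ps)"
    using weak_Young[OF sigma_finite_lborel sigma_finite_lborel Km Knn wk wk2 A r p(1) ps0 pse] by blast
  note Y = this(2)[rule_format]
  define c where "c = A * (d - 1)"
  have c: "c > 0" using A d1 by (simp add: c_def)
  show ?thesis
  proof (intro exI[of _ "C / c"] conjI allI impI)
    show "0 < C / c" using C c by simp
    fix v :: "'a \<Rightarrow> real" and v' g and R F :: real
    assume F: "0 < F" and "\<forall>x. (v has_derivative v' x) (at x)" and "\<forall>h. continuous_on UNIV (\<lambda>x. v' x h)"
      and "\<forall>x h. \<bar>v' x h\<bar> \<le> g x * norm h" and "\<forall>x. R < norm x \<longrightarrow> v x = 0" and "\<forall>x. 0 \<le> g x"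
      and [measurable]: "g \<in> borel_measurable borel"
      and gF: "(\<integral>\<^sup>+x. ennreal (g x powr p) \<partial>lborel) \<le> ennreal (F powr p)"
    then have v': "\<And>x. (v has_derivative v' x) (at x)" and co: "\<And>h. continuous_on UNIV (\<lambda>x. v' x h)"
      and g: "\<And>x h. \<bar>v' x h\<bar> \<le> g x * norm h" and supp: "\<And>x. R < norm x \<Longrightarrow> v x = 0" and gnn: "\<And>x. 0 \<le> g x"
      by auto
    have "continuous_on UNIV v" by (intro continuous_at_imp_continuous_on ballI has_derivative_continuous[OF v'])
    then have [measurable]: "v \<in> borel_measurable borel" by (rule borel_measurable_continuous_onI)
    have "(\<integral>\<^sup>+x. ennreal ((c * \<bar>v x\<bar>) powr ps) \<partial>lborel) \<le> ennreal ((C * F) powr ps)"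
    proof (rule Y)
      show "AE x in lborel. ennreal (c * \<bar>v x\<bar>) \<le> (\<integral>\<^sup>+y. ennreal (K x y * g y) \<partial>lborel)"
        using riesz_bound[OF v' co g supp gnn _ d2] c
        by (simp add: K_def d_def A_def c_def ennreal_mult)
    qed (use gnn c gF F in auto)
    also have "(\<integral>\<^sup>+x. ennreal ((c * \<bar>v x\<bar>) powr ps) \<partial>lborel) = ennreal (c powr ps) * (\<integral>\<^sup>+x. ennreal (\<bar>v x\<bar> powr ps) \<partial>lborel)"
      using c by (subst nn_integral_cmult[symmetric]) (auto simp: powr_mult ennreal_mult)
    finally have "ennreal (1 / c powr ps) * (ennreal (c powr ps) * (\<integral>\<^sup>+x. ennreal (\<bar>v x\<bar> powr ps) \<partial>lborel)) \<le> ennreal (1 / c powr ps) * ennreal ((C * F) powr ps)"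
      by (rule mult_left_mono) simp
    also have "ennreal (1 / c powr ps) * (ennreal (c powr ps) * (\<integral>\<^sup>+x. ennreal (\<bar>v x\<bar> powr ps) \<partial>lborel))
      = (ennreal (1 / c powr ps) * ennreal (c powr ps)) * (\<integral>\<^sup>+x. ennreal (\<bar>v x\<bar> powr ps) \<partial>lborel)" by (simp add: mult.assoc)
    also have "ennreal (1 / c powr ps) * ennreal (c powr ps) = 1" using c by (simp flip: ennreal_mult)
    also have "ennreal (1 / c powr ps) * ennreal ((C * F) powr ps) = ennreal ((C / c * F) powr ps)"
      using c C F by (simp add: powr_mult powr_divide flip: ennreal_mult)
    finally show "(\<integral>\<^sup>+x. ennreal (\<bar>v x\<bar> powr ps) \<partial>lborel) \<le> ennreal ((C / c * F) powr ps)" by simp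
  qed
qed

section \<open>Fractional integration in time\<close>

text \<open>The norm of an integral is at most the integral of the norms. The majorant \<open>\<gamma>\<close> of the norms is
  required to be positive so that it can be used as a weight in Hoelder's inequality.\<close>
lemma minkowski_integral:
  fixes k :: "'s \<Rightarrow> real" and g :: "'s \<Rightarrow> 'x \<Rightarrow> real" and v :: "'x \<Rightarrow> real"
  assumes sfN: "sigma_finite_measure N" and sfX: "sigma_finite_measure X"
    and k[measurable]: "k \<in> borel_measurable N" and knn: "\<And>s. 0 \<le> k s"
    and g[measurable]: "(\<lambda>(s, x). g s x) \<in> borel_measurable (N \<Otimes>\<^sub>M X)" and gnn: "\<And>s x. 0 \<le> g s x"
    and \<gamma>[measurable]: "\<gamma> \<in> borel_measurable N" and \<gamma>0: "\<And>s. 0 < \<gamma> s"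
    and vnn: "\<And>x. 0 \<le> v x" and p: "1 < p"
    and v: "AE x in X. ennreal (v x) \<le> (\<integral>\<^sup>+s. ennreal (k s * g s x) \<partial>N)"
    and G: "AE s in N. (\<integral>\<^sup>+x. ennreal (g s x powr p) \<partial>X) \<le> ennreal (\<gamma> s powr p)"
    and h: "0 \<le> h" "ennreal (h powr p) \<le> (\<integral>\<^sup>+x. ennreal (v x powr p) \<partial>X)"
  shows "ennreal h \<le> (\<integral>\<^sup>+s. ennreal (k s * \<gamma> s) \<partial>N)"
proof (cases "(\<integral>\<^sup>+s. ennreal (k s * \<gamma> s) \<partial>N)")
  case (real I)
  interpret N: sigma_finite_measure N by fact
  interpret X: sigma_finite_measure X by fact
  interpret NX: pair_sigma_finite N X by unfold_locales
  have "h \<le> I + e" if e: "0 < e" for e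
  proof -
    define B where "B = I + e"
    have B: "B > 0" using e real by (simp add: B_def)
    \<comment> \<open>Hoelder for the measure \<open>k ds\<close>: write \<open>g = (g / \<gamma>^(1-1/p)) * \<gamma>^(1-1/p)\<close>.\<close>
    define w where "w s = k s * \<gamma> s powr (1 - p)" for s
    have [measurable]: "w \<in> borel_measurable N" unfolding w_def by measurable
    have wnn: "0 \<le> w s" for s using knn by (simp add: w_def)
    have kgnn: "0 \<le> k s * \<gamma> s" for s using knn[of s] \<gamma>0[of s] by simp
    have pw: "ennreal (v x powr p) \<le> ennreal (B powr (p - 1)) * (\<integral>\<^sup>+s. ennreal (w s * g s x powr p) \<partial>N)"
      if x: "x \<in> space X" and le: "ennreal (v x) \<le> (\<integral>\<^sup>+s. ennreal (k s * g s x) \<partial>N)" for x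
    proof (cases "(\<integral>\<^sup>+s. ennreal (w s * g s x powr p) \<partial>N)")
      case (real a)
      have [measurable]: "(\<lambda>s. g s x) \<in> borel_measurable N" using x by simp
      have "ennreal (v x) \<le> (\<integral>\<^sup>+s. ennreal (k s * g s x) \<partial>N)" by fact
      also have "\<dots> = (\<integral>\<^sup>+s. ennreal ((w s * g s x powr p) powr (1 / p) * (k s * \<gamma> s) powr (1 - 1 / p)) \<partial>N)"
      proof (intro nn_integral_cong arg_cong[of _ _ ennreal])
        fix s
        have "(w s * g s x powr p) powr (1 / p) * (k s * \<gamma> s) powr (1 - 1 / p)
          = (k s powr (1 / p) * k s powr (1 - 1 / p)) * (\<gamma> s powr ((1 - p) * (1 / p)) * \<gamma> s powr (1 - 1 / p)) * g s x powr (p * (1 / p))"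
          unfolding w_def using knn[of s] gnn[of s x] \<gamma>0[of s] by (simp add: powr_mult powr_powr)
        also have "k s powr (1 / p) * k s powr (1 - 1 / p) = k s"
          using knn[of s] by (simp flip: powr_add)
        also have "\<gamma> s powr ((1 - p) * (1 / p)) * \<gamma> s powr (1 - 1 / p) = \<gamma> s powr ((1 - p) * (1 / p) + (1 - 1 / p))"
          by (simp add: powr_add)
        also have "(1 - p) * (1 / p) + (1 - 1 / p) = 0" using p by (simp add: field_simps)
        finally show "k s * g s x = (w s * g s x powr p) powr (1 / p) * (k s * \<gamma> s) powr (1 - 1 / p)"
          using p gnn[of s x] \<gamma>0[of s] by simp
      qed
      also have "\<dots> \<le> ennreal (a powr (1 / p) * B powr (1 - 1 / p))"
      proof (rule nn_integral_geometric_Holder)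
        show "(\<integral>\<^sup>+s. ennreal (k s * \<gamma> s) \<partial>N) \<le> ennreal B"
          using \<open>(\<integral>\<^sup>+s. ennreal (k s * \<gamma> s) \<partial>N) = ennreal I\<close> e by (simp add: B_def ennreal_leI)
        show "(\<integral>\<^sup>+s. ennreal (w s * g s x powr p) \<partial>N) \<le> ennreal a" using real by simp
      qed (use p real B wnn kgnn in auto)
      finally have "v x \<le> a powr (1 / p) * B powr (1 - 1 / p)" by (subst (asm) ennreal_le_iff) auto
      then have "v x powr p \<le> (a powr (1 / p) * B powr (1 - 1 / p)) powr p"
        using vnn[of x] p by (intro powr_mono2) auto
      also have "\<dots> = a powr (1 / p * p) * B powr ((1 - 1 / p) * p)" by (simp add: powr_mult powr_powr)
      also have "1 / p * p = 1" using p by simp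
      also have "(1 - 1 / p) * p = p - 1" using p by (simp add: field_simps)
      finally have "v x powr p \<le> B powr (p - 1) * a" using real by (simp add: mult.commute)
      then show ?thesis using real by (simp add: ennreal_leI flip: ennreal_mult)
    qed (use B in \<open>simp add: ennreal_mult_top\<close>)
    have "ennreal (h powr p) \<le> (\<integral>\<^sup>+x. ennreal (v x powr p) \<partial>X)" by fact
    also have "\<dots> \<le> (\<integral>\<^sup>+x. ennreal (B powr (p - 1)) * (\<integral>\<^sup>+s. ennreal (w s * g s x powr p) \<partial>N) \<partial>X)"
    proof (rule nn_integral_mono_AE)
      show "AE x in X. ennreal (v x powr p) \<le> ennreal (B powr (p - 1)) * (\<integral>\<^sup>+s. ennreal (w s * g s x powr p) \<partial>N)"
        using v AE_space by eventually_elim (rule pw)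
    qed
    also have "\<dots> = ennreal (B powr (p - 1)) * (\<integral>\<^sup>+x. (\<integral>\<^sup>+s. ennreal (w s * g s x powr p) \<partial>N) \<partial>X)"
      by (rule nn_integral_cmult) measurable
    also have "(\<integral>\<^sup>+x. (\<integral>\<^sup>+s. ennreal (w s * g s x powr p) \<partial>N) \<partial>X) = (\<integral>\<^sup>+s. (\<integral>\<^sup>+x. ennreal (w s * g s x powr p) \<partial>X) \<partial>N)"
      by (rule NX.Fubini') measurable
    also have "\<dots> \<le> (\<integral>\<^sup>+s. ennreal (k s * \<gamma> s) \<partial>N)"
    proof (rule nn_integral_mono_AE)
      show "AE s in N. (\<integral>\<^sup>+x. ennreal (w s * g s x powr p) \<partial>X) \<le> ennreal (k s * \<gamma> s)"
        using G AE_space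
      proof eventually_elim
        case (elim s)
        then have [measurable]: "g s \<in> borel_measurable X" by simp
        have "(\<integral>\<^sup>+x. ennreal (w s * g s x powr p) \<partial>X) = ennreal (w s) * (\<integral>\<^sup>+x. ennreal (g s x powr p) \<partial>X)"
          using wnn[of s] by (simp add: ennreal_mult nn_integral_cmult)
        also have "\<dots> \<le> ennreal (w s) * ennreal (\<gamma> s powr p)" by (intro mult_left_mono elim(1)) simp
        also have "\<dots> = ennreal (k s * (\<gamma> s powr (1 - p) * \<gamma> s powr p))"
          using wnn[of s] by (simp add: w_def mult.assoc flip: ennreal_mult)
        also have "\<gamma> s powr (1 - p) * \<gamma> s powr p = \<gamma> s" using \<gamma>0[of s] by (simp flip: powr_add)
        finally show ?case .
      qed
    qed
    also have "\<dots> = ennreal I" by (rule real)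
    also have "\<dots> \<le> ennreal B" using e by (simp add: B_def ennreal_leI)
    finally have "ennreal (h powr p) \<le> ennreal (B powr (p - 1)) * ennreal B" by (simp add: mult_left_mono)
    also have "\<dots> = ennreal (B powr p)" using B by (simp add: powr_diff flip: ennreal_mult)
    finally have "h powr p \<le> B powr p" by (subst (asm) ennreal_le_iff) auto
    then show ?thesis using p h B unfolding B_def[symmetric]
      by (metis less_eq_real_def not_le powr_less_mono2 less_trans zero_less_one)
  qed
  then have "h \<le> I" by (rule field_le_epsilon)
  then show ?thesis using real by (simp add: ennreal_leI)
qed simp

text \<open>If \<open>u\<close> is dominated by the fractional integral of \<open>g\<close> in time, then the function \<open>h\<close> of spatial norms
  of \<open>u\<close> gains integrability in time. Minkowski reduces this to the scalar case, where \<open>weak_Young\<close> applies to the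
  kernel on the whole line; therefore the constant does not depend on \<open>T\<close>.\<close>
theorem fractional_integral_bound:
  fixes \<alpha> p r :: real
  assumes \<alpha>: "0 < \<alpha>" "\<alpha> < 1" and p: "1 < p" "p < 1 / \<alpha>" and r: "1 / r = 1 / p - \<alpha>"
  shows "\<exists>C>0. \<forall>T>0. \<forall>(u :: real \<times> 'a::euclidean_space \<Rightarrow> real) \<in> borel_measurable borel. \<forall>g\<in>borel_measurable borel. \<forall>h\<in>borel_measurable borel. \<forall>F>0.
     (\<forall>t. 0 \<le> h t) \<longrightarrow> (\<forall>t. t \<notin> {0<..<T} \<longrightarrow> h t = 0) \<longrightarrow>
     (\<forall>t. ennreal (h t powr p) \<le> (\<integral>\<^sup>+x. ennreal (\<bar>u (t, x)\<bar> powr p) \<partial>lborel)) \<longrightarrow>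
     (AE z in lborel. fst z \<in> {0<..<T} \<longrightarrow> ennreal \<bar>u z\<bar> \<le> (\<integral>\<^sup>+s. ennreal ((fst z - s) powr (\<alpha> - 1) * indicator {0<..<fst z} s * \<bar>g (s, snd z)\<bar>) \<partial>lborel)) \<longrightarrow>
     (\<integral>\<^sup>+z. ennreal (\<bar>g z\<bar> powr p) \<partial>lborel) \<le> ennreal (F powr p) \<longrightarrow>
     (\<integral>\<^sup>+t. ennreal (h t powr r) \<partial>lborel) \<le> ennreal ((C * F) powr r)"
proof -
  define K where "K t s = (t - s) powr (\<alpha> - 1) * indicator {0<..} (t - s)" for t s :: real
  have Km: "(\<lambda>(t, s). K t s) \<in> borel_measurable (lborel \<Otimes>\<^sub>M lborel)" unfolding K_def by measurable
  have Knn: "0 \<le> K t s" for t s by (simp add: K_def)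
  define \<rho> where "\<rho> = 1 / (1 - \<alpha>)"
  have \<rho>: "1 < \<rho>" using \<alpha> by (simp add: \<rho>_def)
  have lev: "x < s powr (- \<rho>)" if "0 < s" "0 < x" "s < x powr (\<alpha> - 1)" for x s :: real
  proof -
    have "x = (x powr (\<alpha> - 1)) powr (- \<rho>)" 
    proof -
      have "(\<alpha> - 1) * (- \<rho>) = 1" using \<alpha> by (simp add: \<rho>_def field_simps)
      then show ?thesis using that by (simp only: powr_powr) simp
    qed
    also have "\<dots> < s powr (- \<rho>)" using that \<rho> by (intro powr_less_mono2_neg) auto
    finally show ?thesis .
  qed
  have wk1: "weak_kernel 1 \<rho> lborel (K t)" for t
    unfolding weak_kernel_def
  proof (intro allI impI)
    fix s :: real assume s: "0 < s"
    have "{y \<in> space lborel. s < K t y} \<subseteq> {t - s powr (- \<rho>)..t}"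
      using lev[OF s, of "t - y" for y] s by (force simp: K_def split: split_indicator_asm)
    then have "emeasure lborel {y \<in> space lborel. s < K t y} \<le> emeasure lborel {t - s powr (- \<rho>)..t}"
      by (rule emeasure_mono) simp
    then show "emeasure lborel {y \<in> space lborel. s < K t y} \<le> ennreal (1 * s powr - \<rho>)" by simp
  qed
  have wk2: "weak_kernel 1 \<rho> lborel (\<lambda>t. K t y)" for y
    unfolding weak_kernel_def
  proof (intro allI impI)
    fix s :: real assume s: "0 < s"
    have "{t \<in> space lborel. s < K t y} \<subseteq> {y..y + s powr (- \<rho>)}"
      using lev[OF s, of "t - y" for t] s by (force simp: K_def split: split_indicator_asm)
    then have "emeasure lborel {t \<in> space lborel. s < K t y} \<le> emeasure lborel {y..y + s powr (- \<rho>)}"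
      by (rule emeasure_mono) simp
    then show "emeasure lborel {t \<in> space lborel. s < K t y} \<le> ennreal (1 * s powr - \<rho>)" by simp
  qed
  have "\<alpha> < 1 / p" using p \<alpha> by (simp add: field_simps)
  then have "1 / r > 0" using r by simp
  then have r0: "r > 0" by simp
  have re: "1 / r = 1 / p + 1 / \<rho> - 1" using r by (simp add: \<rho>_def)
  obtain C where C: "0 < C" and
    "\<forall>f\<in>borel_measurable lborel. \<forall>v\<in>borel_measurable lborel. \<forall>F>0.
      (\<forall>y. 0 \<le> f y) \<longrightarrow> (\<forall>x. 0 \<le> v x) \<longrightarrow>
      (AE x in lborel. ennreal (v x) \<le> (\<integral>\<^sup>+y. ennreal (K x y * f y) \<partial>lborel)) \<longrightarrow>
      (\<integral>\<^sup>+y. ennreal (f y powr p) \<partial>lborel) \<le> ennreal (F powr p) \<longrightarrow>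
      (\<integral>\<^sup>+x. ennreal (v x powr r) \<partial>lborel) \<le> ennreal ((C * F) powr r)"
    using weak_Young[OF sigma_finite_lborel sigma_finite_lborel Km Knn wk1 wk2 zero_less_one \<rho> p(1) r0 re] by blast
  note Y = this(2)[rule_format]
  show ?thesis
  proof (intro exI[of _ "C * 2"] conjI allI ballI impI)
    show "0 < C * 2" using C by simp
    fix T :: real and u g :: "real \<times> 'a \<Rightarrow> real" and h :: "real \<Rightarrow> real" and F :: real
    assume T: "0 < T" and [measurable]: "u \<in> borel_measurable borel" and [measurable]: "g \<in> borel_measurable borel"
      and [measurable]: "h \<in> borel_measurable borel" and F: "0 < F" and h0: "\<forall>t. 0 \<le> h t"
      and hT: "\<forall>t. t \<notin> {0<..<T} \<longrightarrow> h t = 0"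
      and hu: "\<forall>t. ennreal (h t powr p) \<le> (\<integral>\<^sup>+x. ennreal (\<bar>u (t, x)\<bar> powr p) \<partial>lborel)"
      and ug: "AE z in lborel. fst z \<in> {0<..<T} \<longrightarrow> ennreal \<bar>u z\<bar> \<le> (\<integral>\<^sup>+s. ennreal ((fst z - s) powr (\<alpha> - 1) * indicator {0<..<fst z} s * \<bar>g (s, snd z)\<bar>) \<partial>lborel)"
      and gF: "(\<integral>\<^sup>+z. ennreal (\<bar>g z\<bar> powr p) \<partial>lborel) \<le> ennreal (F powr p)"
    define G where "G s = (\<integral>\<^sup>+x. ennreal (\<bar>g (s, x)\<bar> powr p) \<partial>lborel)" for s
    have gm[measurable]: "(\<lambda>(s, x). \<bar>g (s, x)\<bar>) \<in> borel_measurable (lborel \<Otimes>\<^sub>M lborel)" by (simp add: lborel_prod case_prod_beta')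
    have [measurable]: "(\<lambda>z. \<bar>g z\<bar>) \<in> borel_measurable (lborel \<Otimes>\<^sub>M lborel)" by (simp add: lborel_prod)
    have [measurable]: "G \<in> borel_measurable borel" unfolding G_def by measurable
    have "(\<integral>\<^sup>+s. G s \<partial>lborel) = (\<integral>\<^sup>+z. ennreal (\<bar>g z\<bar> powr p) \<partial>(lborel \<Otimes>\<^sub>M lborel))"
      unfolding G_def by (rule lborel.nn_integral_fst) measurable
    then have GF: "(\<integral>\<^sup>+s. G s \<partial>lborel) \<le> ennreal (F powr p)" using gF by (simp add: lborel_prod)
    then have "(\<integral>\<^sup>+s. G s \<partial>lborel) \<noteq> \<infinity>" by (auto simp: top_unique)
    then have Gfin: "AE s in lborel. G s \<noteq> \<infinity>" by (intro nn_integral_PInf_AE) auto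
    \<comment> \<open>Minkowski's inequality is used with a positive majorant of the slice norms of \<open>g\<close>; this \<open>\<epsilon>\<close> costs
      only a factor \<open>2\<close>, uniformly in \<open>T\<close>.\<close>
    define \<epsilon> where "\<epsilon> = F powr p / T"
    have \<epsilon>: "\<epsilon> > 0" using F T by (simp add: \<epsilon>_def)
    define \<gamma> where "\<gamma> s = (enn2real (G s) + \<epsilon>) powr (1 / p)" for s
    have [measurable]: "\<gamma> \<in> borel_measurable borel" unfolding \<gamma>_def by measurable
    have pos: "0 < enn2real (G s) + \<epsilon>" for s using \<epsilon> enn2real_nonneg[of "G s"] by linarith
    have \<gamma>0: "0 < \<gamma> s" for s using pos[of s] by (simp add: \<gamma>_def)
    have \<gamma>p: "\<gamma> s powr p = enn2real (G s) + \<epsilon>" for s using p pos[of s] by (simp add: \<gamma>_def powr_powr)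
    define f where "f s = \<gamma> s * indicator {0<..<T} s" for s
    have f0: "0 \<le> f s" for s using \<gamma>0[of s] by (simp add: f_def)
    have [measurable]: "f \<in> borel_measurable borel" unfolding f_def by measurable
    have ug': "AE t in lborel. AE x in lborel. t \<in> {0<..<T} \<longrightarrow> ennreal \<bar>u (t, x)\<bar> \<le> (\<integral>\<^sup>+s. ennreal ((t - s) powr (\<alpha> - 1) * indicator {0<..<t} s * \<bar>g (s, x)\<bar>) \<partial>lborel)"
      using lborel_pair.AE_pair[OF ug[folded lborel_prod]] by simp
    show "(\<integral>\<^sup>+t. ennreal (h t powr r) \<partial>lborel) \<le> ennreal ((C * 2 * F) powr r)"
      unfolding mult.assoc
    proof (rule Y)
      show "AE t in lborel. ennreal (h t) \<le> (\<integral>\<^sup>+s. ennreal (K t s * f s) \<partial>lborel)"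
        using ug'
      proof eventually_elim
        case (elim t)
        show ?case
        proof (cases "t \<in> {0<..<T}")
          case True
          define k where "k s = (t - s) powr (\<alpha> - 1) * indicator {0<..<t} s" for s
          have [measurable]: "k \<in> borel_measurable borel" unfolding k_def by measurable
          have "ennreal (h t) \<le> (\<integral>\<^sup>+s. ennreal (k s * \<gamma> s) \<partial>lborel)"
          proof (rule minkowski_integral[where X = "lborel :: 'a measure" and g = "\<lambda>s x. \<bar>g (s, x)\<bar>" and v = "\<lambda>x. \<bar>u (t, x)\<bar>" and p = p])
            show "AE s in lborel. (\<integral>\<^sup>+x. ennreal (\<bar>g (s, x)\<bar> powr p) \<partial>lborel) \<le> ennreal (\<gamma> s powr p)"
              using Gfin
            proof eventually_elim
              case (elim s)
              have "G s = ennreal (enn2real (G s))" using elim by (simp add: top.not_eq_extremum)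
              also have "\<dots> \<le> ennreal (\<gamma> s powr p)" using \<epsilon> by (intro ennreal_leI) (simp add: \<gamma>p)
              finally show ?case by (simp add: G_def)
            qed
            show "AE x in lborel. ennreal \<bar>u (t, x)\<bar> \<le> (\<integral>\<^sup>+s. ennreal (k s * \<bar>g (s, x)\<bar>) \<partial>lborel)"
              using elim True by (simp add: k_def)
          qed (use p \<gamma>0 h0 hu in \<open>auto simp: k_def sigma_finite_lborel\<close>)
          also have "\<dots> \<le> (\<integral>\<^sup>+s. ennreal (K t s * f s) \<partial>lborel)"
            using True \<gamma>0 by (intro nn_integral_mono ennreal_leI) (auto simp: k_def K_def f_def split: split_indicator)
          finally show ?thesis .
        qed (use hT in auto)
      qed
      have "(\<integral>\<^sup>+s. ennreal (f s powr p) \<partial>lborel) \<le> (\<integral>\<^sup>+s. G s + ennreal \<epsilon> * indicator {0<..<T} s \<partial>lborel)"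
      proof (rule nn_integral_mono_AE)
        show "AE s in lborel. ennreal (f s powr p) \<le> G s + ennreal \<epsilon> * indicator {0<..<T} s"
          using Gfin
        proof eventually_elim
          case (elim s)
          have "G s = ennreal (enn2real (G s))" using elim by (simp add: top.not_eq_extremum)
          then have "ennreal (\<gamma> s powr p) = G s + ennreal \<epsilon>"
            unfolding \<gamma>p using \<epsilon> by (metis enn2real_nonneg ennreal_plus less_imp_le)
          then show ?case by (auto simp: f_def split: split_indicator)
        qed
      qed
      also have "\<dots> = (\<integral>\<^sup>+s. G s \<partial>lborel) + ennreal \<epsilon> * ennreal T"
        using T by (subst nn_integral_add) (auto simp: nn_integral_cmult_indicator)
      also have "\<dots> \<le> ennreal (F powr p) + ennreal \<epsilon> * ennreal T" by (intro add_mono GF) auto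
      also have "\<dots> = ennreal (2 * F powr p)" using T F \<epsilon> by (simp add: \<epsilon>_def flip: ennreal_mult ennreal_plus)
      also have "\<dots> \<le> ennreal ((2 * F) powr p)"
      proof -
        have "(2::real) powr 1 \<le> 2 powr p" using p by (intro powr_mono) auto
        then show ?thesis using F by (intro ennreal_leI) (simp add: powr_mult mult_right_mono)
      qed
      finally show "(\<integral>\<^sup>+s. ennreal (f s powr p) \<partial>lborel) \<le> ennreal ((2 * F) powr p)" .
    qed (use F h0 f0 in auto)
  qed
qed

section \<open>Smooth bump functions and the fundamental lemma of the calculus of variations\<close>

lemma Ck_on_SucD: "Ck_on (Suc k) D f \<Longrightarrow> Ck_on k D f"
proof (induction k arbitrary: f)
  case 0
  then obtain f' where "\<forall>z\<in>D. (f has_derivative f' z) (at z within D)" by auto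
  then show ?case by (auto intro: has_derivative_continuous_on)
next
  case (Suc k)
  then obtain f' where f': "\<forall>z\<in>D. (f has_derivative f' z) (at z within D)" "\<forall>v. Ck_on (Suc k) D (\<lambda>z. f' z v)"
    by (subst (asm) (2) Ck_on.simps) auto
  then show ?case using Suc.IH by auto
qed

lemma Ck_on_const: "Ck_on k D (\<lambda>z. c)"
  by (induction k arbitrary: c) (auto intro!: exI[of _ "\<lambda>z v. 0"])

lemma Ck_on_add: "Ck_on k D f \<Longrightarrow> Ck_on k D g \<Longrightarrow> Ck_on k D (\<lambda>z. f z + g z)"
proof (induction k arbitrary: f g)
  case (Suc k)
  from Suc.prems obtain f' g' where f': "\<forall>z\<in>D. (f has_derivative f' z) (at z within D)" "\<forall>v. Ck_on k D (\<lambda>z. f' z v)"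
    and g': "\<forall>z\<in>D. (g has_derivative g' z) (at z within D)" "\<forall>v. Ck_on k D (\<lambda>z. g' z v)" by auto
  then show ?case using Suc.IH
    by (auto intro!: exI[of _ "\<lambda>z v. f' z v + g' z v"] has_derivative_add)
qed (auto intro: continuous_on_add)

lemma Ck_on_mult: "Ck_on k D f \<Longrightarrow> Ck_on k D g \<Longrightarrow> Ck_on k D (\<lambda>z. f z * g z)"
proof (induction k arbitrary: f g)
  case (Suc k)
  from Suc.prems obtain f' g' where f': "\<forall>z\<in>D. (f has_derivative f' z) (at z within D)" "\<forall>v. Ck_on k D (\<lambda>z. f' z v)"
    and g': "\<forall>z\<in>D. (g has_derivative g' z) (at z within D)" "\<forall>v. Ck_on k D (\<lambda>z. g' z v)" by auto
  have "Ck_on k D f" "Ck_on k D g" using Suc.prems Ck_on_SucD by blast+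
  then show ?case using Suc.IH f' g'
    by (auto intro!: exI[of _ "\<lambda>z v. f z * g' z v + f' z v * g z"] has_derivative_mult Ck_on_add)
qed (auto intro: continuous_on_mult)

lemma Ck_on_prod: "(\<And>i. i \<in> I \<Longrightarrow> Ck_on k D (f i)) \<Longrightarrow> Ck_on k D (\<lambda>z. \<Prod>i\<in>I. f i z)"
  by (induction I rule: infinite_finite_induct) (auto intro: Ck_on_mult Ck_on_const)

lemma Ck_on_compose:
  fixes f :: "'b::euclidean_space \<Rightarrow> real"
  assumes l: "\<And>z. (l has_derivative L) (at z)"
  shows "Ck_on k UNIV f \<Longrightarrow> Ck_on k D (\<lambda>z. f (l z))"
proof (induction k arbitrary: f)
  case 0
  have "continuous_on D l" using l by (meson has_derivative_at_withinI has_derivative_continuous_on)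
  with 0 show ?case by (auto intro: continuous_on_compose2)
next
  case (Suc k)
  from Suc.prems obtain f' where f': "\<And>z. (f has_derivative f' z) (at z)" "\<And>v. Ck_on k UNIV (\<lambda>z. f' z v)" by auto
  have "((\<lambda>z. f (l z)) has_derivative (\<lambda>v. f' (l z) (L v))) (at z within D)" for z
    using has_derivative_compose[OF has_derivative_at_withinI[OF l] f'(1)] .
  then show ?case using Suc.IH[OF f'(2)]
    unfolding Ck_on.simps by (intro exI[of _ "\<lambda>z v. f' (l z) (L v)"]) auto
qed

text \<open>The flat function \<open>exp (-1/t)\<close> multiplied by the powers of \<open>1/t\<close>: up to linear combinations this family is
  closed under differentiation, which gives smoothness by induction.\<close>
definition expinv :: "nat \<Rightarrow> real \<Rightarrow> real" where
  "expinv m t = (if 0 < t then inverse t ^ m * exp (- inverse t) else 0)"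

lemma expinv_tendsto_0: "(expinv m \<longlongrightarrow> 0) (at 0)"
proof -
  have "((\<lambda>t. inverse t ^ m / exp (inverse t)) \<longlongrightarrow> 0) (at_right (0::real))"
    by (rule filterlim_compose[OF tendsto_power_div_exp_0 filterlim_inverse_at_top_right])
  moreover have "\<forall>\<^sub>F t in at_right 0. inverse t ^ m / exp (inverse t) = expinv m t"
    using eventually_at_right_less[of "0::real"]
    by eventually_elim (simp add: expinv_def exp_minus divide_inverse)
  ultimately have "(expinv m \<longlongrightarrow> 0) (at_right 0)" by (rule Lim_transform_eventually)
  moreover have "\<forall>\<^sub>F t in at_left 0. expinv m t = 0"
    by (simp add: eventually_at_filter expinv_def)
  then have "(expinv m \<longlongrightarrow> 0) (at_left 0)" by (rule tendsto_eventually)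
  ultimately show ?thesis by (simp add: filterlim_split_at)
qed

lemma expinv_has_derivative:
  "(expinv m has_real_derivative (expinv (m + 2) t - real m * expinv (m + 1) t)) (at t)"
proof -
  consider "t > 0" | "t < 0" | "t = 0" by linarith
  then show ?thesis
  proof cases
    case 1
    have A: "((\<lambda>t. inverse t ^ m) has_real_derivative (- real m * inverse t ^ (m + 1))) (at t)"
    proof -
      have "((\<lambda>t. inverse t) has_real_derivative (- (inverse t * inverse t))) (at t)"
        using 1 by (auto intro!: derivative_eq_intros)
      from DERIV_power[OF this, of m] show ?thesis by (cases m) (simp_all add: algebra_simps)
    qed
    have B: "((\<lambda>t. exp (- inverse t)) has_real_derivative (exp (- inverse t) * (inverse t * inverse t))) (at t)"
      using 1 by (auto intro!: derivative_eq_intros)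
    have "- real m * inverse t ^ (m + 1) * exp (- inverse t) + exp (- inverse t) * (inverse t * inverse t) * inverse t ^ m
        = expinv (m + 2) t - real m * expinv (m + 1) t"
      using 1 by (simp add: expinv_def)
    with DERIV_mult[OF A B] have "((\<lambda>t. inverse t ^ m * exp (- inverse t)) has_real_derivative (expinv (m + 2) t - real m * expinv (m + 1) t)) (at t)"
      by simp
    then show ?thesis
      by (rule has_field_derivative_transform_within_open[where S = "{0<..}"]) (use 1 in \<open>auto simp: expinv_def\<close>)
  next
    case 2
    have "((\<lambda>t. 0) has_real_derivative (expinv (m + 2) t - real m * expinv (m + 1) t)) (at t)"
      using 2 by (simp add: expinv_def)
    then show ?thesis
      by (rule has_field_derivative_transform_within_open[where S = "{..<0}"]) (use 2 in \<open>auto simp: expinv_def\<close>)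
  next
    case 3
    have "(\<lambda>h. (expinv m (0 + h) - expinv m 0) / h) = expinv (Suc m)"
      by (auto simp: expinv_def fun_eq_iff divide_inverse)
    then have "((\<lambda>h. (expinv m (0 + h) - expinv m 0) / h) \<longlongrightarrow> 0) (at 0)"
      using expinv_tendsto_0[of "Suc m"] by simp
    then show ?thesis using 3 by (simp add: DERIV_def expinv_def)
  qed
qed

lemma Ck_on_expinv: "Ck_on k UNIV (expinv m)"
proof (induction k arbitrary: m)
  case 0
  show ?case using DERIV_isCont[OF expinv_has_derivative] by (auto intro: continuous_at_imp_continuous_on)
next
  case (Suc k)
  have "Ck_on k UNIV (\<lambda>t. (expinv (m + 2) t + (- real m) * expinv (m + 1) t) * v)" for v
    by (intro Ck_on_mult Ck_on_add Ck_on_const Suc)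
  moreover have "(expinv m has_derivative (\<lambda>v. (expinv (m + 2) t + (- real m) * expinv (m + 1) t) * v)) (at t)" for t
    using expinv_has_derivative[of m t] by (simp add: has_field_derivative_def)
  ultimately show ?case unfolding Ck_on.simps
    by (intro exI[of _ "\<lambda>t v. (expinv (m + 2) t + (- real m) * expinv (m + 1) t) * v"]) auto
qed

text \<open>Explicit smooth functions that vanish off the box from \<open>c\<close> to \<open>d\<close> and tend pointwise and boundedly to its
  indicator as \<open>n\<close> grows. They are products over coordinates, hence split into a factor in time and one in space.\<close>
definition bump :: "'a::euclidean_space \<Rightarrow> 'a \<Rightarrow> nat \<Rightarrow> 'a \<Rightarrow> real" where
  "bump c d n z = (\<Prod>b\<in>Basis. expinv 0 (real n * ((z - c) \<bullet> b)) * expinv 0 (real n * ((d - z) \<bullet> b)))"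

lemma expinv_0_bounds: "0 \<le> expinv 0 t" "expinv 0 t \<le> 1"
  by (auto simp: expinv_def)

lemma bump_bounds: "0 \<le> bump c d n z" "bump c d n z \<le> 1"
proof -
  have *: "expinv 0 s * expinv 0 t \<in> {0..1}" for s t
    using expinv_0_bounds[of s] expinv_0_bounds[of t] by (auto simp: mult_le_one)
  show "0 \<le> bump c d n z" "bump c d n z \<le> 1" unfolding bump_def
    using * by (auto intro!: prod_nonneg prod_le_1)
qed

lemma bump_eq_0: "z \<notin> box c d \<Longrightarrow> bump c d n z = 0"
  by (force simp: bump_def box_def expinv_def inner_diff_left not_less zero_less_mult_iff intro: prod_zero)

lemma expinv_limit: "(\<lambda>n. expinv 0 (real n * t)) \<longlonglongrightarrow> (if 0 < t then 1 else 0)"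
proof (cases "0 < t")
  case True
  have "filterlim (\<lambda>n. real n * t) at_top sequentially"
    using filterlim_tendsto_pos_mult_at_top[OF tendsto_const True filterlim_real_sequentially] by (simp add: mult.commute)
  then have "(\<lambda>n. inverse (real n * t)) \<longlonglongrightarrow> 0" by (rule tendsto_inverse_0_at_top)
  then have "(\<lambda>n. exp (- inverse (real n * t))) \<longlonglongrightarrow> exp (- 0)" by (intro tendsto_intros)
  then have "(\<lambda>n. exp (- inverse (real n * t))) \<longlonglongrightarrow> 1" by simp
  moreover have "\<forall>\<^sub>F n in sequentially. exp (- inverse (real n * t)) = expinv 0 (real n * t)"
    using True by (intro eventually_sequentiallyI[of 1]) (auto simp: expinv_def)
  ultimately show ?thesis using True by (simp add: Lim_transform_eventually)
next
  case False
  then show ?thesis by (auto simp: expinv_def zero_less_mult_iff)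
qed

lemma bump_limit: "(\<lambda>n. bump c d n z) \<longlonglongrightarrow> indicator (box c d) z"
proof -
  have "(\<lambda>n. bump c d n z) \<longlonglongrightarrow> (\<Prod>b\<in>Basis. (if 0 < (z - c) \<bullet> b then 1 else 0) * (if 0 < (d - z) \<bullet> b then 1 else 0))"
    unfolding bump_def by (intro tendsto_prod tendsto_mult expinv_limit)
  also have "(\<Prod>b\<in>Basis. (if 0 < (z - c) \<bullet> b then 1 else 0) * (if 0 < (d - z) \<bullet> b then 1 else 0)) = (indicator (box c d) z :: real)"
  proof (cases "z \<in> box c d")
    case True
    then show ?thesis by (auto simp: box_def inner_diff_left)
  next
    case False
    then show ?thesis by (force simp: box_def inner_diff_left intro: prod_zero)
  qed
  finally show ?thesis .
qed

lemma Ck_on_bump: "Ck_on k D (bump c d n)"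
  unfolding bump_def[abs_def]
proof (intro Ck_on_prod Ck_on_mult)
  fix b :: 'a
  show "Ck_on k D (\<lambda>z. expinv 0 (real n * ((z - c) \<bullet> b)))"
    by (rule Ck_on_compose[where L = "\<lambda>z. real n * (z \<bullet> b)" and l = "\<lambda>z. real n * ((z - c) \<bullet> b)", OF _ Ck_on_expinv])
      (auto intro!: derivative_eq_intros)
  show "Ck_on k D (\<lambda>z. expinv 0 (real n * ((d - z) \<bullet> b)))"
    by (rule Ck_on_compose[where L = "\<lambda>z. - real n * (z \<bullet> b)" and l = "\<lambda>z. real n * ((d - z) \<bullet> b)", OF _ Ck_on_expinv])
      (auto intro!: derivative_eq_intros)
qed

lemma bump_continuous: "continuous_on UNIV (bump c d n)"
  using Ck_on_bump[of 0 UNIV] by simp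

lemma bump_measurable[measurable]: "bump c d n \<in> borel_measurable borel"
  by (rule borel_measurable_continuous_onI[OF bump_continuous])

lemma bump_prod: "bump (c1, c2) (d1, d2) n (t, x) = bump c1 d1 n t * bump c2 d2 n x"
  unfolding bump_def Basis_prod_def
  by (subst prod.union_disjoint) (auto simp: prod.reindex inj_on_def inner_diff_left)

text \<open>Boxes generate the Borel sets and are stable under intersection.\<close>
lemma AE_zero_of_box_integrals:
  fixes h :: "'a::euclidean_space \<Rightarrow> real"
  assumes int: "integrable lborel h"
    and box: "\<And>c d. (LINT z|lborel. indicator (box c d) z * h z) = 0"
  shows "AE z in lborel. h z = 0"
proof (rule density_unique_real[OF int, of "\<lambda>_. 0", simplified])
  fix A :: "'a set" assume A: "A \<in> sets borel"
  have [measurable]: "h \<in> borel_measurable borel" using int by auto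
  have intA: "integrable lborel (\<lambda>z. indicator B z * h z)" if "B \<in> sets borel" for B
    using integrable_mult_indicator[OF _ int, of B] that by simp
  have tot: "(LINT z|lborel. h z) = 0"
  proof -
    have "(\<lambda>n. LINT z|lborel. indicator (box (- real n *\<^sub>R One) (real n *\<^sub>R One)) z * h z) \<longlonglongrightarrow> (LINT z|lborel. h z)"
    proof (rule integral_dominated_convergence[where w = "\<lambda>z. \<bar>h z\<bar>"])
      show "AE z in lborel. (\<lambda>n. indicator (box (- real n *\<^sub>R One) (real n *\<^sub>R One)) z * h z) \<longlonglongrightarrow> h z"
      proof (rule AE_I2)
        fix z :: 'a
        obtain N :: nat where "norm z < real N" using reals_Archimedean2 by blast
        then have "z \<in> box (- real n *\<^sub>R One) (real n *\<^sub>R One)" if "n \<ge> N" for n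
        proof -
          have "- real n < z \<bullet> b \<and> z \<bullet> b < real n" if "b \<in> Basis" for b
          proof -
            have "\<bar>z \<bullet> b\<bar> \<le> norm z" using that by (rule Basis_le_norm)
            moreover have "real N \<le> real n" using \<open>n \<ge> N\<close> by simp
            ultimately show ?thesis using \<open>norm z < real N\<close> by linarith
          qed
          then show ?thesis by (simp add: mem_box)
        qed
        then show "(\<lambda>n. indicator (box (- real n *\<^sub>R One) (real n *\<^sub>R One)) z * h z) \<longlonglongrightarrow> h z"
          by (intro tendsto_eventually eventually_sequentiallyI[of N]) simp
      qed
    qed (use int in \<open>auto split: split_indicator\<close>)
    then show ?thesis using box by (simp add: LIMSEQ_unique)
  qed
  have bx: "sets (borel :: 'a measure) = sigma_sets UNIV (range (\<lambda>(c, d). box c d))"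
    by (subst borel_eq_box) (rule sets_measure_of, simp)
  have stable: "Int_stable (range (\<lambda>(c::'a, d). box c d))"
  proof (rule Int_stableI)
    fix a b :: "'a set" assume "a \<in> range (\<lambda>(c::'a, d). box c d)" "b \<in> range (\<lambda>(c::'a, d). box c d)"
    then obtain c d c' d' where "a = box c d" "b = box c' d'" by auto
    moreover obtain c'' d'' where "box c d \<inter> box c' d' = box c'' d''" using box_Int_box by blast
    ultimately have "a \<inter> b = (case (c'', d'') of (c, d) \<Rightarrow> box c d)" by simp
    then show "a \<inter> b \<in> range (\<lambda>(c::'a, d). box c d)" by (rule range_eqI)
  qed
  have closed: "range (\<lambda>(c::'a, d). box c d) \<subseteq> Pow UNIV" by simp
  have "A \<in> sigma_sets UNIV (range (\<lambda>(c, d). box c d))" using A bx by simp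
  with stable closed have "(LINT z|lborel. indicator A z * h z) = 0"
  proof (induction rule: sigma_sets_induct_disjoint)
    show "(LINT z|lborel. indicator A z * h z) = 0" if "A \<in> range (\<lambda>(c::'a, d). box c d)" for A
      using that box by auto
  next
    fix A :: "'a set" assume A: "A \<in> sigma_sets UNIV (range (\<lambda>(c, d). box c d))" "(LINT z|lborel. indicator A z * h z) = 0"
    then have "A \<in> sets borel" using bx by simp
    have "(LINT z|lborel. indicator (UNIV - A) z * h z) = (LINT z|lborel. h z - indicator A z * h z)"
      by (intro Bochner_Integration.integral_cong) (auto split: split_indicator)
    also have "\<dots> = 0" using int intA[OF \<open>A \<in> sets borel\<close>] A tot by simp
    finally show "(LINT z|lborel. indicator (UNIV - A) z * h z) = 0" .
  next
    fix A :: "nat \<Rightarrow> 'a set" assume A: "disjoint_family A" "range A \<subseteq> sigma_sets UNIV (range (\<lambda>(c, d). box c d))"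
      "\<And>i. (LINT z|lborel. indicator (A i) z * h z) = 0"
    then have "A i \<in> sets lborel" for i using bx by auto
    then have "set_lebesgue_integral lborel (\<Union>i. A i) h = (\<Sum>i. set_lebesgue_integral lborel (A i) h)"
      using A int intA by (intro lebesgue_integral_countable_add) (auto simp: disjoint_family_on_def set_integrable_def)
    then show "(LINT z|lborel. indicator (\<Union>(range A)) z * h z) = 0"
      using A by (simp add: set_lebesgue_integral_def)
  qed simp
  then show "set_lebesgue_integral lborel A h = 0" by (simp add: set_lebesgue_integral_def)
qed

text \<open>Testing against the bumps suffices: in the limit the integral of \<open>h\<close> over every small box vanishes.\<close>
lemma fundamental_lemma:
  fixes h :: "'a::euclidean_space \<Rightarrow> real"
  assumes D: "open D" and [measurable]: "h \<in> borel_measurable borel"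
    and int: "\<And>a b. cbox a b \<subseteq> D \<Longrightarrow> integrable lborel (\<lambda>z. indicator (cbox a b) z * h z)"
    and test: "\<And>c d n. cbox c d \<subseteq> D \<Longrightarrow> box c d \<noteq> {} \<Longrightarrow> (LINT z|lborel. h z * bump c d n z) = 0"
  shows "AE z in lborel. z \<in> D \<longrightarrow> h z = 0"
proof -
  have box0: "(LINT z|lborel. indicator (box c d) z * h z) = 0" if cd: "cbox c d \<subseteq> D" for c d
  proof (cases "box c d = {}")
    case False
    have "(\<lambda>n. LINT z|lborel. h z * bump c d n z) \<longlonglongrightarrow> (LINT z|lborel. h z * indicator (box c d) z)"
    proof (rule integral_dominated_convergence[where w = "\<lambda>z. \<bar>indicator (cbox c d) z * h z\<bar>"])
      show "AE z in lborel. (\<lambda>n. h z * bump c d n z) \<longlonglongrightarrow> h z * indicator (box c d) z"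
        by (intro AE_I2 tendsto_mult tendsto_const bump_limit)
      show "AE z in lborel. norm (h z * bump c d n z) \<le> \<bar>indicator (cbox c d) z * h z\<bar>" for n
      proof (rule AE_I2)
        fix z
        show "norm (h z * bump c d n z) \<le> \<bar>indicator (cbox c d) z * h z\<bar>"
        proof (cases "z \<in> box c d")
          case True
          then have "z \<in> cbox c d" using box_subset_cbox by blast
          then show ?thesis using bump_bounds[of c d n z] by (auto simp: abs_mult mult_left_le)
        qed (simp add: bump_eq_0)
      qed
      show "integrable lborel (\<lambda>z. \<bar>indicator (cbox c d) z * h z\<bar>)" using int[OF cd] by (rule integrable_abs)
    qed measurable
    then show ?thesis using test[OF cd False] by (simp add: LIMSEQ_unique mult.commute)
  qed simp
  have cb: "AE z in lborel. z \<in> cbox a b \<longrightarrow> h z = 0" if ab: "cbox a b \<subseteq> D" for a b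
  proof -
    have "AE z in lborel. indicator (box a b) z * h z = 0"
    proof (rule AE_zero_of_box_integrals)
      have "integrable lborel (\<lambda>z. indicator (box a b) z *\<^sub>R (indicator (cbox a b) z * h z))"
        by (intro integrable_mult_indicator int ab) simp
      also have "(\<lambda>z. indicator (box a b) z *\<^sub>R (indicator (cbox a b) z * h z)) = (\<lambda>z. indicator (box a b) z * h z)"
        using box_subset_cbox[of a b] by (auto simp: fun_eq_iff split: split_indicator)
      finally show "integrable lborel (\<lambda>z. indicator (box a b) z * h z)" .
      fix c d
      obtain c' d' where e: "box c d \<inter> box a b = box c' d'" by (rule that[OF box_Int_box])
      have "(LINT z|lborel. indicator (box c d) z * (indicator (box a b) z * h z)) = (LINT z|lborel. indicator (box c' d') z * h z)"
        unfolding e[symmetric] by (intro Bochner_Integration.integral_cong) (auto split: split_indicator)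
      also have "\<dots> = 0"
      proof (cases "box c' d' = {}")
        case False
        then have "cbox c' d' = closure (box c' d')" by (simp add: closure_box)
        also have "\<dots> \<subseteq> closure (box a b)" using e by (intro closure_mono) auto
        also have "\<dots> \<subseteq> cbox a b" by (rule closure_minimal[OF box_subset_cbox closed_cbox])
        finally show ?thesis using ab by (intro box0) auto
      qed simp
      finally show "(LINT z|lborel. indicator (box c d) z * (indicator (box a b) z * h z)) = 0" .
    qed
    moreover have "AE z in lborel. z \<notin> cbox a b - box a b"
    proof (rule AE_not_in)
      have e: "emeasure lborel (cbox a b) = emeasure lborel (box a b)"
        unfolding emeasure_lborel_cbox_eq emeasure_lborel_box_eq by simp
      have "emeasure lborel (cbox a b - box a b) = emeasure lborel (cbox a b) - emeasure lborel (box a b)"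
        by (rule emeasure_Diff) (auto simp: box_subset_cbox emeasure_lborel_box_eq)
      then have "emeasure lborel (cbox a b - box a b) = 0"
        unfolding e by (simp add: emeasure_lborel_box_eq)
      then show "cbox a b - box a b \<in> null_sets lborel" by auto
    qed
    ultimately show ?thesis by eventually_elim (auto split: split_indicator_asm)
  qed
  show ?thesis
  proof (rule open_countable_Union_open_cbox[OF D])
    fix \<D> assume \<D>: "countable \<D>" "\<D> \<subseteq> Pow D" "\<And>X. X \<in> \<D> \<Longrightarrow> \<exists>a b. X = cbox a b" "\<Union>\<D> = D"
    have all: "AE z in lborel. \<forall>X\<in>\<D>. z \<in> X \<longrightarrow> h z = 0"
    proof (rule AE_ball_countable')
      fix X assume "X \<in> \<D>"
      then obtain a b where "X = cbox a b" "cbox a b \<subseteq> D" using \<D>(2) \<D>(3)[of X] by auto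
      then show "AE z in lborel. z \<in> X \<longrightarrow> h z = 0" using cb[of a b] by simp
    qed (rule \<D>(1))
    show "AE z in lborel. z \<in> D \<longrightarrow> h z = 0"
      using all
    proof eventually_elim
      case (elim z)
      show ?case
      proof
        assume "z \<in> D"
        then obtain X where "X \<in> \<D>" "z \<in> X" using \<D>(4) by blast
        then show "h z = 0" using elim by blast
      qed
    qed
  qed
qed

section \<open>Borel representatives\<close>

text \<open>Integrals of Lebesgue measurable functions are moved to Borel functions on the whole space; Fubini is only
  available there, as slices of Lebesgue measurable functions need not be measurable.\<close>
lemma lebesgue_on_lint_eq:
  fixes F F0 :: "'a::euclidean_space \<Rightarrow> real"
  assumes D: "D \<in> sets borel" and [measurable]: "F0 \<in> borel_measurable borel"
    and ae: "AE z in lborel. z \<in> D \<longrightarrow> F z = F0 z"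
  shows "(LINT z|lebesgue_on D. F z) = (LINT z|lborel. indicator D z * F0 z)"
    and "integrable (lebesgue_on D) F \<longleftrightarrow> integrable lborel (\<lambda>z. indicator D z * F0 z)"
proof -
  have [measurable]: "D \<in> sets lborel" using D by simp
  have ae': "AE z in lebesgue. indicator D z * F0 z = indicator D z *\<^sub>R F z"
    using AE_completion[OF ae] by eventually_elim (auto split: split_indicator)
  have m0: "(\<lambda>z. indicator D z * F0 z) \<in> borel_measurable lborel" by measurable
  have m0': "(\<lambda>z. indicator D z * F0 z) \<in> borel_measurable lebesgue" by (rule measurable_completion[OF m0])
  have m: "(\<lambda>z. indicator D z *\<^sub>R F z) \<in> borel_measurable lebesgue"
    by (rule borel_measurable_AE[OF m0' ae'])
  have "(LINT z|lebesgue_on D. F z) = (LINT z|lebesgue. indicator D z *\<^sub>R F z)"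
    using D by (intro integral_restrict_space) auto
  also have "\<dots> = (LINT z|lebesgue. indicator D z * F0 z)"
    using ae' by (intro integral_cong_AE m m0') auto
  also have "\<dots> = (LINT z|lborel. indicator D z * F0 z)" by (rule integral_completion[OF m0])
  finally show "(LINT z|lebesgue_on D. F z) = (LINT z|lborel. indicator D z * F0 z)" .
  have "integrable (lebesgue_on D) F \<longleftrightarrow> integrable lebesgue (\<lambda>z. indicator D z *\<^sub>R F z)"
    using D by (intro integrable_restrict_space) auto
  also have "\<dots> \<longleftrightarrow> integrable lebesgue (\<lambda>z. indicator D z * F0 z)"
    using ae' by (intro integrable_cong_AE m m0') auto
  also have "\<dots> \<longleftrightarrow> integrable lborel (\<lambda>z. indicator D z * F0 z)" by (rule integrable_completion[OF m0])
  finally show "integrable (lebesgue_on D) F \<longleftrightarrow> integrable lborel (\<lambda>z. indicator D z * F0 z)" .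
qed

lemma lebesgue_on_borel_rep:
  fixes f :: "'a::euclidean_space \<Rightarrow> 'b::euclidean_space"
  assumes D: "D \<in> sets borel" and f: "f \<in> borel_measurable (lebesgue_on D)"
  obtains f0 where "f0 \<in> borel_measurable borel" "\<And>z. z \<notin> D \<Longrightarrow> f0 z = 0" "AE z in lborel. z \<in> D \<longrightarrow> f z = f0 z"
proof -
  have m: "(\<lambda>z. indicator D z *\<^sub>R f z) \<in> borel_measurable lebesgue"
    using f D by (subst borel_measurable_restrict_space_iff[symmetric]) auto
  have "\<exists>r\<in>borel_measurable lborel. AE z in lborel. (indicator D z *\<^sub>R f z) \<bullet> b = r z" for b
    by (rule completion_ex_borel_measurable_real) (use m in measurable)
  then obtain r where r: "\<And>b. r b \<in> borel_measurable lborel" "\<And>b. AE z in lborel. (indicator D z *\<^sub>R f z) \<bullet> b = r b z"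
    by metis
  have [measurable]: "r b \<in> borel_measurable borel" for b using r(1) by simp
  define f0 where "f0 z = indicator D z *\<^sub>R (\<Sum>b\<in>Basis. r b z *\<^sub>R b)" for z
  have "AE z in lborel. \<forall>b\<in>Basis. (indicator D z *\<^sub>R f z) \<bullet> b = r b z"
    using r(2) by (intro AE_finite_allI) auto
  then have "AE z in lborel. z \<in> D \<longrightarrow> f z = f0 z"
  proof eventually_elim
    case (elim z)
    show ?case
    proof
      assume z: "z \<in> D"
      have "f0 z = (\<Sum>b\<in>Basis. (f z \<bullet> b) *\<^sub>R b)"
        using elim z unfolding f0_def by (auto intro!: sum.cong)
      then show "f z = f0 z" by (simp add: euclidean_representation)
    qed
  qed
  moreover have "f0 \<in> borel_measurable borel" unfolding f0_def using D by measurable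
  ultimately show thesis by (intro that[of f0]) (auto simp: f0_def)
qed

lemma Lp_borel_rep:
  fixes f :: "'a::euclidean_space \<Rightarrow> 'b::euclidean_space"
  assumes D: "D \<in> sets borel" and f: "f \<in> Lp p D" and p: "0 < p"
  obtains f0 where "f0 \<in> borel_measurable borel" "\<And>z. z \<notin> D \<Longrightarrow> f0 z = 0" "AE z in lborel. z \<in> D \<longrightarrow> f z = f0 z"
    "(\<integral>\<^sup>+z. ennreal (norm (f0 z) powr p) \<partial>lborel) = ennreal (Lp_norm p D f powr p)"
proof -
  have fm: "f \<in> borel_measurable (lebesgue_on D)" and fi: "integrable (lebesgue_on D) (\<lambda>z. norm (f z) powr p)"
    using f by (auto simp: Lp_def)
  obtain f0 where f0[measurable]: "f0 \<in> borel_measurable borel" and 0: "\<And>z. z \<notin> D \<Longrightarrow> f0 z = 0"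
    and ae: "AE z in lborel. z \<in> D \<longrightarrow> f z = f0 z" using lebesgue_on_borel_rep[OF D fm] by metis
  have aep: "AE z in lborel. z \<in> D \<longrightarrow> norm (f z) powr p = norm (f0 z) powr p" using ae by eventually_elim auto
  have m: "(\<lambda>z. norm (f0 z) powr p) \<in> borel_measurable borel" by measurable
  have eq: "indicator D z * norm (f0 z) powr p = norm (f0 z) powr p" for z
    using 0[of z] by (cases "z \<in> D") auto
  note conv = lebesgue_on_lint_eq[OF D m aep, unfolded eq]
  have "(\<integral>\<^sup>+z. ennreal (norm (f0 z) powr p) \<partial>lborel) = ennreal (LINT z|lborel. norm (f0 z) powr p)"
    using conv(2) fi by (intro nn_integral_eq_integral) auto
  also have "(LINT z|lborel. norm (f0 z) powr p) = Lp_norm p D f powr p"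
    using p by (simp add: Lp_norm_def conv(1) powr_powr integral_nonneg)
  finally show thesis using f0 0 ae by (intro that) auto
qed

text \<open>The converse transfer, from a Borel representative back to the space on \<open>D\<close>.\<close>
lemma Lp_I:
  fixes f :: "'a::euclidean_space \<Rightarrow> 'b::euclidean_space"
  assumes D: "D \<in> sets borel" and f0[measurable]: "f0 \<in> borel_measurable borel" and 0: "\<And>z. z \<notin> D \<Longrightarrow> f0 z = 0"
    and ae: "AE z in lborel. z \<in> D \<longrightarrow> f z = f0 z" and p: "0 < p" and B: "0 \<le> B"
    and le: "(\<integral>\<^sup>+z. ennreal (norm (f0 z) powr p) \<partial>lborel) \<le> ennreal (B powr p)"
  shows "f \<in> Lp p D" "Lp_norm p D f \<le> B"
proof -
  have aep: "AE z in lborel. z \<in> D \<longrightarrow> norm (f z) powr p = norm (f0 z) powr p" using ae by eventually_elim auto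
  have m: "(\<lambda>z. norm (f0 z) powr p) \<in> borel_measurable borel" by measurable
  have eq: "indicator D z * norm (f0 z) powr p = norm (f0 z) powr p" for z
    using 0[of z] by (cases "z \<in> D") auto
  note conv = lebesgue_on_lint_eq[OF D m aep, unfolded eq]
  have int: "integrable lborel (\<lambda>z. norm (f0 z) powr p)"
    using le by (intro integrableI_bounded) (auto simp: top_unique less_top[symmetric])
  have "f0 \<in> borel_measurable lebesgue" using f0 by (intro measurable_completion) simp
  moreover have "AE z in lebesgue. f0 z = indicator D z *\<^sub>R f z"
    using AE_completion[OF ae] by eventually_elim (auto simp: 0 split: split_indicator)
  ultimately have "(\<lambda>z. indicator D z *\<^sub>R f z) \<in> borel_measurable lebesgue" by (rule borel_measurable_AE)
  then have "f \<in> borel_measurable (lebesgue_on D)"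
    using D by (subst borel_measurable_restrict_space_iff) auto
  then show "f \<in> Lp p D" using conv(2) int by (simp add: Lp_def)
  have "ennreal (LINT z|lborel. norm (f0 z) powr p) = (\<integral>\<^sup>+z. ennreal (norm (f0 z) powr p) \<partial>lborel)"
    using int by (intro nn_integral_eq_integral[symmetric]) auto
  with le have "ennreal (LINT z|lborel. norm (f0 z) powr p) \<le> ennreal (B powr p)" by simp
  then have "(LINT z|lborel. norm (f0 z) powr p) \<le> B powr p" by (subst (asm) ennreal_le_iff) auto
  then have "(LINT z|lborel. norm (f0 z) powr p) powr (1 / p) \<le> (B powr p) powr (1 / p)"
    using p by (intro powr_mono2) (auto intro: integral_nonneg)
  then show "Lp_norm p D f \<le> B" using p B by (simp add: Lp_norm_def conv(1) powr_powr)
qed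

section \<open>Riemann-Liouville integrals and their adjoints\<close>

text \<open>Exchanging \<open>s\<close> and \<open>t\<close> over triples \<open>((s,x),t)\<close>.\<close>
lemma nn_integral_swap3:
  fixes f :: "(real \<times> 'a::euclidean_space) \<times> real \<Rightarrow> ennreal"
  assumes f[measurable]: "f \<in> borel_measurable borel"
  shows "(\<integral>\<^sup>+w. f w \<partial>lborel) = (\<integral>\<^sup>+w. f ((snd w, snd (fst w)), fst (fst w)) \<partial>lborel)"
proof -
  have [measurable]: "f \<in> borel_measurable ((borel \<Otimes>\<^sub>M borel) \<Otimes>\<^sub>M borel)" by (simp add: borel_prod)
  have "(\<integral>\<^sup>+w. f w \<partial>lborel) = (\<integral>\<^sup>+z. \<integral>\<^sup>+t. f (z, t) \<partial>lborel \<partial>lborel)"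
    unfolding lborel_prod[symmetric] by (subst lborel.nn_integral_fst[symmetric]) auto
  also have "\<dots> = (\<integral>\<^sup>+s. \<integral>\<^sup>+x. \<integral>\<^sup>+t. f ((s, x), t) \<partial>lborel \<partial>lborel \<partial>lborel)"
    unfolding lborel_prod[symmetric] by (subst lborel.nn_integral_fst[symmetric]) auto
  also have "\<dots> = (\<integral>\<^sup>+s. \<integral>\<^sup>+t. \<integral>\<^sup>+x. f ((s, x), t) \<partial>lborel \<partial>lborel \<partial>lborel)"
    by (intro nn_integral_cong lborel_pair.Fubini') simp
  also have "\<dots> = (\<integral>\<^sup>+t. \<integral>\<^sup>+s. \<integral>\<^sup>+x. f ((s, x), t) \<partial>lborel \<partial>lborel \<partial>lborel)"
    by (intro lborel_pair.Fubini') simp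
  also have "\<dots> = (\<integral>\<^sup>+t. \<integral>\<^sup>+x. \<integral>\<^sup>+s. f ((s, x), t) \<partial>lborel \<partial>lborel \<partial>lborel)"
    by (intro nn_integral_cong lborel_pair.Fubini') simp
  also have "\<dots> = (\<integral>\<^sup>+z. \<integral>\<^sup>+s. f ((s, snd z), fst z) \<partial>lborel \<partial>lborel)"
    unfolding lborel_prod[symmetric] by (subst lborel.nn_integral_fst[symmetric]) auto
  also have "\<dots> = (\<integral>\<^sup>+w. f ((snd w, snd (fst w)), fst (fst w)) \<partial>lborel)"
    unfolding lborel_prod[symmetric] by (subst lborel.nn_integral_fst[symmetric]) auto
  finally show ?thesis .
qed

lemma distr_swap3:
  "distr lborel lborel (\<lambda>w. ((snd w, snd (fst w)), fst (fst w))) = (lborel :: ((real \<times> 'a::euclidean_space) \<times> real) measure)"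
proof (rule measure_eqI)
  fix A :: "((real \<times> 'a) \<times> real) set" assume "A \<in> sets (distr lborel lborel (\<lambda>w. ((snd w, snd (fst w)), fst (fst w))))"
  then have A[measurable]: "A \<in> sets borel" by simp
  have [measurable]: "(\<lambda>w::(real \<times> 'a) \<times> real. ((snd w, snd (fst w)), fst (fst w))) \<in> borel_measurable borel"
    unfolding borel_prod[symmetric] by measurable
  have "emeasure lborel A = (\<integral>\<^sup>+w. indicator A w \<partial>lborel)" by simp
  also have "\<dots> = (\<integral>\<^sup>+w. indicator A ((snd w, snd (fst w)), fst (fst w)) \<partial>lborel)"
    by (rule nn_integral_swap3) measurable
  also have "\<dots> = (\<integral>\<^sup>+w. indicator A w \<partial>distr lborel lborel (\<lambda>w. ((snd w, snd (fst w)), fst (fst w))))"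
    by (subst nn_integral_distr) auto
  finally show "emeasure (distr lborel lborel (\<lambda>w. ((snd w, snd (fst w)), fst (fst w)))) A = emeasure lborel A" by simp
qed simp

lemma swap3_integral:
  fixes f :: "(real \<times> 'a::euclidean_space) \<times> real \<Rightarrow> real"
  assumes f: "integrable lborel f"
  shows "integrable lborel (\<lambda>z. LINT t|lborel. f (z, t))"
    and "integrable lborel (\<lambda>z. LINT s|lborel. f ((s, snd z), fst z))"
    and "AE z in lborel. integrable lborel (\<lambda>s. f ((s, snd z), fst z))"
    and "(LINT z|lborel. LINT t|lborel. f (z, t)) = (LINT z|lborel. LINT s|lborel. f ((s, snd z), fst z))"
proof -
  define \<pi> :: "(real \<times> 'a) \<times> real \<Rightarrow> (real \<times> 'a) \<times> real" where "\<pi> w = ((snd w, snd (fst w)), fst (fst w))" for w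
  have [measurable]: "\<pi> \<in> borel_measurable borel"
    unfolding borel_prod[symmetric] \<pi>_def by measurable
  have d: "distr lborel lborel \<pi> = lborel" using distr_swap3 unfolding \<pi>_def .
  have [measurable]: "f \<in> borel_measurable borel" using f by auto
  have i2: "integrable lborel (\<lambda>w. f (\<pi> w))"
    using f integrable_distr_eq[of \<pi> lborel lborel f] by (simp add: d)
  have e: "(LINT w|lborel. f w) = (LINT w|lborel. f (\<pi> w))"
    using integral_distr[of \<pi> lborel lborel f] by (simp add: d)
  note f' = f[unfolded lborel_prod[symmetric, where 'b=real]]
  note i2' = i2[unfolded lborel_prod[symmetric, where 'b=real]]
  show "integrable lborel (\<lambda>z. LINT t|lborel. f (z, t))" by (rule lborel_pair.integrable_fst'[OF f'])
  show "integrable lborel (\<lambda>z. LINT s|lborel. f ((s, snd z), fst z))"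
    using lborel_pair.integrable_fst'[OF i2'] by (simp add: \<pi>_def)
  show "AE z in lborel. integrable lborel (\<lambda>s. f ((s, snd z), fst z))"
    using lborel_pair.AE_integrable_fst'[OF i2'] by (simp add: \<pi>_def)
  show "(LINT z|lborel. LINT t|lborel. f (z, t)) = (LINT z|lborel. LINT s|lborel. f ((s, snd z), fst z))"
    using lborel_pair.integral_fst'[OF f'] lborel_pair.integral_fst'[OF i2'] e by (simp add: \<pi>_def lborel_prod)
qed

text \<open>The Riemann-Liouville integral of order \<open>\<beta>\<close> in time, without the factor \<open>1 / Gamma \<beta>\<close>.\<close>
definition RL :: "real \<Rightarrow> (real \<times> 'a \<Rightarrow> real) \<Rightarrow> real \<times> 'a \<Rightarrow> real" where
  "RL \<beta> u z = (LINT s|lborel. (fst z - s) powr (\<beta> - 1) * indicator {0<..<fst z} s * u (s, snd z))"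

text \<open>The adjoint of \<open>RL\<close>, integrating over the future instead of the past and acting on functions of time only.
  In this translation invariant form derivatives pass under the integral.\<close>
definition RLback :: "real \<Rightarrow> (real \<Rightarrow> real) \<Rightarrow> real \<Rightarrow> real" where
  "RLback \<beta> w s = (LINT r|lborel. r powr (\<beta> - 1) * indicator {0<..} r * w (s + r))"

lemma RLback_eq: "RLback \<beta> w s = (LINT t|lborel. (t - s) powr (\<beta> - 1) * indicator {s<..} t * w t)"
proof -
  have "(LINT t|lborel. (t - s) powr (\<beta> - 1) * indicator {s<..} t * w t)
     = (LINT r|lborel. ((s + r) - s) powr (\<beta> - 1) * indicator {s<..} (s + r) * w (s + r))"
    using lborel_integral_real_affine[where c = 1 and t = s and f = "\<lambda>t. (t - s) powr (\<beta> - 1) * indicator {s<..} t * w t"]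
    by simp
  also have "\<dots> = RLback \<beta> w s" unfolding RLback_def
    by (intro Bochner_Integration.integral_cong) (auto split: split_indicator)
  finally show ?thesis by simp
qed

lemma nn_integral_kernel:
  fixes s T \<beta> :: real
  assumes "0 < \<beta>" "s \<le> T"
  shows "(\<integral>\<^sup>+t. ennreal ((t - s) powr (\<beta> - 1)) * indicator {s<..<T} t \<partial>lborel) = ennreal ((T - s) powr \<beta> / \<beta>)"
proof -
  have "(\<integral>\<^sup>+t. ennreal ((t - s) powr (\<beta> - 1)) * indicator {s<..<T} t \<partial>lborel)
    = (\<integral>\<^sup>+r. ennreal (((s + r) - s) powr (\<beta> - 1)) * indicator {s<..<T} (s + r) \<partial>lborel)"
    using nn_integral_real_affine[where c = 1 and t = s and f = "\<lambda>t. ennreal ((t - s) powr (\<beta> - 1)) * indicator {s<..<T} t"]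
    by simp
  also have "\<dots> = (\<integral>\<^sup>+r. ennreal (r powr (\<beta> - 1)) * indicator {0<..<T - s} r \<partial>lborel)"
    by (intro nn_integral_cong) (auto split: split_indicator)
  also have "\<dots> = ennreal ((T - s) powr \<beta> / \<beta>)" using assms by (intro nn_integral_powr_from_0) auto
  finally show ?thesis .
qed

text \<open>Fractional integration by parts is Fubini's theorem on triples: the weight \<open>w\<close> of the time at which
  \<open>RL\<close> is evaluated becomes a backward integral. The integrability of almost every slice is a by-product.\<close>
lemma RL_by_parts:
  fixes u :: "real \<times> 'a::euclidean_space \<Rightarrow> real" and b :: "'a \<Rightarrow> real" and w :: "real \<Rightarrow> real"
  assumes \<beta>: "0 < \<beta>" and u[measurable]: "u \<in> borel_measurable borel" and u0: "\<And>z. fst z \<notin> {0<..<T} \<Longrightarrow> u z = 0"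
    and b[measurable]: "b \<in> borel_measurable borel" and w[measurable]: "w \<in> borel_measurable borel"
    and W: "\<And>t. \<bar>w t\<bar> \<le> W" and wT: "\<And>t. T \<le> t \<Longrightarrow> w t = 0"
    and int: "integrable lborel (\<lambda>z. u z * b (snd z))"
  shows "integrable lborel (\<lambda>z. RL \<beta> u z * w (fst z) * b (snd z))"
    and "integrable lborel (\<lambda>z. u z * b (snd z) * RLback \<beta> w (fst z))"
    and "AE z in lborel. w (fst z) * b (snd z) \<noteq> 0 \<longrightarrow> integrable lborel (\<lambda>s. (fst z - s) powr (\<beta> - 1) * indicator {0<..<fst z} s * u (s, snd z))"
    and "(LINT z|lborel. RL \<beta> u z * w (fst z) * b (snd z)) = (LINT z|lborel. u z * b (snd z) * RLback \<beta> w (fst z))"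
proof -
  have W0: "0 \<le> W" using W[of 0] by simp
  have ub[measurable]: "(\<lambda>z. u z * b (snd z)) \<in> borel_measurable borel"
    using int by auto
  have [measurable]: "(\<lambda>z. u z * b (snd z)) \<in> borel_measurable (borel \<Otimes>\<^sub>M borel)" using ub by (simp add: borel_prod)
  define \<Phi> where "\<Phi> v = (snd v - fst (fst v)) powr (\<beta> - 1) * indicator {0<..} (snd v - fst (fst v)) * (u (fst v) * b (snd (fst v))) * w (snd v)" for v :: "(real \<times> 'a) \<times> real"
  have [measurable]: "(\<lambda>v::(real \<times> 'a) \<times> real. u (fst v) * b (snd (fst v))) \<in> borel_measurable ((borel \<Otimes>\<^sub>M borel) \<Otimes>\<^sub>M borel)"
    by (rule measurable_compose[OF measurable_fst]) measurable
  have "\<Phi> \<in> borel_measurable ((borel \<Otimes>\<^sub>M borel) \<Otimes>\<^sub>M borel)" unfolding \<Phi>_def by measurable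
  then have \<Phi>m: "\<Phi> \<in> borel_measurable borel" by (simp add: borel_prod)
  then have \<Phi>m'[measurable]: "\<Phi> \<in> borel_measurable (lborel \<Otimes>\<^sub>M lborel)" by (simp add: lborel_prod)
  have \<Phi>i: "integrable lborel \<Phi>"
  proof (rule integrableI_bounded)
    have "(\<integral>\<^sup>+v. ennreal (norm (\<Phi> v)) \<partial>lborel) = (\<integral>\<^sup>+z. \<integral>\<^sup>+t. ennreal (norm (\<Phi> (z, t))) \<partial>lborel \<partial>lborel)"
      unfolding lborel_prod[symmetric, where 'b=real] by (subst lborel.nn_integral_fst[symmetric]) auto
    also have "\<dots> \<le> (\<integral>\<^sup>+z. ennreal (W * (T powr \<beta> / \<beta>)) * ennreal (norm (u z * b (snd z))) \<partial>lborel)"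
    proof (rule nn_integral_mono)
      fix z :: "real \<times> 'a"
      show "(\<integral>\<^sup>+t. ennreal (norm (\<Phi> (z, t))) \<partial>lborel) \<le> ennreal (W * (T powr \<beta> / \<beta>)) * ennreal (norm (u z * b (snd z)))"
      proof (cases "fst z \<in> {0<..<T}")
        case True
        have "(\<integral>\<^sup>+t. ennreal (norm (\<Phi> (z, t))) \<partial>lborel)
          \<le> (\<integral>\<^sup>+t. ennreal (W * norm (u z * b (snd z))) * (ennreal ((t - fst z) powr (\<beta> - 1)) * indicator {fst z<..<T} t) \<partial>lborel)"
        proof (rule nn_integral_mono)
          fix t
          show "ennreal (norm (\<Phi> (z, t))) \<le> ennreal (W * norm (u z * b (snd z))) * (ennreal ((t - fst z) powr (\<beta> - 1)) * indicator {fst z<..<T} t)"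
          proof (cases "t \<in> {fst z<..<T}")
            case True
            have "norm (\<Phi> (z, t)) = ((t - fst z) powr (\<beta> - 1) * norm (u z * b (snd z))) * \<bar>w t\<bar>"
              using True by (simp add: \<Phi>_def abs_mult)
            also have "\<dots> \<le> ((t - fst z) powr (\<beta> - 1) * norm (u z * b (snd z))) * W"
              by (intro mult_left_mono W) auto
            finally have "norm (\<Phi> (z, t)) \<le> W * norm (u z * b (snd z)) * (t - fst z) powr (\<beta> - 1)" by (simp add: mult_ac)
            then show ?thesis using True W0 by (subst mult.assoc[symmetric]) (simp add: ennreal_leI flip: ennreal_mult)
          next
            case False
            then have "t - fst z \<le> 0 \<or> w t = 0" using wT by force
            then show ?thesis by (auto simp: \<Phi>_def)
          qed
        qed
        also have "\<dots> = ennreal (W * norm (u z * b (snd z))) * ennreal ((T - fst z) powr \<beta> / \<beta>)"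
          using True \<beta> by (subst nn_integral_cmult) (auto simp: nn_integral_kernel)
        also have "\<dots> = ennreal (W * norm (u z * b (snd z)) * ((T - fst z) powr \<beta> / \<beta>))"
          using W0 \<beta> by (subst ennreal_mult) auto
        also have "\<dots> \<le> ennreal (W * norm (u z * b (snd z)) * (T powr \<beta> / \<beta>))"
          using True \<beta> W0 by (intro ennreal_leI mult_left_mono divide_right_mono powr_mono2) auto
        also have "\<dots> = ennreal (W * (T powr \<beta> / \<beta>)) * ennreal (norm (u z * b (snd z)))"
          using W0 \<beta> by (subst ennreal_mult[symmetric]) (auto simp: mult_ac)
        finally show ?thesis .
      qed (simp add: \<Phi>_def u0)
    qed
    also have "\<dots> = ennreal (W * (T powr \<beta> / \<beta>)) * (\<integral>\<^sup>+z. ennreal (norm (u z * b (snd z))) \<partial>lborel)"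
      by (rule nn_integral_cmult) measurable
    also have "\<dots> < \<infinity>" using int by (auto simp: integrable_iff_bounded ennreal_mult_less_top)
    finally show "(\<integral>\<^sup>+v. ennreal (norm (\<Phi> v)) \<partial>lborel) < \<infinity>" .
  qed (use \<Phi>m in simp)
  have e1: "\<Phi> ((s, snd z), fst z) = ((fst z - s) powr (\<beta> - 1) * indicator {0<..<fst z} s * u (s, snd z)) * (w (fst z) * b (snd z))" for s and z :: "real \<times> 'a"
    using u0[of "(s, snd z)"] by (auto simp: \<Phi>_def split: split_indicator)
  have e2: "(LINT s|lborel. \<Phi> ((s, snd z), fst z)) = RL \<beta> u z * w (fst z) * b (snd z)" for z
    unfolding e1 RL_def integral_mult_left_zero by (simp only: mult.assoc)
  have e3: "(LINT t|lborel. \<Phi> (z, t)) = u z * b (snd z) * RLback \<beta> w (fst z)" for z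
  proof -
    have "(LINT t|lborel. \<Phi> (z, t)) = (LINT t|lborel. (u z * b (snd z)) * ((t - fst z) powr (\<beta> - 1) * indicator {fst z<..} t * w t))"
      by (intro Bochner_Integration.integral_cong) (auto simp: \<Phi>_def split: split_indicator)
    then show ?thesis by (simp add: RLback_eq)
  qed
  note sw = swap3_integral[OF \<Phi>i]
  show "integrable lborel (\<lambda>z. RL \<beta> u z * w (fst z) * b (snd z))" using sw(2) unfolding e2 .
  show "integrable lborel (\<lambda>z. u z * b (snd z) * RLback \<beta> w (fst z))" using sw(1) unfolding e3 .
  show "(LINT z|lborel. RL \<beta> u z * w (fst z) * b (snd z)) = (LINT z|lborel. u z * b (snd z) * RLback \<beta> w (fst z))"
    using sw(4) unfolding e2 e3 by simp
  show "AE z in lborel. w (fst z) * b (snd z) \<noteq> 0 \<longrightarrow> integrable lborel (\<lambda>s. (fst z - s) powr (\<beta> - 1) * indicator {0<..<fst z} s * u (s, snd z))"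
    using sw(3) unfolding e1 by eventually_elim auto
qed

text \<open>Dominated convergence for the singular kernel; the common support bound \<open>R\<close> makes the kernel integrable.\<close>
lemma RLback_dominated:
  fixes G :: "nat \<Rightarrow> real \<Rightarrow> real"
  assumes \<beta>: "0 < \<beta>" and [measurable]: "\<And>n. G n \<in> borel_measurable borel" "g \<in> borel_measurable borel"
    and lim: "\<And>r. (\<lambda>n. G n r) \<longlonglongrightarrow> g r" and W: "\<And>n r. \<bar>G n r\<bar> \<le> W" and R: "\<And>n r. R \<le> r \<Longrightarrow> G n r = 0" "0 \<le> R"
  shows "(\<lambda>n. LINT r|lborel. r powr (\<beta> - 1) * indicator {0<..} r * G n r) \<longlonglongrightarrow> (LINT r|lborel. r powr (\<beta> - 1) * indicator {0<..} r * g r)"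
proof (rule integral_dominated_convergence[where w = "\<lambda>r. W * (r powr (\<beta> - 1) * indicator {0<..<R} r)"])
  have "(\<integral>\<^sup>+r. ennreal (norm (r powr (\<beta> - 1) * indicator {0<..<R} r)) \<partial>lborel) = (\<integral>\<^sup>+r. ennreal (r powr (\<beta> - 1)) * indicator {0<..<R} r \<partial>lborel)"
    by (intro nn_integral_cong) (auto split: split_indicator)
  also have "\<dots> < \<infinity>" using \<beta> R by (subst nn_integral_powr_from_0) auto
  finally have "integrable lborel (\<lambda>r. r powr (\<beta> - 1) * indicator {0<..<R} r)" by (intro integrableI_bounded) auto
  then show "integrable lborel (\<lambda>r. W * (r powr (\<beta> - 1) * indicator {0<..<R} r))" by simp
  show "AE r in lborel. (\<lambda>n. r powr (\<beta> - 1) * indicator {0<..} r * G n r) \<longlonglongrightarrow> r powr (\<beta> - 1) * indicator {0<..} r * g r"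
    by (intro AE_I2 tendsto_intros lim)
  show "AE r in lborel. norm (r powr (\<beta> - 1) * indicator {0<..} r * G n r) \<le> W * (r powr (\<beta> - 1) * indicator {0<..<R} r)" for n
  proof (rule AE_I2)
    fix r :: real
    have "\<bar>G n r\<bar> * r powr (\<beta> - 1) \<le> W * r powr (\<beta> - 1)" by (intro mult_right_mono W) auto
    then show "norm (r powr (\<beta> - 1) * indicator {0<..} r * G n r) \<le> W * (r powr (\<beta> - 1) * indicator {0<..<R} r)"
      using R(1)[of r n] by (auto simp: abs_mult mult.commute split: split_indicator)
  qed
qed measurable

lemma compact_support_bounded:
  fixes f :: "'a::euclidean_space \<Rightarrow> real"
  assumes "continuous_on UNIV f" and 0: "\<And>z. z \<notin> cbox c d \<Longrightarrow> f z = 0"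
  shows "\<exists>W. \<forall>z. \<bar>f z\<bar> \<le> W"
proof -
  have "bounded (f ` cbox c d)"
    using assms(1) by (intro compact_imp_bounded compact_continuous_image) (auto intro: continuous_on_subset)
  then obtain W where W: "\<And>z. z \<in> cbox c d \<Longrightarrow> \<bar>f z\<bar> \<le> W" by (auto simp: bounded_iff)
  have "\<bar>f z\<bar> \<le> max W 0" for z using W[of z] 0[of z] by (cases "z \<in> cbox c d") auto
  then show ?thesis by blast
qed

lemma RLback_continuous:
  assumes \<beta>: "0 < \<beta>" and a: "continuous_on UNIV a" and 0: "\<And>t. t \<notin> {c..d} \<Longrightarrow> a t = 0"
  shows "continuous_on UNIV (RLback \<beta> a)"
proof -
  have [measurable]: "a \<in> borel_measurable borel" using a by (rule borel_measurable_continuous_onI)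
  have "\<exists>W. \<forall>z. \<bar>a z\<bar> \<le> W" by (rule compact_support_bounded[OF a, of c d]) (use 0 in simp)
  then obtain W where W: "\<And>z. \<bar>a z\<bar> \<le> W" by blast
  have "(\<lambda>n. RLback \<beta> a (X n)) \<longlonglongrightarrow> RLback \<beta> a s" if X: "X \<longlonglongrightarrow> s" for X s
  proof -
    have "Bseq X" using X by (intro convergent_imp_Bseq) (auto simp: convergent_def)
    then obtain K where K: "\<And>n. \<bar>X n\<bar> \<le> K" by (auto simp: Bseq_def)
    show ?thesis unfolding RLback_def
    proof (rule RLback_dominated[where W = W and R = "\<bar>d\<bar> + \<bar>K\<bar> + 1", OF \<beta>])
      show "(\<lambda>n. a (X n + r)) \<longlonglongrightarrow> a (s + r)" for r
        using a X by (intro continuous_on_tendsto_compose[OF a] tendsto_intros) auto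
      show "a (X n + r) = 0" if "\<bar>d\<bar> + \<bar>K\<bar> + 1 \<le> r" for n r
        using that K[of n] by (intro 0) (auto simp: abs_if split: if_splits)
    qed (use W in auto)
  qed
  then show ?thesis by (auto simp: continuous_on_sequentially o_def)
qed

lemma RLback_has_derivative:
  assumes \<beta>: "0 < \<beta>" and a: "\<And>t. (a has_real_derivative a' t) (at t)" and a': "continuous_on UNIV a'"
    and 0: "\<And>t. t \<notin> {c..d} \<Longrightarrow> a t = 0" "\<And>t. t \<notin> {c..d} \<Longrightarrow> a' t = 0"
  shows "(RLback \<beta> a has_real_derivative RLback \<beta> a' s) (at s)"
proof -
  have ca: "continuous_on UNIV a" using a by (intro continuous_at_imp_continuous_on ballI DERIV_isCont) auto
  have [measurable]: "a \<in> borel_measurable borel" "a' \<in> borel_measurable borel"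
    using ca a' by (auto intro: borel_measurable_continuous_onI)
  have "\<exists>W. \<forall>z. \<bar>a' z\<bar> \<le> W" by (rule compact_support_bounded[OF a', of c d]) (use 0 in simp)
  then obtain W where W: "\<And>z. \<bar>a' z\<bar> \<le> W" by blast
  have "\<exists>W. \<forall>z. \<bar>a z\<bar> \<le> W" by (rule compact_support_bounded[OF ca, of c d]) (use 0 in simp)
  then obtain W0 where W0: "\<And>z. \<bar>a z\<bar> \<le> W0" by blast
  have int: "integrable lborel (\<lambda>r. r powr (\<beta> - 1) * indicator {0<..} r * a (x + r))" for x
  proof (rule integrableI_bounded)
    have "(\<integral>\<^sup>+r. ennreal (norm (r powr (\<beta> - 1) * indicator {0<..} r * a (x + r))) \<partial>lborel)
       \<le> (\<integral>\<^sup>+r. ennreal W0 * (ennreal (r powr (\<beta> - 1)) * indicator {0<..<\<bar>d\<bar> + \<bar>x\<bar> + 1} r) \<partial>lborel)"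
    proof (rule nn_integral_mono)
      fix r :: real
      have "a (x + r) = 0" if "\<bar>d\<bar> + \<bar>x\<bar> + 1 \<le> r" using that by (intro 0) (auto simp: abs_if split: if_splits)
      moreover have "r powr (\<beta> - 1) * \<bar>a (x + r)\<bar> \<le> r powr (\<beta> - 1) * W0" by (intro mult_left_mono W0) auto
      moreover have "0 \<le> W0" using W0[of 0] by simp
      ultimately show "ennreal (norm (r powr (\<beta> - 1) * indicator {0<..} r * a (x + r))) \<le> ennreal W0 * (ennreal (r powr (\<beta> - 1)) * indicator {0<..<\<bar>d\<bar> + \<bar>x\<bar> + 1} r)"
        by (auto simp: abs_mult mult.commute ennreal_leI split: split_indicator simp flip: ennreal_mult)
    qed
    also have "\<dots> < \<infinity>" using \<beta> by (subst nn_integral_cmult) (auto simp: nn_integral_powr_from_0 ennreal_mult_less_top)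
    finally show "(\<integral>\<^sup>+r. ennreal (norm (r powr (\<beta> - 1) * indicator {0<..} r * a (x + r))) \<partial>lborel) < \<infinity>" .
  qed measurable
  have "(\<lambda>n. (RLback \<beta> a (s + X n) - RLback \<beta> a s) / X n) \<longlonglongrightarrow> RLback \<beta> a' s"
    if X: "X \<longlonglongrightarrow> 0" and Xn: "\<And>n. X n \<noteq> 0" for X
  proof -
    have "Bseq X" using X by (intro convergent_imp_Bseq) (auto simp: convergent_def)
    then obtain K where K: "\<And>n. \<bar>X n\<bar> \<le> K" by (auto simp: Bseq_def)
    have q: "(RLback \<beta> a (s + X n) - RLback \<beta> a s) / X n
       = (LINT r|lborel. r powr (\<beta> - 1) * indicator {0<..} r * ((a (s + r + X n) - a (s + r)) / X n))" for n
    proof -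
      have "RLback \<beta> a (s + X n) - RLback \<beta> a s
        = (LINT r|lborel. r powr (\<beta> - 1) * indicator {0<..} r * a (s + X n + r) - r powr (\<beta> - 1) * indicator {0<..} r * a (s + r))"
        unfolding RLback_def by (intro Bochner_Integration.integral_diff[symmetric] int)
      then have "(RLback \<beta> a (s + X n) - RLback \<beta> a s) / X n
        = (LINT r|lborel. (r powr (\<beta> - 1) * indicator {0<..} r * a (s + X n + r) - r powr (\<beta> - 1) * indicator {0<..} r * a (s + r)) / X n)" by simp
      also have "\<dots> = (LINT r|lborel. r powr (\<beta> - 1) * indicator {0<..} r * ((a (s + r + X n) - a (s + r)) / X n))"
        by (intro Bochner_Integration.integral_cong) (auto simp: algebra_simps diff_divide_distrib)
      finally show ?thesis .
    qed
    show ?thesis unfolding q unfolding RLback_def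
    proof (rule RLback_dominated[where W = W and R = "\<bar>d\<bar> + \<bar>s\<bar> + \<bar>K\<bar> + 1", OF \<beta>])
      show "(\<lambda>n. (a (s + r + X n) - a (s + r)) / X n) \<longlonglongrightarrow> a' (s + r)" for r
        using a[of "s + r", unfolded DERIV_def, THEN tendsto_at_iff_sequentially[THEN iffD1], rule_format, of X] X Xn
        by (simp add: o_def)
      show "\<bar>(a (s + r + X n) - a (s + r)) / X n\<bar> \<le> W" for n r
      proof -
        have "norm (a (s + r + X n) - a (s + r)) \<le> W * norm ((s + r + X n) - (s + r))"
          using W a by (intro field_differentiable_bound[of UNIV a a']) (auto intro: has_field_derivative_at_within)
        then show ?thesis using Xn[of n] by (simp add: divide_le_eq)
      qed
      show "(a (s + r + X n) - a (s + r)) / X n = 0" if "\<bar>d\<bar> + \<bar>s\<bar> + \<bar>K\<bar> + 1 \<le> r" for n r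
      proof -
        have "d < s + r" "d < s + r + X n" using that K[of n] by linarith+
        then show ?thesis by (simp add: 0)
      qed
    qed (use W in auto)
  qed
  then show ?thesis unfolding DERIV_def tendsto_at_iff_sequentially by (auto simp: o_def)
qed

lemma Ck_on_imp_continuous_on: "Ck_on k D f \<Longrightarrow> continuous_on D f"
proof (induction k)
  case (Suc k)
  show ?case using Suc.IH Ck_on_SucD[OF Suc.prems] .
qed simp

lemma Ck_on_Suc_real_derivative:
  fixes a :: "real \<Rightarrow> real"
  assumes a: "Ck_on (Suc k) UNIV a" and 0: "\<And>t. t \<notin> {c..d} \<Longrightarrow> a t = 0"
  shows "\<exists>D. (\<forall>t. (a has_real_derivative D t) (at t)) \<and> Ck_on k UNIV D \<and> (\<forall>t. t \<notin> {c..d} \<longrightarrow> D t = 0)"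
proof -
  obtain a1 where a1: "\<And>t. (a has_derivative a1 t) (at t)" "\<And>v. Ck_on k UNIV (\<lambda>t. a1 t v)" using a by auto
  define D where "D t = a1 t 1" for t
  have D: "(a has_real_derivative D t) (at t)" for t
  proof -
    have "a1 t h = D t * h" for h
      using linear_scale[OF has_derivative_linear[OF a1(1)[of t]], of h 1] by (simp add: D_def)
    then have "a1 t = (*) (D t)" by (rule ext)
    then show ?thesis using a1(1)[of t] by (simp add: has_field_derivative_def)
  qed
  have "D t = 0" if "t \<notin> {c..d}" for t
  proof -
    have "((\<lambda>_. 0) has_real_derivative D t) (at t)"
      by (rule has_field_derivative_transform_within_open[OF D, of "- {c..d}"]) (use that 0 in auto)
    then show ?thesis by (rule DERIV_unique[OF _ DERIV_const])
  qed
  moreover have "Ck_on k UNIV D" unfolding D_def[abs_def] by (rule a1(2))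
  ultimately show ?thesis using D by blast
qed

lemma Ck_on_RLback:
  assumes \<beta>: "0 < \<beta>" and 0: "\<And>t. t \<notin> {c..d} \<Longrightarrow> a t = 0"
  shows "Ck_on k UNIV a \<Longrightarrow> Ck_on k UNIV (RLback \<beta> a)"
  using 0
proof (induction k arbitrary: a)
  case 0
  then show ?case using RLback_continuous[OF \<beta>, of a c d] by simp
next
  case (Suc k)
  obtain D where "\<forall>t. (a has_real_derivative D t) (at t)" and Ck: "Ck_on k UNIV D" and "\<forall>t. t \<notin> {c..d} \<longrightarrow> D t = 0"
    using Ck_on_Suc_real_derivative[OF Suc.prems] by blast
  then have D: "\<And>t. (a has_real_derivative D t) (at t)" and D0: "\<And>t. t \<notin> {c..d} \<Longrightarrow> D t = 0" by blast+
  have "continuous_on UNIV D" by (rule Ck_on_imp_continuous_on[OF Ck])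
  have "(RLback \<beta> a has_real_derivative RLback \<beta> D t) (at t)" for t
    using RLback_has_derivative[OF \<beta> D \<open>continuous_on UNIV D\<close> Suc.prems(2) D0] by blast
  then have "(RLback \<beta> a has_derivative (\<lambda>v. RLback \<beta> D t * v)) (at t)" for t
    by (simp add: has_field_derivative_def)
  moreover have "Ck_on k UNIV (\<lambda>t. RLback \<beta> D t * v)" for v
    by (intro Ck_on_mult Ck_on_const Suc.IH[OF Ck D0])
  ultimately show ?case unfolding Ck_on.simps
    by (intro exI[of _ "\<lambda>t v. RLback \<beta> D t * v"]) auto
qed

text \<open>The substitution \<open>t = s + (\<sigma> - s) * \<tau>\<close> turns this into Euler's beta integral, and all powers of \<open>\<sigma> - s\<close> cancel.\<close>
lemma nn_integral_Beta_kernel: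
  fixes s \<sigma> \<alpha> :: real
  assumes \<alpha>: "0 < \<alpha>" "\<alpha> < 1" and s: "s < \<sigma>"
  shows "(\<integral>\<^sup>+t. ennreal ((t - s) powr (- \<alpha>) * (\<sigma> - t) powr (\<alpha> - 1)) * indicator {s<..<\<sigma>} t \<partial>lborel)
    = ennreal (Gamma (1 - \<alpha>) * Gamma \<alpha>)"
proof -
  define c where "c = \<sigma> - s"
  have c: "c > 0" using s by (simp add: c_def)
  have B: "Beta (1 - \<alpha>) \<alpha> = Gamma (1 - \<alpha>) * Gamma \<alpha>" by (simp add: Beta_def)
  have "(\<integral>\<^sup>+t. ennreal ((t - s) powr (- \<alpha>) * (\<sigma> - t) powr (\<alpha> - 1)) * indicator {s<..<\<sigma>} t \<partial>lborel)
    = ennreal \<bar>c\<bar> * (\<integral>\<^sup>+\<tau>. ennreal (((s + c * \<tau>) - s) powr (- \<alpha>) * (\<sigma> - (s + c * \<tau>)) powr (\<alpha> - 1)) * indicator {s<..<\<sigma>} (s + c * \<tau>) \<partial>lborel)"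
    using c by (intro nn_integral_real_affine) auto
  also have "\<dots> = (\<integral>\<^sup>+\<tau>. ennreal \<bar>c\<bar> * (ennreal (((s + c * \<tau>) - s) powr (- \<alpha>) * (\<sigma> - (s + c * \<tau>)) powr (\<alpha> - 1)) * indicator {s<..<\<sigma>} (s + c * \<tau>)) \<partial>lborel)"
    by (rule nn_integral_cmult[symmetric]) measurable
  also have "\<dots> = (\<integral>\<^sup>+\<tau>. ennreal (\<tau> powr ((1 - \<alpha>) - 1) * (1 - \<tau>) powr (\<alpha> - 1)) * indicator {0..1} \<tau> \<partial>lborel)"
  proof (rule nn_integral_cong_AE)
    show "AE \<tau> in lborel. ennreal \<bar>c\<bar> * (ennreal (((s + c * \<tau>) - s) powr (- \<alpha>) * (\<sigma> - (s + c * \<tau>)) powr (\<alpha> - 1)) * indicator {s<..<\<sigma>} (s + c * \<tau>))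
       = ennreal (\<tau> powr ((1 - \<alpha>) - 1) * (1 - \<tau>) powr (\<alpha> - 1)) * indicator {0..1} \<tau>"
      using AE_lborel_singleton[of "0::real"] AE_lborel_singleton[of "1::real"]
    proof eventually_elim
      case (elim \<tau>)
      have iff: "s + c * \<tau> \<in> {s<..<\<sigma>} \<longleftrightarrow> \<tau> \<in> {0<..<1}"
      proof -
        have "s + c * \<tau> < \<sigma> \<longleftrightarrow> c * \<tau> < c * 1" by (simp add: c_def) linarith
        then show ?thesis using c by (simp add: zero_less_mult_iff)
      qed
      show ?case
      proof (cases "\<tau> \<in> {0<..<1}")
        case True
        have "\<sigma> - (s + c * \<tau>) = c * (1 - \<tau>)" by (simp add: c_def algebra_simps)
        then have "c * (((s + c * \<tau>) - s) powr (- \<alpha>) * (\<sigma> - (s + c * \<tau>)) powr (\<alpha> - 1))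
          = (c * (c powr (- \<alpha>) * c powr (\<alpha> - 1))) * (\<tau> powr (- \<alpha>) * (1 - \<tau>) powr (\<alpha> - 1))"
          using c True by (simp add: powr_mult)
        also have "c powr (- \<alpha>) * c powr (\<alpha> - 1) = 1 / c"
          unfolding powr_add[symmetric] using c by (simp add: powr_minus_divide)
        finally have "c * (((s + c * \<tau>) - s) powr (- \<alpha>) * (\<sigma> - (s + c * \<tau>)) powr (\<alpha> - 1)) = \<tau> powr (- \<alpha>) * (1 - \<tau>) powr (\<alpha> - 1)"
          using c by simp
        then show ?thesis using iff c True by (simp flip: ennreal_mult)
      next
        case False
        then have "\<tau> \<notin> {0..1}" using elim by auto
        then have z2: "indicator {0..1} \<tau> = (0::ennreal)" by (rule indicator_simps(2))
        have "s + c * \<tau> \<notin> {s<..<\<sigma>}" using iff False by blast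
        then have z1: "indicator {s<..<\<sigma>} (s + c * \<tau>) = (0::ennreal)" by (rule indicator_simps(2))
        show ?thesis unfolding z1 z2 by simp
      qed
    qed
  qed
  also have "\<dots> = ennreal (Beta (1 - \<alpha>) \<alpha>)"
    using \<alpha> by (intro nn_integral_has_integral_lebesgue' has_integral_Beta_real) auto
  finally show ?thesis by (simp add: B)
qed

text \<open>The orders \<open>1 - \<alpha>\<close> and \<open>\<alpha>\<close> add up to one, so the two backward integrals compose to the ordinary integral
  over the future, which recovers \<open>a\<close> from its derivative.\<close>
lemma RLback_semigroup:
  assumes \<alpha>: "0 < \<alpha>" "\<alpha> < 1" and a: "\<And>t. (a has_real_derivative a' t) (at t)" and a': "continuous_on UNIV a'"
    and 0: "\<And>t. t \<notin> {c..d} \<Longrightarrow> a t = 0" "\<And>t. t \<notin> {c..d} \<Longrightarrow> a' t = 0"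
  shows "RLback (1 - \<alpha>) (RLback \<alpha> a') s = - (Gamma (1 - \<alpha>) * Gamma \<alpha>) * a s"
proof -
  define B where "B = Gamma (1 - \<alpha>) * Gamma \<alpha>"
  have B0: "B \<ge> 0" using \<alpha> by (simp add: B_def Gamma_real_pos less_imp_le)
  have [measurable]: "a' \<in> borel_measurable borel" using a' by (rule borel_measurable_continuous_onI)
  define k where "k \<sigma> t = (t - s) powr (- \<alpha>) * (\<sigma> - t) powr (\<alpha> - 1) * indicator {0<..} (t - s) * indicator {0<..} (\<sigma> - t)" for \<sigma> t
  have [measurable]: "(\<lambda>(\<sigma>, t). k \<sigma> t) \<in> borel_measurable (borel \<Otimes>\<^sub>M borel)" unfolding k_def by measurable
  have km[measurable]: "k \<sigma> \<in> borel_measurable borel" for \<sigma> unfolding k_def by measurable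
  have knn: "0 \<le> k \<sigma> t" for \<sigma> t by (simp add: k_def)
  have knk: "(\<integral>\<^sup>+t. ennreal (k \<sigma> t) \<partial>lborel) = ennreal (B * indicator {s<..} \<sigma>)" for \<sigma>
  proof (cases "s < \<sigma>")
    case True
    have "(\<integral>\<^sup>+t. ennreal (k \<sigma> t) \<partial>lborel) = (\<integral>\<^sup>+t. ennreal ((t - s) powr (- \<alpha>) * (\<sigma> - t) powr (\<alpha> - 1)) * indicator {s<..<\<sigma>} t \<partial>lborel)"
      by (intro nn_integral_cong) (auto simp: k_def split: split_indicator)
    then show ?thesis using nn_integral_Beta_kernel[OF \<alpha> True] True by (simp add: B_def)
  next
    case False
    then have "k \<sigma> t = 0" for t by (auto simp: k_def split: split_indicator)
    then show ?thesis using False by simp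
  qed
  have kint: "(LINT t|lborel. k \<sigma> t) = B * indicator {s<..} \<sigma>" for \<sigma>
    using knk[of \<sigma>] knn B0 by (intro integral_eq_nn_integral[THEN trans]) (auto simp: enn2real_ennreal)
  define \<Psi> where "\<Psi> \<sigma> t = k \<sigma> t * a' \<sigma>" for \<sigma> t
  obtain W where W: "\<And>z. \<bar>a' z\<bar> \<le> W"
  proof -
    have "\<exists>W. \<forall>z. \<bar>a' z\<bar> \<le> W" by (rule compact_support_bounded[OF a', of c d]) (use 0 in simp)
    then show ?thesis using that by blast
  qed
  have W0: "W \<ge> 0" using W[of 0] by simp
  have int: "integrable (lborel \<Otimes>\<^sub>M lborel) (\<lambda>(\<sigma>, t). \<Psi> \<sigma> t)"
  proof (rule integrableI_bounded)
    have "(\<integral>\<^sup>+w. ennreal (norm (case w of (\<sigma>, t) \<Rightarrow> \<Psi> \<sigma> t)) \<partial>(lborel \<Otimes>\<^sub>M lborel)) = (\<integral>\<^sup>+\<sigma>. \<integral>\<^sup>+t. ennreal (norm (\<Psi> \<sigma> t)) \<partial>lborel \<partial>lborel)"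
      unfolding \<Psi>_def by (subst lborel.nn_integral_fst[symmetric]) auto
    also have "\<dots> \<le> (\<integral>\<^sup>+\<sigma>. ennreal (W * B) * indicator {c..d} \<sigma> \<partial>lborel)"
    proof (rule nn_integral_mono)
      fix \<sigma>
      have "(\<integral>\<^sup>+t. ennreal (norm (\<Psi> \<sigma> t)) \<partial>lborel) = (\<integral>\<^sup>+t. ennreal \<bar>a' \<sigma>\<bar> * ennreal (k \<sigma> t) \<partial>lborel)"
        using knn by (intro nn_integral_cong) (simp add: \<Psi>_def abs_mult mult.commute flip: ennreal_mult)
      also have "\<dots> = ennreal \<bar>a' \<sigma>\<bar> * ennreal (B * indicator {s<..} \<sigma>)" by (simp add: nn_integral_cmult knk)
      also have "\<dots> = ennreal (\<bar>a' \<sigma>\<bar> * (B * indicator {s<..} \<sigma>))" using B0 by (intro ennreal_mult[symmetric]) auto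
      also have "\<dots> \<le> ennreal (W * B) * indicator {c..d} \<sigma>"
      proof -
        have "\<bar>a' \<sigma>\<bar> * (B * indicator {s<..} \<sigma>) \<le> \<bar>a' \<sigma>\<bar> * B" using B0 by (intro mult_left_mono) (auto split: split_indicator)
        moreover have "\<bar>a' \<sigma>\<bar> * B \<le> W * B" using W B0 by (intro mult_right_mono) auto
        ultimately show ?thesis using 0(2)[of \<sigma>] by (auto intro!: ennreal_leI split: split_indicator)
      qed
      finally show "(\<integral>\<^sup>+t. ennreal (norm (\<Psi> \<sigma> t)) \<partial>lborel) \<le> ennreal (W * B) * indicator {c..d} \<sigma>" .
    qed
    also have "\<dots> < \<infinity>" by (subst nn_integral_cmult_indicator) (auto simp: ennreal_mult_less_top emeasure_lborel_Icc_eq)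
    finally show "(\<integral>\<^sup>+w. ennreal (norm (case w of (\<sigma>, t) \<Rightarrow> \<Psi> \<sigma> t)) \<partial>(lborel \<Otimes>\<^sub>M lborel)) < \<infinity>" .
  qed (simp add: \<Psi>_def)
  have "RLback (1 - \<alpha>) (RLback \<alpha> a') s = (LINT t|lborel. LINT \<sigma>|lborel. \<Psi> \<sigma> t)"
    unfolding RLback_eq
  proof (rule Bochner_Integration.integral_cong)
    fix t :: real
    have "(t - s) powr (1 - \<alpha> - 1) * indicator {s<..} t * (LINT \<sigma>|lborel. (\<sigma> - t) powr (\<alpha> - 1) * indicator {t<..} \<sigma> * a' \<sigma>)
       = (LINT \<sigma>|lborel. (t - s) powr (1 - \<alpha> - 1) * indicator {s<..} t * ((\<sigma> - t) powr (\<alpha> - 1) * indicator {t<..} \<sigma> * a' \<sigma>))"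
      by simp
    also have "\<dots> = (LINT \<sigma>|lborel. \<Psi> \<sigma> t)"
      by (intro Bochner_Integration.integral_cong) (auto simp: \<Psi>_def k_def split: split_indicator)
    finally show "(t - s) powr (1 - \<alpha> - 1) * indicator {s<..} t * (LINT \<sigma>|lborel. (\<sigma> - t) powr (\<alpha> - 1) * indicator {t<..} \<sigma> * a' \<sigma>) = (LINT \<sigma>|lborel. \<Psi> \<sigma> t)" .
  qed simp
  also have "\<dots> = (LINT \<sigma>|lborel. LINT t|lborel. \<Psi> \<sigma> t)" by (rule lborel_pair.Fubini_integral[OF int])
  also have "\<dots> = (LINT \<sigma>|lborel. B * (a' \<sigma> * indicator {s..max s d + 1} \<sigma>))"
  proof (rule integral_cong_AE)
    show "AE \<sigma> in lborel. (LINT t|lborel. \<Psi> \<sigma> t) = B * (a' \<sigma> * indicator {s..max s d + 1} \<sigma>)"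
      using AE_lborel_singleton[of s]
    proof eventually_elim
      case (elim \<sigma>)
      have "a' \<sigma> = 0" if "\<sigma> > max s d + 1" using that by (intro 0) auto
      then show ?case using elim unfolding \<Psi>_def by (auto simp: kint split: split_indicator)
    qed
  qed (auto simp: \<Psi>_def kint)
  also have "\<dots> = B * (LINT \<sigma>|lborel. a' \<sigma> * indicator {s..max s d + 1} \<sigma>)" by simp
  also have "(LINT \<sigma>|lborel. a' \<sigma> * indicator {s..max s d + 1} \<sigma>) = a (max s d + 1) - a s"
    using a a' by (intro integral_FTC_Icc_real) (auto simp: continuous_on_eq_continuous_within intro: continuous_at_imp_continuous_at_within)
  also have "a (max s d + 1) = 0" by (rule 0) auto
  finally show ?thesis by (simp add: B_def)
qed

section \<open>Recovering a function from its fractional time derivative\<close>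

text \<open>Borel functions that represent \<open>f\<close> on \<open>D\<close> and vanish elsewhere, so that integrals over \<open>D\<close> become integrals
  over the whole space.\<close>
definition Lp_rep :: "real \<Rightarrow> 'a::euclidean_space set \<Rightarrow> ('a \<Rightarrow> 'b::euclidean_space) \<Rightarrow> ('a \<Rightarrow> 'b) \<Rightarrow> bool" where
  "Lp_rep p D f f0 \<longleftrightarrow> f0 \<in> borel_measurable borel \<and> (\<forall>z. z \<notin> D \<longrightarrow> f0 z = 0) \<and>
     (AE z in lborel. z \<in> D \<longrightarrow> f z = f0 z) \<and>
     (\<integral>\<^sup>+z. ennreal (norm (f0 z) powr p) \<partial>lborel) = ennreal (Lp_norm p D f powr p)"

lemma Lp_rep_exists: "D \<in> sets borel \<Longrightarrow> f \<in> Lp p D \<Longrightarrow> 0 < p \<Longrightarrow> \<exists>f0. Lp_rep p D f f0"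
  by (rule Lp_borel_rep) (auto simp: Lp_rep_def)

lemma cylinder_UNIV_iff: "z \<in> cylinder T UNIV \<longleftrightarrow> fst z \<in> {0<..<T}"
  by (cases z) (auto simp: cylinder_def)

lemma open_cylinder: "open (cylinder T (UNIV :: (real^'n) set))"
  unfolding cylinder_def by (intro open_Times) auto

lemma cylinder_borel: "cylinder T (UNIV :: (real^'n) set) \<in> sets borel"
  using open_cylinder by (rule borel_open)

lemma Lp_rep_locally_integrable:
  fixes f :: "real \<times> (real^'n) \<Rightarrow> 'b::euclidean_space"
  assumes rep: "Lp_rep p (cylinder T UNIV) f f0" and p: "1 \<le> p"
    and b[measurable]: "b \<in> borel_measurable borel" and B: "\<And>x. \<bar>b x\<bar> \<le> B" and b0: "\<And>x. x \<notin> cbox c d \<Longrightarrow> b x = 0"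
  shows "integrable lborel (\<lambda>z. norm (f0 z) * b (snd z))"
proof -
  have f0[measurable]: "f0 \<in> borel_measurable borel" and 0: "\<And>z. fst z \<notin> {0<..<T} \<Longrightarrow> f0 z = 0"
    and fin: "(\<integral>\<^sup>+z. ennreal (norm (f0 z) powr p) \<partial>lborel) < \<infinity>"
    using rep by (auto simp: Lp_rep_def cylinder_UNIV_iff)
  have B0: "0 \<le> B" using B[of undefined] by simp
  have [measurable]: "(\<lambda>z::real \<times> (real^'n). b (snd z)) \<in> borel_measurable borel"
    unfolding borel_prod[symmetric] by (rule measurable_compose[OF measurable_snd]) simp
  have "integrable lborel (\<lambda>z. norm (f0 z) powr p)" by (intro integrableI_bounded) (use fin in auto)
  moreover have "integrable lborel (indicator (cbox (0, c) (T, d)) :: real \<times> (real^'n) \<Rightarrow> real)"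
    using emeasure_bounded_finite[OF bounded_cbox, of "(0, c)" "(T, d)"]
    by (intro integrable_real_indicator) auto
  ultimately have "integrable lborel (\<lambda>z. B * (norm (f0 z) powr p + indicator (cbox (0, c) (T, d)) z))"
    by (intro integrable_mult_right Bochner_Integration.integrable_add)
  then show ?thesis
  proof (rule Bochner_Integration.integrable_bound)
    show "AE z in lborel. norm (norm (f0 z) * b (snd z)) \<le> norm (B * (norm (f0 z) powr p + indicator (cbox (0, c) (T, d)) z))"
    proof (rule AE_I2)
      fix z :: "real \<times> (real^'n)"
      show "norm (norm (f0 z) * b (snd z)) \<le> norm (B * (norm (f0 z) powr p + indicator (cbox (0, c) (T, d)) z))"
      proof (cases "fst z \<in> {0<..<T} \<and> snd z \<in> cbox c d")
        case True
        then have ind: "indicator (cbox (0, c) (T, d)) z = (1::real)" by (cases z) (auto simp: cbox_Pair_eq)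
        have "norm (f0 z) \<le> norm (f0 z) powr p + 1"
        proof (cases "norm (f0 z) \<le> 1")
          case False
          then have "norm (f0 z) powr 1 \<le> norm (f0 z) powr p" using p by (intro powr_mono) auto
          then show ?thesis by simp
        qed (simp add: add_increasing)
        then have "norm (f0 z) * \<bar>b (snd z)\<bar> \<le> (norm (f0 z) powr p + 1) * B" using B by (intro mult_mono) auto
        then show ?thesis using B0 ind by (simp add: abs_mult mult.commute)
      next
        case False
        then show ?thesis using 0[of z] b0[of "snd z"] B0 by auto
      qed
    qed
  qed measurable
qed

lemma Lp_rep_integrable_mult:
  fixes f :: "real \<times> (real^'n) \<Rightarrow> real"
  assumes rep: "Lp_rep p (cylinder T UNIV) f f0" and p: "1 \<le> p"
    and b: "b \<in> borel_measurable borel" and B: "\<And>x. \<bar>b x\<bar> \<le> B" and b0: "\<And>x. x \<notin> cbox c d \<Longrightarrow> b x = 0"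
  shows "integrable lborel (\<lambda>z. f0 z * b (snd z))"
proof (rule Bochner_Integration.integrable_bound[OF Lp_rep_locally_integrable[OF assms]])
  have [measurable]: "f0 \<in> borel_measurable borel" using rep by (simp add: Lp_rep_def)
  have [measurable]: "(\<lambda>z::real \<times> (real^'n). b (snd z)) \<in> borel_measurable borel"
    unfolding borel_prod[symmetric] by (rule measurable_compose[OF measurable_snd]) (use b in simp)
  show "(\<lambda>z. f0 z * b (snd z)) \<in> borel_measurable lborel" by measurable
qed (auto simp: abs_mult)

lemma AE_snd:
  assumes "AE x in lborel. P x"
  shows "AE z in (lborel :: ('b::euclidean_space \<times> 'a::euclidean_space) measure). P (snd z)"
proof -
  obtain N where N: "{x \<in> space lborel. \<not> P x} \<subseteq> N" "emeasure lborel N = 0" "N \<in> sets lborel" using assms by (rule AE_E)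
  then have "N \<in> null_sets lborel" by auto
  then have "UNIV \<times> N \<in> null_sets (lborel \<Otimes>\<^sub>M lborel :: ('b \<times> 'a) measure)"
    by (intro lborel.times_in_null_sets2) auto
  then have "AE z in (lborel :: ('b \<times> 'a) measure). z \<notin> UNIV \<times> N" unfolding lborel_prod by (rule AE_not_in)
  then show ?thesis by eventually_elim (use N(1) in auto)
qed

text \<open>The exceptional set is enlarged to a Borel null set first; the predicate itself need not be measurable.\<close>
lemma AE_slice:
  fixes P :: "'b::euclidean_space \<times> 'a::euclidean_space \<Rightarrow> bool"
  assumes "AE z in lborel. P z"
  shows "AE x in lborel. AE t in lborel. P (t, x)"
proof -
  obtain N where N: "{z \<in> space lborel. \<not> P z} \<subseteq> N" "emeasure lborel N = 0" "N \<in> sets lborel" using assms by (rule AE_E)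
  have [measurable]: "N \<in> sets (lborel \<Otimes>\<^sub>M lborel)" using N(3) unfolding lborel_prod .
  have "AE z in lborel. z \<notin> N" using N by (intro AE_not_in) auto
  then have "AE t in lborel. AE x in lborel. (t, x) \<notin> N" unfolding lborel_prod[symmetric] by (rule lborel_pair.AE_pair)
  moreover have "{w \<in> space (lborel \<Otimes>\<^sub>M lborel). w \<notin> N} \<in> sets (lborel \<Otimes>\<^sub>M lborel)" by measurable
  ultimately have "AE x in lborel. AE t in lborel. (t, x) \<notin> N"
    using lborel_pair.AE_commute[of "\<lambda>t x. (t, x) \<notin> N"] by (simp only: prod.collapse)
  then show ?thesis
  proof eventually_elim
    case (elim x)
    then show ?case by eventually_elim (use N(1) in auto)
  qed
qed

text \<open>The slice integrals may be computed from a Borel representative for almost every \<open>x\<close>, and they converge for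
  almost every \<open>(t,x)\<close>. The second part makes \<open>I0\<close> additive almost everywhere.\<close>
lemma I0_rep:
  fixes u :: "real \<times> (real^'n) \<Rightarrow> real"
  assumes rep: "Lp_rep p (cylinder T UNIV) u u0" and p: "1 \<le> p" and \<beta>: "0 < \<beta>"
  shows "AE z in lborel. z \<in> cylinder T UNIV \<longrightarrow> I0 \<beta> u z = 1 / Gamma \<beta> * RL \<beta> u0 z"
    and "AE z in lborel. z \<in> cylinder T UNIV \<longrightarrow> integrable (lebesgue_on {0<..<fst z}) (\<lambda>s. (fst z - s) powr (\<beta> - 1) * u (s, snd z))"
proof -
  have u0[measurable]: "u0 \<in> borel_measurable borel" and 0: "\<And>z. fst z \<notin> {0<..<T} \<Longrightarrow> u0 z = 0"
    and ae: "AE z in lborel. fst z \<in> {0<..<T} \<longrightarrow> u z = u0 z"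
    using rep by (auto simp: Lp_rep_def cylinder_UNIV_iff)
  have u0': "u0 \<in> borel_measurable (borel \<Otimes>\<^sub>M borel)" by (simp add: borel_prod)
  have good: "AE z in (lborel :: (real \<times> (real^'n)) measure). AE s in lborel. s \<in> {0<..<T} \<longrightarrow> u (s, snd z) = u0 (s, snd z)"
    using AE_slice[OF ae] by (intro AE_snd) simp
  have conv: "(LINT s|lebesgue_on {0<..<t}. (t - s) powr (\<beta> - 1) * u (s, x)) = RL \<beta> u0 (t, x)"
    "integrable (lebesgue_on {0<..<t}) (\<lambda>s. (t - s) powr (\<beta> - 1) * u (s, x)) \<longleftrightarrow> integrable lborel (\<lambda>s. (t - s) powr (\<beta> - 1) * indicator {0<..<t} s * u0 (s, x))"
    if x: "AE s in lborel. s \<in> {0<..<T} \<longrightarrow> u (s, x) = u0 (s, x)" and t: "t < T" for t x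
  proof -
    have [measurable]: "(\<lambda>s. u0 (s, x)) \<in> borel_measurable borel" by (rule measurable_compose[OF _ u0']) simp
    have m: "(\<lambda>s. (t - s) powr (\<beta> - 1) * u0 (s, x)) \<in> borel_measurable borel" by measurable
    have "AE s in lborel. s \<in> {0<..<t} \<longrightarrow> (t - s) powr (\<beta> - 1) * u (s, x) = (t - s) powr (\<beta> - 1) * u0 (s, x)"
      using x by eventually_elim (use t in auto)
    note c = lebesgue_on_lint_eq[OF _ m this]
    show "(LINT s|lebesgue_on {0<..<t}. (t - s) powr (\<beta> - 1) * u (s, x)) = RL \<beta> u0 (t, x)"
      using c(1) by (simp add: RL_def mult_ac)
    show "integrable (lebesgue_on {0<..<t}) (\<lambda>s. (t - s) powr (\<beta> - 1) * u (s, x)) \<longleftrightarrow> integrable lborel (\<lambda>s. (t - s) powr (\<beta> - 1) * indicator {0<..<t} s * u0 (s, x))"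
      using c(2) by (simp add: mult_ac)
  qed
  show "AE z in lborel. z \<in> cylinder T UNIV \<longrightarrow> I0 \<beta> u z = 1 / Gamma \<beta> * RL \<beta> u0 z"
    using good
  proof eventually_elim
    case (elim z)
    then show ?case using conv(1)[of "snd z" "fst z"] by (auto simp: cylinder_UNIV_iff I0_def case_prod_beta')
  qed
  define b where "b n = (indicator (cbox (- real n *\<^sub>R One) (real n *\<^sub>R One)) :: real^'n \<Rightarrow> real)" for n :: nat
  have "AE z in lborel. indicator {..<T} (fst z) * b n (snd z) \<noteq> 0 \<longrightarrow> integrable lborel (\<lambda>s. (fst z - s) powr (\<beta> - 1) * indicator {0<..<fst z} s * u0 (s, snd z))" for n
  proof (rule RL_by_parts(3)[OF \<beta> u0 0, where W = 1])
    show "integrable lborel (\<lambda>z. u0 z * b n (snd z))"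
      by (rule Lp_rep_integrable_mult[OF rep p, where B = 1]) (auto simp: b_def split: split_indicator)
  qed (auto simp: b_def split: split_indicator)
  then have "AE z in lborel. \<forall>n. indicator {..<T} (fst z) * b n (snd z) \<noteq> 0 \<longrightarrow> integrable lborel (\<lambda>s. (fst z - s) powr (\<beta> - 1) * indicator {0<..<fst z} s * u0 (s, snd z))"
    by (subst AE_all_countable) blast
  with good show "AE z in lborel. z \<in> cylinder T UNIV \<longrightarrow> integrable (lebesgue_on {0<..<fst z}) (\<lambda>s. (fst z - s) powr (\<beta> - 1) * u (s, snd z))"
  proof eventually_elim
    case (elim z)
    show ?case
    proof
      assume z: "z \<in> cylinder T UNIV"
      obtain n :: nat where n: "norm (snd z) \<le> real n" using real_arch_simple by blast
      have "\<bar>snd z \<bullet> i\<bar> \<le> real n" if "i \<in> Basis" for i using Basis_le_norm[OF that, of "snd z"] n by linarith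
      then have "snd z \<in> cbox (- real n *\<^sub>R One) (real n *\<^sub>R One)" by (auto simp: mem_box abs_le_iff minus_le_iff)
      then have "indicator {..<T} (fst z) * b n (snd z) \<noteq> 0" using z by (auto simp: b_def cylinder_UNIV_iff)
      then have "integrable lborel (\<lambda>s. (fst z - s) powr (\<beta> - 1) * indicator {0<..<fst z} s * u0 (s, snd z))" using elim(2) by blast
      then show "integrable (lebesgue_on {0<..<fst z}) (\<lambda>s. (fst z - s) powr (\<beta> - 1) * u (s, snd z))"
        using conv(2)[OF elim(1), of "fst z"] z by (auto simp: cylinder_UNIV_iff)
    qed
  qed
qed

lemma RL_measurable[measurable]:
  fixes u :: "real \<times> 'a::euclidean_space \<Rightarrow> real"
  assumes [measurable]: "u \<in> borel_measurable borel"
  shows "RL \<beta> u \<in> borel_measurable borel"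
proof -
  have "u \<in> borel_measurable (borel \<Otimes>\<^sub>M borel)" by (simp add: borel_prod)
  then have [measurable]: "(\<lambda>v::(real \<times> 'a) \<times> real. u (snd v, snd (fst v))) \<in> borel_measurable ((borel \<Otimes>\<^sub>M borel) \<Otimes>\<^sub>M borel)"
    by (rule measurable_compose[rotated]) measurable
  have "(\<lambda>v::(real \<times> 'a) \<times> real. (fst (fst v) - snd v) powr (\<beta> - 1) * (indicator {0<..} (snd v) * indicator {0<..} (fst (fst v) - snd v)) * u (snd v, snd (fst v)))
     \<in> borel_measurable ((borel \<Otimes>\<^sub>M borel) \<Otimes>\<^sub>M borel)" by measurable
  then have "(\<lambda>z. LINT s|lborel. (fst z - s) powr (\<beta> - 1) * (indicator {0<..} s * indicator {0<..} (fst z - s)) * u (s, snd z)) \<in> borel_measurable (borel \<Otimes>\<^sub>M borel)"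
    by (intro lborel.borel_measurable_lebesgue_integral) (simp add: case_prod_beta')
  also have "(\<lambda>z. LINT s|lborel. (fst z - s) powr (\<beta> - 1) * (indicator {0<..} s * indicator {0<..} (fst z - s)) * u (s, snd z)) = RL \<beta> u"
    unfolding RL_def by (intro ext Bochner_Integration.integral_cong) (auto split: split_indicator)
  finally show ?thesis by (simp add: borel_prod)
qed

lemma RLback_eq_0:
  assumes "\<And>t. d < t \<Longrightarrow> a t = 0" "d \<le> s"
  shows "RLback \<beta> a s = 0"
proof -
  have "r powr (\<beta> - 1) * indicator {0<..} r * a (s + r) = 0" for r
    using assms(1)[of "s + r"] assms(2) by (auto split: split_indicator)
  then show ?thesis unfolding RLback_def by (simp only:) simp
qed

lemma cbox_in_cylinder:
  fixes c2 d2 :: "real^'n"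
  assumes "cbox (c1, c2) (d1, d2) \<subseteq> cylinder T UNIV" "cbox (c1, c2) (d1, d2) \<noteq> {}"
  shows "0 < c1" "d1 < T" "c1 \<le> d1" "cbox c2 d2 \<noteq> {}"
proof -
  show "c1 \<le> d1" and ne: "cbox c2 d2 \<noteq> {}" using assms(2) by (auto simp: cbox_Pair_eq)
  then obtain x where "x \<in> cbox c2 d2" by blast
  then have "(c1, x) \<in> cylinder T UNIV" "(d1, x) \<in> cylinder T UNIV"
    using assms(1) \<open>c1 \<le> d1\<close> by (auto simp: cbox_Pair_eq)
  then show "0 < c1" "d1 < T" by (auto simp: cylinder_def)
qed

text \<open>A function is the fractional integral of its fractional time derivative. For a bump \<open>a\<close> in time and
  \<open>b\<close> in space, take the test function \<open>A(t) b(x)\<close>, where \<open>A\<close> is the backward integral of \<open>a\<close> of order \<open>\<alpha>\<close>.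
  Moving both fractional integrals to the test function, the left-hand side of the weak formulation becomes the integral of
  \<open>RL \<alpha> g * a * b\<close>, and the right-hand side, by \<open>RLback_semigroup\<close>, that of \<open>Gamma \<alpha> * u * a * b\<close>. It is
  essential that test functions may be nonzero at \<open>t = 0\<close>: this encodes the vanishing initial value.\<close>
theorem time_representation:
  fixes u g :: "real \<times> (real^'n) \<Rightarrow> real"
  assumes \<alpha>: "0 < \<alpha>" "\<alpha> < 1" and p: "1 \<le> p"
    and repu: "Lp_rep p (cylinder T UNIV) u u0" and repg: "Lp_rep p (cylinder T UNIV) g g0"
    and weak: "is_weak_dt_I0 \<alpha> p T UNIV u g"
  shows "AE z in lborel. z \<in> cylinder T UNIV \<longrightarrow> Gamma \<alpha> * u0 z = RL \<alpha> g0 z"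
proof -
  have u0[measurable]: "u0 \<in> borel_measurable borel" and u00: "\<And>z. fst z \<notin> {0<..<T} \<Longrightarrow> u0 z = 0"
    using repu by (auto simp: Lp_rep_def cylinder_UNIV_iff)
  have g0[measurable]: "g0 \<in> borel_measurable borel" and g00: "\<And>z. fst z \<notin> {0<..<T} \<Longrightarrow> g0 z = 0"
    and aeg: "AE z in lborel. z \<in> cylinder T UNIV \<longrightarrow> g z = g0 z"
    using repg by (auto simp: Lp_rep_def cylinder_UNIV_iff)
  have G0: "Gamma \<alpha> > 0" "Gamma (1 - \<alpha>) > 0" using \<alpha> by (auto intro: Gamma_real_pos)
  have sndm: "(\<lambda>z::real \<times> (real^'n). b (snd z)) \<in> borel_measurable borel" if "b \<in> borel_measurable borel" for b :: "real^'n \<Rightarrow> real"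
    unfolding borel_prod[symmetric] by (rule measurable_compose[OF measurable_snd]) (use that in simp)
  have fstm: "(\<lambda>z::real \<times> (real^'n). b (fst z)) \<in> borel_measurable borel" if "b \<in> borel_measurable borel" for b :: "real \<Rightarrow> real"
    unfolding borel_prod[symmetric] by (rule measurable_compose[OF measurable_fst]) (use that in simp)
  have "AE z in lborel. z \<in> cylinder T UNIV \<longrightarrow> Gamma \<alpha> * u0 z - RL \<alpha> g0 z = 0"
  proof (rule fundamental_lemma[OF open_cylinder])
    show "(\<lambda>z. Gamma \<alpha> * u0 z - RL \<alpha> g0 z) \<in> borel_measurable borel" by measurable
    fix c d :: "real \<times> (real^'n)" assume cd: "cbox c d \<subseteq> cylinder T UNIV"
    obtain c1 c2 d1 d2 where [simp]: "c = (c1, c2)" "d = (d1, d2)" by (cases c; cases d)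
    show "integrable lborel (\<lambda>z. indicator (cbox c d) z * (Gamma \<alpha> * u0 z - RL \<alpha> g0 z))"
    proof (cases "cbox c d = {}")
      case False
      note cc = cbox_in_cylinder[OF cd[simplified] False[simplified]]
      define b where "b = (indicator (cbox c2 d2) :: _ \<Rightarrow> real)"
      have [measurable]: "b \<in> borel_measurable borel" by (simp add: b_def)
      have b: "\<bar>b x\<bar> \<le> 1" "x \<notin> cbox c2 d2 \<Longrightarrow> b x = 0" for x by (auto simp: b_def split: split_indicator)
      have "integrable lborel (\<lambda>z. u0 z * b (snd z))" by (rule Lp_rep_integrable_mult[OF repu p _ b]) simp
      then have 1: "integrable lborel (\<lambda>z. indicator (cbox c d) z * u0 z)"
      proof (rule Bochner_Integration.integrable_bound)
        have "cbox c d \<in> sets borel" by (rule cbox_borel)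
        then show "(\<lambda>z. indicator (cbox c d) z * u0 z) \<in> borel_measurable lborel" by measurable
      qed (auto simp: b_def cbox_Pair_eq split: split_indicator)
      have "integrable lborel (\<lambda>z. RL \<alpha> g0 z * indicator {c1..d1} (fst z) * b (snd z))"
      proof (rule RL_by_parts(1)[OF \<alpha>(1) g0 g00, where W = 1])
        show "integrable lborel (\<lambda>z. g0 z * b (snd z))" by (rule Lp_rep_integrable_mult[OF repg p _ b]) simp
      qed (use cc in \<open>auto split: split_indicator\<close>)
      also have "(\<lambda>z. RL \<alpha> g0 z * indicator {c1..d1} (fst z) * b (snd z)) = (\<lambda>z. indicator (cbox c d) z * RL \<alpha> g0 z)"
        by (auto simp: fun_eq_iff b_def cbox_Pair_eq split: split_indicator)
      finally have 2: "integrable lborel (\<lambda>z. indicator (cbox c d) z * RL \<alpha> g0 z)" .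
      have "integrable lborel (\<lambda>z. Gamma \<alpha> * (indicator (cbox c d) z * u0 z) - indicator (cbox c d) z * RL \<alpha> g0 z)"
        by (intro Bochner_Integration.integrable_diff integrable_mult_right 1 2)
      then show ?thesis by (simp add: algebra_simps)
    qed simp
    fix n assume ne: "box c d \<noteq> {}"
    then have "cbox c d \<noteq> {}" using box_subset_cbox by blast
    note cc = cbox_in_cylinder[OF cd[simplified] this[simplified]]
    define a where "a = bump c1 d1 n"
    define b where "b = bump c2 d2 n"
    have am[measurable]: "a \<in> borel_measurable borel" and bm[measurable]: "b \<in> borel_measurable borel" by (simp_all add: a_def b_def)
    have a1: "\<bar>a t\<bar> \<le> 1" and a0: "t \<notin> {c1..d1} \<Longrightarrow> a t = 0" for t
      using bump_bounds[of c1 d1 n t] bump_eq_0[of t c1 d1 n] by (auto simp: a_def)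
    have b1: "\<bar>b x\<bar> \<le> 1" and b0: "x \<notin> cbox c2 d2 \<Longrightarrow> b x = 0" for x
      using bump_bounds[of c2 d2 n x] bump_eq_0[of x c2 d2 n] box_subset_cbox[of c2 d2] by (auto simp: b_def)
    have Cka: "Ck_on k UNIV a" for k unfolding a_def by (rule Ck_on_bump)
    obtain a' where "\<forall>t. (a has_real_derivative a' t) (at t)" "Ck_on 0 UNIV a'" "\<forall>t. t \<notin> {c1..d1} \<longrightarrow> a' t = 0"
      using Ck_on_Suc_real_derivative[OF Cka a0] by blast
    then have a': "\<And>t. (a has_real_derivative a' t) (at t)" "continuous_on UNIV a'" "\<And>t. t \<notin> {c1..d1} \<Longrightarrow> a' t = 0" by auto
    define A where "A = RLback \<alpha> a"
    define A' where "A' = RLback \<alpha> a'"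
    have dA: "(A has_real_derivative A' t) (at t)" for t
      unfolding A_def A'_def by (rule RLback_has_derivative[OF \<alpha>(1) a'(1,2) a0 a'(3)])
    have A0: "A t = 0" "A' t = 0" if "d1 \<le> t" for t
      unfolding A_def A'_def using that a0 a'(3) by (auto intro!: RLback_eq_0[of d1])
    have cA': "continuous_on UNIV A'" unfolding A'_def by (rule RLback_continuous[OF \<alpha>(1) a'(2,3)])
    have [measurable]: "A' \<in> borel_measurable borel" using cA' by (rule borel_measurable_continuous_onI)
    have cA: "continuous_on UNIV A" using dA by (intro continuous_at_imp_continuous_on ballI DERIV_isCont) auto
    have [measurable]: "A \<in> borel_measurable borel" using cA by (rule borel_measurable_continuous_onI)
    \<comment> \<open>\<open>\<phi>\<close> vanishes for \<open>t \<ge> d1\<close> but in general not at \<open>t = 0\<close>; the weak formulation allows this.\<close>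
    define \<phi> where "\<phi> z = A (fst z) * b (snd z)" for z
    have \<phi>m[measurable]: "\<phi> \<in> borel_measurable borel" unfolding \<phi>_def using sndm[OF bm] fstm[of A] by simp
    have Ckb: "Ck_on k D (\<lambda>z::real \<times> (real^'n). b (snd z))" for k D
      unfolding b_def by (rule Ck_on_compose[where l = snd and L = snd, OF _ Ck_on_bump]) (auto intro!: derivative_eq_intros)
    have "Ck_on k D \<phi>" for k D
      unfolding \<phi>_def[abs_def] A_def
      by (intro Ck_on_mult Ckb Ck_on_compose[where l = fst and L = fst and f = "RLback \<alpha> a"] Ck_on_RLback[OF \<alpha>(1) a0 Cka])
        (auto intro!: derivative_eq_intros)
    then have Cinf: "Cinf_on ({0..<T} \<times> UNIV) \<phi>" by (simp add: Cinf_on_def)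
    have sub: "closure {z \<in> {0..<T} \<times> UNIV. \<phi> z \<noteq> 0} \<subseteq> {0..d1} \<times> cbox c2 d2"
    proof (rule closure_minimal)
      show "closed ({0..d1} \<times> cbox c2 d2)" by (intro closed_Times) auto
      show "{z \<in> {0..<T} \<times> UNIV. \<phi> z \<noteq> 0} \<subseteq> {0..d1} \<times> cbox c2 d2"
      proof
        fix z assume z: "z \<in> {z \<in> {0..<T} \<times> UNIV. \<phi> z \<noteq> 0}"
        then have "0 \<le> fst z" "\<not> d1 \<le> fst z" "snd z \<in> cbox c2 d2"
          using A0(1)[of "fst z"] b0[of "snd z"] by (auto simp: \<phi>_def)
        then show "z \<in> {0..d1} \<times> cbox c2 d2" by (cases z) auto
      qed
    qed
    have "bounded ({0..d1} \<times> cbox c2 d2)" by (intro bounded_Times) auto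
    then have "bounded (closure {z \<in> {0..<T} \<times> UNIV. \<phi> z \<noteq> 0})"
      using sub by (rule bounded_subset)
    then have "compact (closure {z \<in> {0..<T} \<times> UNIV. \<phi> z \<noteq> 0})"
      by (simp add: compact_eq_bounded_closed)
    moreover have "{0..d1} \<times> cbox c2 d2 \<subseteq> {0..<T} \<times> UNIV" using cc by auto
    ultimately have test: "\<phi> \<in> test_functions ({0..<T} \<times> UNIV)"
      unfolding test_functions_def using Cinf sub by auto
    have fd: "frechet_derivative \<phi> (at z) (1, 0) = A' (fst z) * b (snd z)" for z
    proof -
      have "Ck_on (Suc 0) UNIV (\<lambda>z::real \<times> (real^'n). b (snd z))" by (rule Ckb)
      then obtain B' where B': "\<And>z::real \<times> (real^'n). ((\<lambda>z. b (snd z)) has_derivative B' z) (at z)" by auto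
      have "((\<lambda>h::real. b (snd (z + h *\<^sub>R (1, 0)))) has_derivative (\<lambda>h. B' (z + 0 *\<^sub>R (1, 0)) (h *\<^sub>R (1, 0)))) (at 0)"
        by (rule has_derivative_compose[where g = "\<lambda>z. b (snd z)"]) (auto intro!: derivative_eq_intros B')
      moreover have "z + (0, 0) = z" by (cases z) simp
      ultimately have "((\<lambda>h::real. b (snd z)) has_derivative (\<lambda>h. B' z (h *\<^sub>R (1, 0)))) (at 0)" by simp
      then have "(\<lambda>h. B' z (h *\<^sub>R (1, 0))) = (\<lambda>h. 0)"
        by (rule has_derivative_unique[OF _ has_derivative_const])
      from fun_cong[OF this, of 1] have B0: "B' z (1, 0) = 0" by simp
      have "((\<lambda>z::real \<times> (real^'n). A (fst z)) has_derivative (\<lambda>v. A' (fst z) * fst v)) (at z)"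
        using has_derivative_compose[OF has_derivative_fst[OF has_derivative_ident] dA[unfolded has_field_derivative_def], of z UNIV] by simp
      from has_derivative_mult[OF this B'] have "(\<phi> has_derivative (\<lambda>v. A (fst z) * B' z v + A' (fst z) * fst v * b (snd z))) (at z)"
        by (simp add: \<phi>_def[abs_def])
      then have "frechet_derivative \<phi> (at z) = (\<lambda>v. A (fst z) * B' z v + A' (fst z) * fst v * b (snd z))"
        by (rule frechet_derivative_at[symmetric])
      then show ?thesis by (simp add: B0)
    qed
    \<comment> \<open>\<open>A'\<close> does not have compact support in the past. Only times in \<open>(0,T)\<close> matter, and the
      truncation \<open>w\<close> is bounded, as \<open>RL_by_parts\<close> requires.\<close>
    define w where "w t = indicator {0..} t * A' t" for t
    have [measurable]: "w \<in> borel_measurable borel" unfolding w_def by measurable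
    have "bounded (A' ` {0..d1})" by (intro compact_imp_bounded compact_continuous_image continuous_on_subset[OF cA']) auto
    then have "\<exists>W. \<forall>t\<in>{0..d1}. \<bar>A' t\<bar> \<le> W" by (simp add: bounded_iff)
    then obtain W where W: "\<And>t. t \<in> {0..d1} \<Longrightarrow> \<bar>A' t\<bar> \<le> W" by blast
    have wW: "\<bar>w t\<bar> \<le> max W 0" for t using W[of t] A0(2)[of t] by (cases "t \<in> {0..d1}") (auto simp: w_def split: split_indicator)
    have wT: "w t = 0" if "T \<le> t" for t using that cc A0(2)[of t] by (simp add: w_def)
    have iub: "integrable lborel (\<lambda>z. u0 z * b (snd z))" by (rule Lp_rep_integrable_mult[OF repu p bm b1 b0])
    have igb: "integrable lborel (\<lambda>z. g0 z * b (snd z))" by (rule Lp_rep_integrable_mult[OF repg p bm b1 b0])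
    have aT: "a t = 0" if "T \<le> t" for t using that cc by (intro a0) auto
    note bp1 = RL_by_parts[OF \<alpha>(1) g0 g00 bm am a1 aT igb]
    have \<alpha>': "0 < 1 - \<alpha>" using \<alpha> by simp
    note bp2 = RL_by_parts[OF \<alpha>' u0 u00 bm \<open>w \<in> borel_measurable borel\<close> wW wT iub]
    have L: "(LINT z|lebesgue_on (cylinder T UNIV). g z * \<phi> z) = (LINT z|lborel. RL \<alpha> g0 z * a (fst z) * b (snd z))"
    proof -
      have "(LINT z|lebesgue_on (cylinder T UNIV). g z * \<phi> z) = (LINT z|lborel. indicator (cylinder T UNIV) z * (g0 z * \<phi> z))"
        by (rule lebesgue_on_lint_eq(1)[OF cylinder_borel]) (use aeg in auto)
      also have "\<dots> = (LINT z|lborel. g0 z * b (snd z) * RLback \<alpha> a (fst z))"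
        using g00 by (intro Bochner_Integration.integral_cong) (auto simp: \<phi>_def A_def cylinder_UNIV_iff split: split_indicator)
      finally show ?thesis using bp1(4) by simp
    qed
    have R: "(LINT z|lebesgue_on (cylinder T UNIV). I0 (1 - \<alpha>) u z * frechet_derivative \<phi> (at z) (1, 0))
       = - Gamma \<alpha> * (LINT z|lborel. u0 z * b (snd z) * a (fst z))"
    proof -
      have [measurable]: "(\<lambda>z::real \<times> (real^'n). A' (fst z) * b (snd z)) \<in> borel_measurable borel"
        using sndm[OF bm] fstm[of A'] by simp
      have "(LINT z|lebesgue_on (cylinder T UNIV). I0 (1 - \<alpha>) u z * frechet_derivative \<phi> (at z) (1, 0))
         = (LINT z|lborel. indicator (cylinder T UNIV) z * (1 / Gamma (1 - \<alpha>) * RL (1 - \<alpha>) u0 z * (A' (fst z) * b (snd z))))"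
      proof (rule lebesgue_on_lint_eq(1)[OF cylinder_borel])
        show "AE z in lborel. z \<in> cylinder T UNIV \<longrightarrow> I0 (1 - \<alpha>) u z * frechet_derivative \<phi> (at z) (1, 0) = 1 / Gamma (1 - \<alpha>) * RL (1 - \<alpha>) u0 z * (A' (fst z) * b (snd z))"
          using I0_rep(1)[OF repu p \<alpha>'] by eventually_elim (auto simp: fd)
      qed measurable
      also have "\<dots> = (LINT z|lborel. 1 / Gamma (1 - \<alpha>) * (RL (1 - \<alpha>) u0 z * w (fst z) * b (snd z)))"
      proof (rule Bochner_Integration.integral_cong)
        fix z :: "real \<times> (real^'n)"
        consider "fst z \<le> 0" | "0 < fst z" "fst z < T" | "T \<le> fst z" by linarith
        then show "indicator (cylinder T UNIV) z * (1 / Gamma (1 - \<alpha>) * RL (1 - \<alpha>) u0 z * (A' (fst z) * b (snd z))) = 1 / Gamma (1 - \<alpha>) * (RL (1 - \<alpha>) u0 z * w (fst z) * b (snd z))"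
        proof cases
          case 1
          then have "{0<..<fst z} = {}" by auto
          then have "RL (1 - \<alpha>) u0 z = 0" by (simp add: RL_def)
          then show ?thesis by simp
        next
          case 2
          then show ?thesis by (simp add: cylinder_UNIV_iff w_def)
        next
          case 3
          then have "A' (fst z) = 0" using cc by (intro A0) simp
          then show ?thesis by (simp add: w_def)
        qed
      qed simp
      also have "\<dots> = 1 / Gamma (1 - \<alpha>) * (LINT z|lborel. u0 z * b (snd z) * RLback (1 - \<alpha>) w (fst z))"
        using bp2(4) by simp
      also have "(LINT z|lborel. u0 z * b (snd z) * RLback (1 - \<alpha>) w (fst z))
         = (LINT z|lborel. - (Gamma (1 - \<alpha>) * Gamma \<alpha>) * (u0 z * b (snd z) * a (fst z)))"
      proof (rule Bochner_Integration.integral_cong)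
        fix z :: "real \<times> (real^'n)"
        show "u0 z * b (snd z) * RLback (1 - \<alpha>) w (fst z) = - (Gamma (1 - \<alpha>) * Gamma \<alpha>) * (u0 z * b (snd z) * a (fst z))"
        proof (cases "fst z \<in> {0<..<T}")
          case True
          have "RLback (1 - \<alpha>) w (fst z) = RLback (1 - \<alpha>) A' (fst z)"
            unfolding RLback_def using True by (intro Bochner_Integration.integral_cong) (auto simp: w_def split: split_indicator)
          also have "\<dots> = - (Gamma (1 - \<alpha>) * Gamma \<alpha>) * a (fst z)"
            unfolding A'_def by (rule RLback_semigroup[OF \<alpha> a'(1,2) a0 a'(3)])
          finally show ?thesis by simp
        qed (simp add: u00)
      qed simp
      also have "\<dots> = - (Gamma (1 - \<alpha>) * Gamma \<alpha>) * (LINT z|lborel. u0 z * b (snd z) * a (fst z))"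
        by (rule integral_mult_right_zero)
      finally show ?thesis using G0 by simp
    qed
    have "(LINT z|lebesgue_on (cylinder T UNIV). g z * \<phi> z) =
        - (LINT z|lebesgue_on (cylinder T UNIV). I0 (1 - \<alpha>) u z * frechet_derivative \<phi> (at z) (1, 0))"
      using weak test by (simp add: is_weak_dt_I0_def)
    then have eq: "(LINT z|lborel. RL \<alpha> g0 z * a (fst z) * b (snd z)) = Gamma \<alpha> * (LINT z|lborel. u0 z * b (snd z) * a (fst z))"
      unfolding L R by simp
    have iuab: "integrable lborel (\<lambda>z. u0 z * b (snd z) * a (fst z))"
    proof (rule Bochner_Integration.integrable_bound[OF iub])
      show "(\<lambda>z. u0 z * b (snd z) * a (fst z)) \<in> borel_measurable lborel" using sndm[OF bm] fstm[OF am] by simp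
      show "AE z in lborel. norm (u0 z * b (snd z) * a (fst z)) \<le> norm (u0 z * b (snd z))"
        using a1 by (intro AE_I2) (simp add: abs_mult mult_left_le)
    qed
    have "(LINT z|lborel. (Gamma \<alpha> * u0 z - RL \<alpha> g0 z) * bump c d n z)
      = (LINT z|lborel. Gamma \<alpha> * (u0 z * b (snd z) * a (fst z)) - RL \<alpha> g0 z * a (fst z) * b (snd z))"
    proof (rule Bochner_Integration.integral_cong)
      fix z :: "real \<times> (real^'n)"
      have "bump c d n z = a (fst z) * b (snd z)" using bump_prod[of c1 c2 d1 d2 n "fst z" "snd z"] by (simp add: a_def b_def)
      then show "(Gamma \<alpha> * u0 z - RL \<alpha> g0 z) * bump c d n z = Gamma \<alpha> * (u0 z * b (snd z) * a (fst z)) - RL \<alpha> g0 z * a (fst z) * b (snd z)"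
        by (simp add: algebra_simps)
    qed simp
    also have "\<dots> = Gamma \<alpha> * (LINT z|lborel. u0 z * b (snd z) * a (fst z)) - (LINT z|lborel. RL \<alpha> g0 z * a (fst z) * b (snd z))"
      using iuab bp1(1) by simp
    also have "\<dots> = 0" using eq by simp
    finally show "(LINT z|lborel. (Gamma \<alpha> * u0 z - RL \<alpha> g0 z) * bump c d n z) = 0" .
  qed
  then show ?thesis by eventually_elim auto
qed

section \<open>Weak and classical spatial gradients\<close>

lemma integral_translation:
  fixes f :: "'a::euclidean_space \<Rightarrow> real"
  assumes f: "integrable lborel f"
  shows "integrable lborel (\<lambda>z. f (z + c))" "(LINT z|lborel. f (z + c)) = (LINT z|lborel. f z)"
proof -
  have [measurable]: "f \<in> borel_measurable borel" using f by auto
  have d: "distr lborel lborel (\<lambda>z. z + c) = (lborel :: 'a measure)"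
    using lborel_distr_plus[of c] by (simp add: add.commute cong: distr_cong)
  show "integrable lborel (\<lambda>z. f (z + c))"
    using f integrable_distr_eq[of "\<lambda>z. z + c" lborel lborel f] by (simp add: d)
  show "(LINT z|lborel. f (z + c)) = (LINT z|lborel. f z)"
    using integral_distr[of "\<lambda>z. z + c" lborel lborel f] by (simp add: d)
qed

lemma derivative_eq_0_outside:
  fixes f :: "'a::euclidean_space \<Rightarrow> real"
  assumes f: "(f has_derivative F) (at z)" and 0: "\<And>z. z \<notin> K \<Longrightarrow> f z = 0" and K: "closed K" "z \<notin> K"
  shows "F v = 0"
proof -
  have "((\<lambda>_. 0) has_derivative F) (at z)"
    by (rule has_derivative_transform_within_open[OF f, of "- K"]) (use 0 K in auto)
  then have "F = (\<lambda>_. 0)" by (rule has_derivative_unique[OF _ has_derivative_const])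
  then show ?thesis by simp
qed

lemma compact_support_integrable:
  fixes f :: "'a::euclidean_space \<Rightarrow> real"
  assumes f: "continuous_on UNIV f" and 0: "\<And>z. z \<notin> cbox c d \<Longrightarrow> f z = 0"
  shows "integrable lborel f"
proof -
  have [measurable]: "f \<in> borel_measurable borel" using f by (rule borel_measurable_continuous_onI)
  obtain W where W: "\<And>z. \<bar>f z\<bar> \<le> W" using compact_support_bounded[OF f 0] by blast
  have "integrable lborel (indicator (cbox c d) :: 'a \<Rightarrow> real)"
    using emeasure_bounded_finite[OF bounded_cbox, of c d] by (intro integrable_real_indicator) auto
  then have "integrable lborel (\<lambda>z. W * indicator (cbox c d) z)" by simp
  then show ?thesis
  proof (rule Bochner_Integration.integrable_bound)
    show "AE z in lborel. norm (f z) \<le> norm (W * indicator (cbox c d) z)"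
    proof (rule AE_I2)
      fix z
      show "norm (f z) \<le> norm (W * indicator (cbox c d) z)"
        using W[of z] 0[of z] by (cases "z \<in> cbox c d") auto
    qed
  qed simp
qed

text \<open>Difference quotients have integral zero by translation invariance.\<close>
lemma integral_derivative_eq_0:
  fixes f :: "'a::euclidean_space \<Rightarrow> real"
  assumes f: "\<And>z. (f has_derivative F z) (at z)" and F: "continuous_on UNIV (\<lambda>z. F z v)"
    and 0: "\<And>z. z \<notin> cbox c d \<Longrightarrow> f z = 0"
  shows "(LINT z|lborel. F z v) = 0"
proof -
  have cf: "continuous_on UNIV f" using f by (intro continuous_at_imp_continuous_on ballI has_derivative_continuous)
  have F0: "F z v = 0" if "z \<notin> cbox c d" for z by (rule derivative_eq_0_outside[OF f 0 closed_cbox that])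
  have [measurable]: "f \<in> borel_measurable borel" "(\<lambda>z. F z v) \<in> borel_measurable borel"
    using cf F by (auto intro: borel_measurable_continuous_onI)
  obtain W where W: "\<And>z. \<bar>F z v\<bar> \<le> W" using compact_support_bounded[OF F F0] by blast
  have fi: "integrable lborel f" by (rule compact_support_integrable[OF cf 0])
  obtain R where R: "\<And>z. z \<in> cbox c d \<Longrightarrow> norm z \<le> R" using bounded_cbox[of c d] by (auto simp: bounded_iff)
  have dir: "((\<lambda>h. f (z + h *\<^sub>R v)) has_real_derivative F (z + h *\<^sub>R v) v) (at h)" for z h
  proof -
    have "((\<lambda>h. f (z + h *\<^sub>R v)) has_derivative (\<lambda>k. F (z + h *\<^sub>R v) (k *\<^sub>R v))) (at h)"
      by (rule has_derivative_compose[OF _ f]) (auto intro!: derivative_eq_intros)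
    moreover have "F (z + h *\<^sub>R v) (k *\<^sub>R v) = F (z + h *\<^sub>R v) v * k" for k
      using linear_scale[OF has_derivative_linear[OF f]] by simp
    ultimately show ?thesis by (simp add: has_field_derivative_def)
  qed
  define X where "X n = inverse (real (Suc n))" for n
  have X0: "X \<longlonglongrightarrow> 0" using LIMSEQ_inverse_real_of_nat unfolding X_def[abs_def] .
  have X: "X n \<noteq> 0" "0 < X n" "X n \<le> 1" for n
    by (auto simp: X_def inverse_le_1_iff)
  define q where "q n z = (f (z + X n *\<^sub>R v) - f z) / X n" for n z
  have q0: "(LINT z|lborel. q n z) = 0" for n
    using integral_translation[OF fi, of "X n *\<^sub>R v"] fi by (simp add: q_def)
  have "(\<lambda>n. LINT z|lborel. q n z) \<longlonglongrightarrow> (LINT z|lborel. F z v)"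
  proof (rule integral_dominated_convergence[where w = "\<lambda>z. W * indicator (cball 0 (R + norm v)) z"])
    have "integrable lborel (indicator (cball 0 (R + norm v)) :: 'a \<Rightarrow> real)"
      using emeasure_bounded_finite[OF bounded_cball, of "0::'a" "R + norm v"] by (intro integrable_real_indicator) auto
    then show "integrable lborel (\<lambda>z::'a. W * indicator (cball 0 (R + norm v)) z)" by simp
    show "AE z in lborel. (\<lambda>n. q n z) \<longlonglongrightarrow> F z v"
    proof (rule AE_I2)
      fix z
      have "((\<lambda>h. (f (z + (0 + h) *\<^sub>R v) - f (z + 0 *\<^sub>R v)) / h) \<longlongrightarrow> F (z + 0 *\<^sub>R v) v) (at 0)"
        using dir[of z 0] by (simp only: DERIV_def)
      then show "(\<lambda>n. q n z) \<longlonglongrightarrow> F z v"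
        unfolding tendsto_at_iff_sequentially using X0 X(1) by (auto simp: q_def o_def)
    qed
    show "AE z in lborel. norm (q n z) \<le> W * indicator (cball 0 (R + norm v)) z" for n
    proof (rule AE_I2)
      fix z
      have "norm (f (z + X n *\<^sub>R v) - f (z + 0 *\<^sub>R v)) \<le> W * norm (X n - 0)"
        by (rule field_differentiable_bound[of UNIV "\<lambda>h. f (z + h *\<^sub>R v)" "\<lambda>h. F (z + h *\<^sub>R v) v"])
          (use dir W in \<open>auto intro: has_field_derivative_at_within\<close>)
      then have le: "norm (q n z) \<le> W" using X(2)[of n] by (simp add: q_def divide_le_eq)
      show "norm (q n z) \<le> W * indicator (cball 0 (R + norm v)) z"
      proof (cases "z \<in> cball 0 (R + norm v)")
        case False
        then have nz: "R + norm v < norm z" by simp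
        have "norm (X n *\<^sub>R v) \<le> norm v" using X(2,3)[of n] by (simp add: mult_le_cancel_right1 mult_left_le_one_le)
        moreover have "norm z \<le> norm (z + X n *\<^sub>R v) + norm (X n *\<^sub>R v)"
          using norm_triangle_ineq4[of "z + X n *\<^sub>R v" "X n *\<^sub>R v"] by simp
        ultimately have "R < norm (z + X n *\<^sub>R v)" "R < norm z" using nz norm_ge_zero[of v] by linarith+
        then have "z + X n *\<^sub>R v \<notin> cbox c d" "z \<notin> cbox c d" using R by (meson not_le)+
        then show ?thesis using False by (simp add: q_def 0)
      qed (use le in simp)
    qed
  qed (simp_all add: q_def)
  then show ?thesis unfolding q0 by (simp add: LIMSEQ_const_iff)
qed

text \<open>For a function that is \<open>C^1\<close> on the closed strip, every weak gradient agrees with the classical one, by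
  integration by parts against the bumps.\<close>
lemma gradient_unique:
  fixes U :: "real \<times> (real^'n) \<Rightarrow> real"
  assumes U': "\<And>z. z \<in> {0..T} \<times> UNIV \<Longrightarrow> (U has_derivative U' z) (at z within {0..T} \<times> UNIV)"
    and cU': "\<And>v. continuous_on ({0..T} \<times> UNIV) (\<lambda>z. U' z v)"
    and weak: "is_weak_Dx p T UNIV U G" and p: "1 \<le> p" and rep: "Lp_rep p (cylinder T UNIV) G G0"
  shows "AE z in lborel. z \<in> cylinder T UNIV \<longrightarrow> (\<forall>i. G0 z $ i = U' z (0, axis i 1))"
proof -
  let ?C = "cylinder T (UNIV :: (real^'n) set)"
  have C: "?C \<subseteq> {0..T} \<times> UNIV" by (auto simp: cylinder_def)
  have G0[measurable]: "G0 \<in> borel_measurable borel" and aeG: "AE z in lborel. z \<in> ?C \<longrightarrow> G z = G0 z"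
    using rep by (auto simp: Lp_rep_def)
  have dU: "(U has_derivative U' z) (at z)" if "z \<in> ?C" for z
  proof -
    have "at z within {0..T} \<times> UNIV = at z" by (rule at_within_open_subset[OF that open_cylinder C])
    then show ?thesis using U'[of z] that C by auto
  qed
  have contU: "continuous_on ?C U" using dU by (intro continuous_at_imp_continuous_on ballI has_derivative_continuous)
  have cont: "continuous_on ?C (\<lambda>z. U' z v)" for v by (rule continuous_on_subset[OF cU' C])
  have "AE z in lborel. z \<in> ?C \<longrightarrow> G0 z $ i - indicator ?C z *\<^sub>R U' z (0, axis i 1) = 0" for i
  proof (rule fundamental_lemma[OF open_cylinder])
    define e :: "real \<times> (real^'n)" where "e = (0, axis i 1)"
    have dm[measurable]: "(\<lambda>z. indicator ?C z *\<^sub>R U' z v) \<in> borel_measurable borel" for v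
      by (rule borel_measurable_continuous_on_indicator[OF cylinder_borel cont])
    have Gi[measurable]: "(\<lambda>z. G0 z $ i) \<in> borel_measurable borel"
      using borel_measurable_inner[OF G0 borel_measurable_const, of "axis i 1"] by (simp add: inner_axis)
    show "(\<lambda>z. G0 z $ i - indicator ?C z *\<^sub>R U' z (0, axis i 1)) \<in> borel_measurable borel" by measurable
    fix c d :: "real \<times> (real^'n)" assume cd: "cbox c d \<subseteq> ?C"
    obtain c1 c2 d1 d2 where cd2: "c = (c1, c2)" "d = (d1, d2)" by (cases c; cases d)
    have 1: "integrable lborel (\<lambda>z. indicator (cbox c d) z * G0 z $ i)"
    proof (rule Bochner_Integration.integrable_bound)
      show "integrable lborel (\<lambda>z. norm (G0 z) * indicator (cbox c2 d2) (snd z))"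
        by (rule Lp_rep_locally_integrable[OF rep p, where B = 1]) (auto split: split_indicator)
      have "cbox c d \<in> sets borel" by (rule cbox_borel)
      then show "(\<lambda>z. indicator (cbox c d) z * G0 z $ i) \<in> borel_measurable lborel" by measurable
      show "AE z in lborel. norm (indicator (cbox c d) z * G0 z $ i) \<le> norm (norm (G0 z) * indicator (cbox c2 d2) (snd z))"
        using component_le_norm_cart[of "G0 z" i for z] by (intro AE_I2) (auto simp: cd2 cbox_Pair_eq split: split_indicator)
    qed
    have 2: "integrable lborel (\<lambda>z. indicator (cbox c d) z * U' z v)" for v
    proof -
      have "set_integrable lborel (cbox c d) (\<lambda>z. U' z v)"
        by (rule borel_integrable_compact[OF compact_cbox continuous_on_subset[OF cont cd], unfolded set_integrable_def[symmetric]])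
      then show ?thesis by (simp add: set_integrable_def)
    qed
    have "integrable lborel (\<lambda>z. indicator (cbox c d) z * G0 z $ i - indicator (cbox c d) z * U' z e)"
      by (intro Bochner_Integration.integrable_diff 1 2)
    also have "(\<lambda>z. indicator (cbox c d) z * G0 z $ i - indicator (cbox c d) z * U' z e) = (\<lambda>z. indicator (cbox c d) z * (G0 z $ i - indicator ?C z *\<^sub>R U' z (0, axis i 1)))"
      using cd by (auto simp: fun_eq_iff e_def split: split_indicator)
    finally show "integrable lborel (\<lambda>z. indicator (cbox c d) z * (G0 z $ i - indicator ?C z *\<^sub>R U' z (0, axis i 1)))" .
    fix n
    define \<phi> where "\<phi> = bump c d n"
    have \<phi>m[measurable]: "\<phi> \<in> borel_measurable borel" by (simp add: \<phi>_def)
    have \<phi>0: "\<phi> z = 0" if "z \<notin> cbox c d" for z using that bump_eq_0[of z c d n] box_subset_cbox[of c d] by (auto simp: \<phi>_def)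
    have \<phi>1: "\<bar>\<phi> z\<bar> \<le> 1" for z using bump_bounds[of c d n z] by (simp add: \<phi>_def)
    have "Ck_on (Suc 0) UNIV \<phi>" unfolding \<phi>_def by (rule Ck_on_bump)
    then obtain \<phi>' where \<phi>': "\<And>z. (\<phi> has_derivative \<phi>' z) (at z)" "\<And>v. continuous_on UNIV (\<lambda>z. \<phi>' z v)" by auto
    have \<phi>c: "continuous_on UNIV \<phi>" using \<phi>' by (intro continuous_at_imp_continuous_on ballI has_derivative_continuous)
    have \<phi>'0: "\<phi>' z v = 0" if "z \<notin> cbox c d" for z v by (rule derivative_eq_0_outside[OF \<phi>'(1) \<phi>0 closed_cbox that])
    have [measurable]: "(\<lambda>z. \<phi>' z v) \<in> borel_measurable borel" for v using \<phi>'(2) by (rule borel_measurable_continuous_onI)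
    have sub: "closure {z \<in> ?C. \<phi> z \<noteq> 0} \<subseteq> cbox c d"
      using \<phi>0 by (intro closure_minimal) auto
    have "bounded (closure {z \<in> ?C. \<phi> z \<noteq> 0})" by (rule bounded_subset[OF bounded_cbox sub])
    then have test: "\<phi> \<in> test_functions ?C"
      unfolding test_functions_def Cinf_on_def using sub cd by (auto simp: compact_eq_bounded_closed \<phi>_def Ck_on_bump)
    have fd: "frechet_derivative \<phi> (at z) = \<phi>' z" for z using frechet_derivative_at[OF \<phi>'(1)] by simp
    \<comment> \<open>Extended by zero, \<open>U * \<phi>\<close> is \<open>C^1\<close> on the whole space, since \<open>\<phi>\<close> vanishes off a box inside the cylinder.\<close>
    define f where "f z = (if z \<in> ?C then U z else 0) * \<phi> z" for z
    define F where "F z v = (if z \<in> ?C then U z * \<phi>' z v + U' z v * \<phi> z else 0)" for z v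
    have f0: "f z = 0" if "z \<notin> cbox c d" for z using \<phi>0[OF that] by (simp add: f_def)
    have F0: "F z v = 0" if "z \<notin> cbox c d" for z v using \<phi>0[OF that] \<phi>'0[OF that] by (simp add: F_def)
    have df: "(f has_derivative F z) (at z)" for z
    proof (cases "z \<in> ?C")
      case True
      have "((\<lambda>z. U z * \<phi> z) has_derivative F z) (at z)"
        using has_derivative_mult[OF dU[OF True] \<phi>'(1)] True by (simp add: F_def[abs_def])
      then show ?thesis
        by (rule has_derivative_transform_within_open[OF _ open_cylinder True]) (simp add: f_def)
    next
      case False
      then have z: "z \<in> - cbox c d" using cd by auto
      have "F z = (\<lambda>_. 0)" using F0[of z] z by auto
      then have "((\<lambda>_. 0) has_derivative F z) (at z)" by simp
      then show ?thesis
        by (rule has_derivative_transform_within_open[OF _ _ z]) (auto simp: f0)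
    qed
    have cF: "continuous_on UNIV (\<lambda>z. F z v)" for v
    proof -
      have "continuous_on ?C (\<lambda>z. U z * \<phi>' z v + U' z v * \<phi> z)"
        by (intro continuous_intros contU cont continuous_on_subset[OF \<phi>'(2)] continuous_on_subset[OF \<phi>c]) auto
      then have 1: "continuous_on ?C (\<lambda>z. F z v)" by (rule continuous_on_eq) (simp add: F_def)
      have "continuous_on (- cbox c d) (\<lambda>z. 0 :: real)" by simp
      then have 2: "continuous_on (- cbox c d) (\<lambda>z. F z v)" by (rule continuous_on_eq) (simp add: F0)
      have "?C \<union> - cbox c d = UNIV" using cd by auto
      then show ?thesis using continuous_on_open_Un[OF open_cylinder open_Compl[OF closed_cbox] 1 2] by simp
    qed
    have int0: "(LINT z|lborel. F z e) = 0" by (rule integral_derivative_eq_0[OF df cF f0])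
    have "(LINT z|lebesgue_on ?C. G z $ i * \<phi> z) = - (LINT z|lebesgue_on ?C. U z * frechet_derivative \<phi> (at z) (0, axis i 1))"
      using weak test by (simp add: is_weak_Dx_def)
    also have "(LINT z|lebesgue_on ?C. G z $ i * \<phi> z) = (LINT z|lborel. indicator ?C z * (G0 z $ i * \<phi> z))"
      by (rule lebesgue_on_lint_eq(1)[OF cylinder_borel]) (use aeG in auto)
    also have "(LINT z|lebesgue_on ?C. U z * frechet_derivative \<phi> (at z) (0, axis i 1))
       = (LINT z|lborel. indicator ?C z * ((indicator ?C z *\<^sub>R U z) * \<phi>' z e))"
    proof (rule lebesgue_on_lint_eq(1)[OF cylinder_borel])
      have [measurable]: "(\<lambda>z. indicator ?C z *\<^sub>R U z) \<in> borel_measurable borel"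
        by (rule borel_measurable_continuous_on_indicator[OF cylinder_borel contU])
      show "(\<lambda>z. (indicator ?C z *\<^sub>R U z) * \<phi>' z e) \<in> borel_measurable borel" by measurable
    qed (auto simp: fd e_def)
    finally have w: "(LINT z|lborel. indicator ?C z * (G0 z $ i * \<phi> z)) = - (LINT z|lborel. indicator ?C z * ((indicator ?C z *\<^sub>R U z) * \<phi>' z e))" .
    have i1: "integrable lborel (\<lambda>z. indicator ?C z * (G0 z $ i * \<phi> z))"
    proof (rule Bochner_Integration.integrable_bound[OF 1])
      have "?C \<in> sets borel" by (rule cylinder_borel)
      then show "(\<lambda>z. indicator ?C z * (G0 z $ i * \<phi> z)) \<in> borel_measurable lborel" by measurable
      show "AE z in lborel. norm (indicator ?C z * (G0 z $ i * \<phi> z)) \<le> norm (indicator (cbox c d) z * G0 z $ i)"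
        using \<phi>0 \<phi>1 by (intro AE_I2) (auto simp: abs_mult mult_left_le split: split_indicator)
    qed
    have ic: "integrable lborel (\<lambda>z. indicator (cbox c d) z * H z)" if "continuous_on ?C H" for H :: "_ \<Rightarrow> real"
      using borel_integrable_compact[OF compact_cbox continuous_on_subset[OF that cd]] by simp
    have "continuous_on ?C (\<lambda>z. U z * \<phi>' z e)" "continuous_on ?C (\<lambda>z. U' z e * \<phi> z)"
      by (intro continuous_intros contU cont continuous_on_subset[OF \<phi>'(2)] continuous_on_subset[OF \<phi>c]; simp)+
    then have i2: "integrable lborel (\<lambda>z. indicator (cbox c d) z * (U z * \<phi>' z e))" and i3: "integrable lborel (\<lambda>z. indicator (cbox c d) z * (U' z e * \<phi> z))"
      by (auto intro: ic)
    have e2: "indicator ?C z * ((indicator ?C z *\<^sub>R U z) * \<phi>' z e) = indicator (cbox c d) z * (U z * \<phi>' z e)" for z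
      using cd \<phi>'0[of z e] by (auto split: split_indicator)
    have "(LINT z|lborel. (G0 z $ i - indicator ?C z *\<^sub>R U' z (0, axis i 1)) * bump c d n z)
       = (LINT z|lborel. indicator ?C z * (G0 z $ i * \<phi> z) - indicator (cbox c d) z * (U' z e * \<phi> z))"
      using cd \<phi>0 by (intro Bochner_Integration.integral_cong) (auto simp: \<phi>_def[symmetric] e_def algebra_simps split: split_indicator)
    also have "\<dots> = (LINT z|lborel. indicator ?C z * (G0 z $ i * \<phi> z)) - (LINT z|lborel. indicator (cbox c d) z * (U' z e * \<phi> z))"
      by (rule Bochner_Integration.integral_diff[OF i1 i3])
    also have "\<dots> = - ((LINT z|lborel. indicator (cbox c d) z * (U z * \<phi>' z e)) + (LINT z|lborel. indicator (cbox c d) z * (U' z e * \<phi> z)))"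
      unfolding w e2 by simp
    also have "(LINT z|lborel. indicator (cbox c d) z * (U z * \<phi>' z e)) + (LINT z|lborel. indicator (cbox c d) z * (U' z e * \<phi> z))
       = (LINT z|lborel. indicator (cbox c d) z * (U z * \<phi>' z e) + indicator (cbox c d) z * (U' z e * \<phi> z))"
      by (rule Bochner_Integration.integral_add[OF i2 i3, symmetric])
    also have "\<dots> = (LINT z|lborel. F z e)"
    proof (intro Bochner_Integration.integral_cong refl)
      fix z
      show "indicator (cbox c d) z * (U z * \<phi>' z e) + indicator (cbox c d) z * (U' z e * \<phi> z) = F z e"
      proof (cases "z \<in> cbox c d")
        case True
        moreover have "z \<in> ?C" using True cd by blast
        ultimately show ?thesis by (simp add: F_def)
      qed (simp add: F0)
    qed
    finally show "(LINT z|lborel. (G0 z $ i - indicator ?C z *\<^sub>R U' z (0, axis i 1)) * bump c d n z) = 0" using int0 by simp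
  qed
  then have "AE z in lborel. \<forall>i. z \<in> ?C \<longrightarrow> G0 z $ i - indicator ?C z *\<^sub>R U' z (0, axis i 1) = 0"
    by (subst AE_all_countable) blast
  then show ?thesis by eventually_elim auto
qed

section \<open>Linearity of the weak derivatives\<close>

lemma powr_add_le:
  fixes a b p :: real
  assumes "0 \<le> a" "0 \<le> b" "0 \<le> p"
  shows "(a + b) powr p \<le> 2 powr p * (a powr p + b powr p)"
proof -
  have "(a + b) powr p \<le> (2 * max a b) powr p" using assms by (intro powr_mono2) auto
  also have "\<dots> = 2 powr p * max a b powr p" using assms by (intro powr_mult)
  also have "\<dots> \<le> 2 powr p * (a powr p + b powr p)" by (intro mult_left_mono) (auto simp: max_def)
  finally show ?thesis .
qed

text \<open>A crude triangle inequality is enough, as it only enters the constant of the theorem.\<close>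
lemma Lp_lincomb:
  fixes f g :: "'a::euclidean_space \<Rightarrow> 'b::euclidean_space"
  assumes D: "D \<in> sets borel" and p: "1 \<le> p" and f: "f \<in> Lp p D" and g: "g \<in> Lp p D" and c: "\<bar>c\<bar> = 1"
  shows "(\<lambda>z. f z + c *\<^sub>R g z) \<in> Lp p D"
    and "Lp_norm p D (\<lambda>z. f z + c *\<^sub>R g z) \<le> 4 * (Lp_norm p D f + Lp_norm p D g)"
proof -
  have p0: "0 < p" using p by simp
  obtain f0 where Rf: "Lp_rep p D f f0" using Lp_rep_exists[OF D f p0] by blast
  then have f0[measurable]: "f0 \<in> borel_measurable borel" and f00: "\<And>z. z \<notin> D \<Longrightarrow> f0 z = 0"
    and aef: "AE z in lborel. z \<in> D \<longrightarrow> f z = f0 z"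
    and If: "(\<integral>\<^sup>+z. ennreal (norm (f0 z) powr p) \<partial>lborel) = ennreal (Lp_norm p D f powr p)"
    by (auto simp: Lp_rep_def)
  obtain g0 where Rg: "Lp_rep p D g g0" using Lp_rep_exists[OF D g p0] by blast
  then have g0[measurable]: "g0 \<in> borel_measurable borel" and g00: "\<And>z. z \<notin> D \<Longrightarrow> g0 z = 0"
    and aeg: "AE z in lborel. z \<in> D \<longrightarrow> g z = g0 z"
    and Ig: "(\<integral>\<^sup>+z. ennreal (norm (g0 z) powr p) \<partial>lborel) = ennreal (Lp_norm p D g powr p)"
    by (auto simp: Lp_rep_def)
  define A where "A = Lp_norm p D f"
  define B where "B = Lp_norm p D g"
  have AB: "0 \<le> A" "0 \<le> B" by (auto simp: A_def B_def Lp_norm_def)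
  have pt: "norm (f0 z + c *\<^sub>R g0 z) powr p \<le> 2 powr p * (norm (f0 z) powr p + norm (g0 z) powr p)" for z
  proof -
    have "norm (f0 z + c *\<^sub>R g0 z) \<le> norm (f0 z) + norm (g0 z)" using norm_triangle_ineq[of "f0 z" "c *\<^sub>R g0 z"] c by simp
    then have "norm (f0 z + c *\<^sub>R g0 z) powr p \<le> (norm (f0 z) + norm (g0 z)) powr p" using p by (intro powr_mono2) auto
    also have "\<dots> \<le> 2 powr p * (norm (f0 z) powr p + norm (g0 z) powr p)" using p by (intro powr_add_le) auto
    finally show ?thesis .
  qed
  have "(\<integral>\<^sup>+z. ennreal (norm (f0 z + c *\<^sub>R g0 z) powr p) \<partial>lborel)
     \<le> (\<integral>\<^sup>+z. ennreal (2 powr p) * (ennreal (norm (f0 z) powr p) + ennreal (norm (g0 z) powr p)) \<partial>lborel)"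
    using pt by (intro nn_integral_mono) (simp flip: ennreal_plus ennreal_mult)
  also have "\<dots> = ennreal (2 powr p) * (ennreal (A powr p) + ennreal (B powr p))"
    by (simp add: nn_integral_cmult nn_integral_add If Ig A_def B_def)
  also have "\<dots> = ennreal (2 powr p * (A powr p + B powr p))" by (simp flip: ennreal_plus ennreal_mult)
  also have "\<dots> \<le> ennreal ((4 * (A + B)) powr p)"
  proof (rule ennreal_leI)
    have "A powr p + B powr p \<le> (A + B) powr p + (A + B) powr p" using AB p by (intro add_mono powr_mono2) auto
    also have "\<dots> = 2 powr 1 * (A + B) powr p" by simp
    also have "\<dots> \<le> 2 powr p * (A + B) powr p" using p by (intro mult_right_mono powr_mono) auto
    finally have "2 powr p * (A powr p + B powr p) \<le> 2 powr p * (2 powr p * (A + B) powr p)" by (intro mult_left_mono) auto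
    also have "\<dots> = (2 * (2 * (A + B))) powr p" using AB by (simp only: powr_mult)
    finally show "2 powr p * (A powr p + B powr p) \<le> (4 * (A + B)) powr p" by simp
  qed
  finally have le: "(\<integral>\<^sup>+z. ennreal (norm (f0 z + c *\<^sub>R g0 z) powr p) \<partial>lborel) \<le> ennreal ((4 * (A + B)) powr p)" .
  have ae: "AE z in lborel. z \<in> D \<longrightarrow> f z + c *\<^sub>R g z = f0 z + c *\<^sub>R g0 z" using aef aeg by eventually_elim auto
  have m: "(\<lambda>z. f0 z + c *\<^sub>R g0 z) \<in> borel_measurable borel" by measurable
  have "0 \<le> 4 * (A + B)" using AB by simp
  note L = Lp_I[OF D m _ ae p0 this le]
  show "(\<lambda>z. f z + c *\<^sub>R g z) \<in> Lp p D" by (rule L(1)) (simp add: f00 g00)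
  have "Lp_norm p D (\<lambda>z. f z + c *\<^sub>R g z) \<le> 4 * (A + B)" by (rule L(2)) (simp add: f00 g00)
  then show "Lp_norm p D (\<lambda>z. f z + c *\<^sub>R g z) \<le> 4 * (Lp_norm p D f + Lp_norm p D g)" by (simp add: A_def B_def)
qed

text \<open>Off a bounded set both the test function and its derivative vanish on \<open>C\<close>, so that pairings with locally
  integrable functions converge.\<close>
lemma test_function_bounds:
  fixes \<phi> :: "'a::euclidean_space \<Rightarrow> real"
  assumes \<phi>: "\<phi> \<in> test_functions D" and C: "open C" "C \<subseteq> D"
  shows "\<exists>W K. bounded K \<and> (\<forall>z\<in>C. \<bar>\<phi> z\<bar> \<le> W \<and> \<bar>frechet_derivative \<phi> (at z) v\<bar> \<le> W) \<and>
    (\<forall>z\<in>C - K. \<phi> z = 0 \<and> frechet_derivative \<phi> (at z) v = 0) \<and>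
    continuous_on C \<phi> \<and> continuous_on C (\<lambda>z. frechet_derivative \<phi> (at z) v)"
proof -
  define K where "K = closure {z \<in> D. \<phi> z \<noteq> 0}"
  have K: "compact K" "K \<subseteq> D" using \<phi> by (auto simp: test_functions_def K_def)
  have "Ck_on (Suc 0) D \<phi>" using \<phi> unfolding test_functions_def Cinf_on_def by blast
  then obtain \<phi>' where \<phi>': "\<And>z. z \<in> D \<Longrightarrow> (\<phi> has_derivative \<phi>' z) (at z within D)" "\<And>v. continuous_on D (\<lambda>z. \<phi>' z v)" by auto
  have c\<phi>: "continuous_on D \<phi>" using \<phi>'(1) by (rule has_derivative_continuous_on)
  have d: "(\<phi> has_derivative \<phi>' z) (at z)" if "z \<in> C" for z
    using \<phi>'(1)[of z] that C at_within_open_subset[OF that C] by auto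
  have fd: "frechet_derivative \<phi> (at z) = \<phi>' z" if "z \<in> C" for z using frechet_derivative_at[OF d[OF that]] by simp
  have vzero: "\<phi> z = 0" if "z \<in> C" "z \<notin> K" for z
    using that C closure_subset[of "{z \<in> D. \<phi> z \<noteq> 0}"] by (auto simp: K_def)
  have dzero: "\<phi>' z v = 0" if "z \<in> C" "z \<notin> K" for z
  proof -
    have "open (C - K)" using C(1) K(1) by (intro open_Diff compact_imp_closed)
    then have "((\<lambda>_. 0) has_derivative \<phi>' z) (at z)"
      by (rule has_derivative_transform_within_open[OF d[OF that(1)]]) (use that vzero in auto)
    then have "\<phi>' z = (\<lambda>_. 0)" by (rule has_derivative_unique[OF _ has_derivative_const])
    then show ?thesis by simp
  qed
  have "bounded (\<phi> ` K)" by (intro compact_imp_bounded compact_continuous_image continuous_on_subset[OF c\<phi>] K)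
  then obtain W1 where W1: "\<forall>z\<in>K. \<bar>\<phi> z\<bar> \<le> W1" by (auto simp: bounded_iff)
  have "bounded ((\<lambda>z. \<phi>' z v) ` K)" by (intro compact_imp_bounded compact_continuous_image continuous_on_subset[OF \<phi>'(2)] K)
  then obtain W2 where W2: "\<forall>z\<in>K. \<bar>\<phi>' z v\<bar> \<le> W2" by (auto simp: bounded_iff)
  define W where "W = max 0 (max W1 W2)"
  show ?thesis
  proof (intro exI[of _ W] exI[of _ K] conjI ballI)
    show "bounded K" using K by (simp add: compact_imp_bounded)
    show "\<bar>\<phi> z\<bar> \<le> W" if "z \<in> C" for z using W1 vzero[OF that] by (cases "z \<in> K") (auto simp: W_def)
    show "\<bar>frechet_derivative \<phi> (at z) v\<bar> \<le> W" if "z \<in> C" for z using W2 dzero[OF that] by (cases "z \<in> K") (auto simp: W_def fd[OF that])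
    show "frechet_derivative \<phi> (at z) v = 0" "\<phi> z = 0" if "z \<in> C - K" for z using dzero[of z] vzero[of z] fd[of z] that by auto
    show "continuous_on C \<phi>" by (rule continuous_on_subset[OF c\<phi> C(2)])
    have "continuous_on C (\<lambda>z. \<phi>' z v)" by (rule continuous_on_subset[OF \<phi>'(2) C(2)])
    then show "continuous_on C (\<lambda>z. frechet_derivative \<phi> (at z) v)" by (rule continuous_on_eq) (simp add: fd)
  qed
qed

lemma bounded_snd_cbox:
  fixes K :: "(real \<times> (real^'n)) set"
  assumes "bounded K"
  shows "\<exists>c d. \<forall>z\<in>K. snd z \<in> cbox c d"
proof -
  have "bounded (snd ` K)" by (rule bounded_snd[OF assms])
  from bounded_subset_cbox_symmetric[OF this] obtain a where "snd ` K \<subseteq> cbox (-a) a" by blast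
  then show ?thesis by blast
qed

lemma Lp_rep_times_bounded:
  fixes f :: "real \<times> (real^'n) \<Rightarrow> real"
  assumes rep: "Lp_rep p (cylinder T UNIV) f f0" and p: "1 \<le> p"
    and h[measurable]: "h \<in> borel_measurable borel" and W: "\<And>z. \<bar>h z\<bar> \<le> W" and 0: "\<And>z. z \<notin> K \<Longrightarrow> h z = 0" and K: "bounded K"
  shows "integrable lborel (\<lambda>z. f0 z * h z)"
    and "0 < \<beta> \<Longrightarrow> integrable lborel (\<lambda>z. indicator (cylinder T UNIV) z * (RL \<beta> f0 z * h z))"
proof -
  have [measurable]: "f0 \<in> borel_measurable borel" and f00: "\<And>z. fst z \<notin> {0<..<T} \<Longrightarrow> f0 z = 0"
    using rep by (auto simp: Lp_rep_def cylinder_UNIV_iff)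
  have C[measurable]: "cylinder T (UNIV :: (real^'n) set) \<in> sets borel" by (rule cylinder_borel)
  obtain c d where cd: "\<And>z. z \<in> K \<Longrightarrow> snd z \<in> cbox c d" using bounded_snd_cbox[OF K] by blast
  define b where "b = (\<lambda>x. W * indicator (cbox c d) x)"
  have [measurable]: "b \<in> borel_measurable borel" by (simp add: b_def)
  have W0: "0 \<le> W" using W[of undefined] by simp
  have b: "\<bar>b x\<bar> \<le> W" "x \<notin> cbox c d \<Longrightarrow> b x = 0" for x using W0 by (auto simp: b_def split: split_indicator)
  have hb: "\<bar>h z\<bar> \<le> b (snd z)" for z using cd[of z] 0[of z] W[of z] W0 by (cases "z \<in> K") (auto simp: b_def)
  have ib: "integrable lborel (\<lambda>z. f0 z * b (snd z))" by (rule Lp_rep_integrable_mult[OF rep p _ b]) simp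
  have le: "norm (x * h z) \<le> norm (x * b (snd z))" for x z
    unfolding real_norm_def abs_mult by (intro mult_left_mono order.trans[OF hb abs_ge_self]) auto
  show "integrable lborel (\<lambda>z. f0 z * h z)"
    by (rule Bochner_Integration.integrable_bound[OF ib]) (use le in auto)
  assume \<beta>: "0 < \<beta>"
  have "integrable lborel (\<lambda>z. RL \<beta> f0 z * indicator {..<T} (fst z) * b (snd z))"
    by (rule RL_by_parts(1)[OF \<beta> _ f00, where W = 1]) (use ib in \<open>auto split: split_indicator\<close>)
  then show "integrable lborel (\<lambda>z. indicator (cylinder T UNIV) z * (RL \<beta> f0 z * h z))"
  proof (rule Bochner_Integration.integrable_bound)
    show "AE z in lborel. norm (indicator (cylinder T UNIV) z * (RL \<beta> f0 z * h z)) \<le> norm (RL \<beta> f0 z * indicator {..<T} (fst z) * b (snd z))"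
      using le by (intro AE_I2) (auto simp: cylinder_UNIV_iff split: split_indicator)
    have [measurable]: "RL \<beta> f0 \<in> borel_measurable borel" by (rule RL_measurable) measurable
    show "(\<lambda>z. indicator (cylinder T UNIV) z * (RL \<beta> f0 z * h z)) \<in> borel_measurable lborel" by measurable
  qed
qed

text \<open>Pairings with a test function and with one of its derivatives are turned, once and for all, into integrals
  of Borel representatives over the whole space against bounded functions \<open>h\<close> and \<open>k\<close> of bounded support.\<close>
lemma test_pairing:
  fixes \<phi> :: "real \<times> (real^'n) \<Rightarrow> real"
  assumes \<phi>: "\<phi> \<in> test_functions D" and sub: "cylinder T UNIV \<subseteq> D"
  shows "\<exists>h k W K. h \<in> borel_measurable borel \<and> k \<in> borel_measurable borel \<and> bounded K \<and>
    (\<forall>z. \<bar>h z\<bar> \<le> W \<and> \<bar>k z\<bar> \<le> W) \<and> (\<forall>z. z \<notin> K \<longrightarrow> h z = 0 \<and> k z = 0) \<and>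
    (\<forall>f f0. f0 \<in> borel_measurable borel \<longrightarrow> (AE z in lborel. z \<in> cylinder T UNIV \<longrightarrow> f z = f0 z) \<longrightarrow>
      (LINT z|lebesgue_on (cylinder T UNIV). f z * \<phi> z) = (LINT z|lborel. f0 z * h z) \<and>
      (LINT z|lebesgue_on (cylinder T UNIV). f z * frechet_derivative \<phi> (at z) v) = (LINT z|lborel. f0 z * k z))"
proof -
  let ?C = "cylinder T (UNIV :: (real^'n) set)"
  have C: "?C \<in> sets borel" by (rule cylinder_borel)
  obtain W K where WK: "bounded K" "\<forall>z\<in>?C. \<bar>\<phi> z\<bar> \<le> W \<and> \<bar>frechet_derivative \<phi> (at z) v\<bar> \<le> W"
    "\<forall>z\<in>?C - K. \<phi> z = 0 \<and> frechet_derivative \<phi> (at z) v = 0"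
    and WKc: "continuous_on ?C \<phi>" "continuous_on ?C (\<lambda>z. frechet_derivative \<phi> (at z) v)"
    using test_function_bounds[OF \<phi> open_cylinder sub, of v] by blast
  define h where "h z = indicator ?C z *\<^sub>R \<phi> z" for z
  define k where "k z = indicator ?C z *\<^sub>R frechet_derivative \<phi> (at z) v" for z
  have hm[measurable]: "h \<in> borel_measurable borel" unfolding h_def[abs_def] by (rule borel_measurable_continuous_on_indicator[OF C WKc(1)])
  have km[measurable]: "k \<in> borel_measurable borel" unfolding k_def[abs_def] by (rule borel_measurable_continuous_on_indicator[OF C WKc(2)])
  have "\<bar>h z\<bar> \<le> max W 0 \<and> \<bar>k z\<bar> \<le> max W 0" "z \<notin> K \<longrightarrow> h z = 0 \<and> k z = 0" for z
    using WK(2,3) by (auto simp: h_def k_def split: split_indicator)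
  moreover have "(LINT z|lebesgue_on ?C. f z * \<phi> z) = (LINT z|lborel. f0 z * h z) \<and>
      (LINT z|lebesgue_on ?C. f z * frechet_derivative \<phi> (at z) v) = (LINT z|lborel. f0 z * k z)"
    if [measurable]: "f0 \<in> borel_measurable borel" and a: "AE z in lborel. z \<in> ?C \<longrightarrow> f z = f0 z" for f f0
  proof -
    have m1: "(\<lambda>z. f0 z * h z) \<in> borel_measurable borel" and m2: "(\<lambda>z. f0 z * k z) \<in> borel_measurable borel"
      by measurable
    have e1: "indicator ?C z * (f0 z * h z) = f0 z * h z" and e2: "indicator ?C z * (f0 z * k z) = f0 z * k z" for z
      by (auto simp: h_def k_def split: split_indicator)
    have "(LINT z|lebesgue_on ?C. f z * \<phi> z) = (LINT z|lborel. indicator ?C z * (f0 z * h z))"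
      by (rule lebesgue_on_lint_eq(1)[OF C m1]) (use a in \<open>auto simp: h_def\<close>)
    moreover have "(LINT z|lebesgue_on ?C. f z * frechet_derivative \<phi> (at z) v) = (LINT z|lborel. indicator ?C z * (f0 z * k z))"
      by (rule lebesgue_on_lint_eq(1)[OF C m2]) (use a in \<open>auto simp: k_def\<close>)
    ultimately show ?thesis unfolding e1 e2 by simp
  qed
  ultimately show ?thesis using hm km WK(1) by (intro exI[of _ h] exI[of _ k] exI[of _ "max W 0"] exI[of _ K]) blast
qed

lemma is_weak_Dx_lincomb:
  fixes u v :: "real \<times> (real^'n) \<Rightarrow> real"
  assumes p: "1 \<le> p" and u: "u \<in> Lp p (cylinder T UNIV)" and v: "v \<in> Lp p (cylinder T UNIV)"
    and G: "is_weak_Dx p T UNIV u G" and H: "is_weak_Dx p T UNIV v H" and c: "\<bar>c\<bar> = 1"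
  shows "is_weak_Dx p T UNIV (\<lambda>z. u z + c * v z) (\<lambda>z. G z + c *\<^sub>R H z)"
  unfolding is_weak_Dx_def
proof (intro conjI ballI allI)
  let ?C = "cylinder T (UNIV :: (real^'n) set)"
  have C[measurable]: "?C \<in> sets borel" by (rule cylinder_borel)
  have p0: "0 < p" using p by simp
  have GL: "G \<in> Lp p ?C" "H \<in> Lp p ?C" using G H by (auto simp: is_weak_Dx_def)
  show "(\<lambda>z. G z + c *\<^sub>R H z) \<in> Lp p ?C" by (rule Lp_lincomb(1)[OF cylinder_borel p GL c])
  fix \<phi> i assume \<phi>: "\<phi> \<in> test_functions ?C"
  obtain h k W K where hm[measurable]: "h \<in> borel_measurable borel" and km[measurable]: "k \<in> borel_measurable borel" and K: "bounded K"
    and bd: "\<forall>z. \<bar>h z\<bar> \<le> W \<and> \<bar>k z\<bar> \<le> W" "\<forall>z. z \<notin> K \<longrightarrow> h z = 0 \<and> k z = 0"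
    and cv: "\<forall>f f0. f0 \<in> borel_measurable borel \<longrightarrow> (AE z in lborel. z \<in> ?C \<longrightarrow> f z = f0 z) \<longrightarrow>
      (LINT z|lebesgue_on ?C. f z * \<phi> z) = (LINT z|lborel. f0 z * h z) \<and>
      (LINT z|lebesgue_on ?C. f z * frechet_derivative \<phi> (at z) (0, axis i 1)) = (LINT z|lborel. f0 z * k z)"
    using test_pairing[OF \<phi> order.refl, of "(0, axis i 1)"] by blast
  have h: "\<bar>h z\<bar> \<le> W" "z \<notin> K \<Longrightarrow> h z = 0" and k: "\<bar>k z\<bar> \<le> W" "z \<notin> K \<Longrightarrow> k z = 0" for z using bd by blast+
  note conv = cv[rule_format, THEN conjunct1] cv[rule_format, THEN conjunct2]
  obtain u0 where u0: "Lp_rep p ?C u u0" using Lp_rep_exists[OF C u p0] by blast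
  obtain v0 where v0: "Lp_rep p ?C v v0" using Lp_rep_exists[OF C v p0] by blast
  have Gi: "(\<lambda>z. F z $ i) \<in> Lp p ?C" if F: "F \<in> Lp p ?C" for F :: "_ \<Rightarrow> real^'n"
  proof -
    obtain F0 where F0: "Lp_rep p ?C F F0" using Lp_rep_exists[OF C F p0] by blast
    then have [measurable]: "F0 \<in> borel_measurable borel" by (simp add: Lp_rep_def)
    have m: "(\<lambda>z. F0 z $ i) \<in> borel_measurable borel"
      using borel_measurable_inner[OF \<open>F0 \<in> borel_measurable borel\<close> borel_measurable_const, of "axis i 1"] by (simp add: inner_axis)
    show ?thesis
    proof (rule Lp_I(1)[OF C m _ _ p0, where B = "Lp_norm p ?C F"])
      show "AE z in lborel. z \<in> ?C \<longrightarrow> F z $ i = F0 z $ i" using F0 by (auto simp: Lp_rep_def)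
      have "(\<integral>\<^sup>+z. ennreal (norm (F0 z $ i) powr p) \<partial>lborel) \<le> (\<integral>\<^sup>+z. ennreal (norm (F0 z) powr p) \<partial>lborel)"
        using p component_le_norm_cart[of "F0 z" i for z] by (intro nn_integral_mono ennreal_leI powr_mono2) auto
      then show "(\<integral>\<^sup>+z. ennreal (norm (F0 z $ i) powr p) \<partial>lborel) \<le> ennreal (Lp_norm p ?C F powr p)"
        using F0 by (simp add: Lp_rep_def)
    qed (use F0 in \<open>auto simp: Lp_rep_def Lp_norm_def\<close>)
  qed
  obtain G0 where G0: "Lp_rep p ?C (\<lambda>z. G z $ i) G0" using Lp_rep_exists[OF C Gi[OF GL(1)] p0] by blast
  obtain H0 where H0: "Lp_rep p ?C (\<lambda>z. H z $ i) H0" using Lp_rep_exists[OF C Gi[OF GL(2)] p0] by blast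
  have [measurable]: "u0 \<in> borel_measurable borel" "v0 \<in> borel_measurable borel" "G0 \<in> borel_measurable borel" "H0 \<in> borel_measurable borel"
    using u0 v0 G0 H0 by (auto simp: Lp_rep_def)
  have ae: "AE z in lborel. z \<in> ?C \<longrightarrow> u z = u0 z" "AE z in lborel. z \<in> ?C \<longrightarrow> v z = v0 z"
      "AE z in lborel. z \<in> ?C \<longrightarrow> G z $ i = G0 z" "AE z in lborel. z \<in> ?C \<longrightarrow> H z $ i = H0 z"
    using u0 v0 G0 H0 by (auto simp: Lp_rep_def)
  have ih: "integrable lborel (\<lambda>z. f0 z * h z)" "integrable lborel (\<lambda>z. f0 z * k z)" if "Lp_rep p ?C f f0" for f f0
    using Lp_rep_times_bounded(1)[OF that p _ h K] Lp_rep_times_bounded(1)[OF that p _ k K] by auto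
  have wG: "(LINT z|lborel. G0 z * h z) = - (LINT z|lborel. u0 z * k z)"
    using G \<phi> conv(1)[OF _ ae(3)] conv(2)[OF _ ae(1)] by (auto simp: is_weak_Dx_def)
  have wH: "(LINT z|lborel. H0 z * h z) = - (LINT z|lborel. v0 z * k z)"
    using H \<phi> conv(1)[OF _ ae(4)] conv(2)[OF _ ae(2)] by (auto simp: is_weak_Dx_def)
  have "(LINT z|lebesgue_on ?C. (G z + c *\<^sub>R H z) $ i * \<phi> z) = (LINT z|lborel. (G0 z + c * H0 z) * h z)"
    by (rule conv(1)) (use ae(3,4) in auto)
  also have "\<dots> = (LINT z|lborel. G0 z * h z + c * (H0 z * h z))"
    by (intro Bochner_Integration.integral_cong) (auto simp: algebra_simps)
  also have "\<dots> = (LINT z|lborel. G0 z * h z) + c * (LINT z|lborel. H0 z * h z)"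
    using ih(1)[OF G0] ih(1)[OF H0] by simp
  also have "\<dots> = - ((LINT z|lborel. u0 z * k z) + c * (LINT z|lborel. v0 z * k z))" by (simp add: wG wH)
  also have "(LINT z|lborel. u0 z * k z) + c * (LINT z|lborel. v0 z * k z) = (LINT z|lborel. u0 z * k z + c * (v0 z * k z))"
    using ih(2)[OF u0] ih(2)[OF v0] by simp
  also have "\<dots> = (LINT z|lborel. (u0 z + c * v0 z) * k z)"
    by (intro Bochner_Integration.integral_cong) (auto simp: algebra_simps)
  also have "\<dots> = (LINT z|lebesgue_on ?C. (u z + c * v z) * frechet_derivative \<phi> (at z) (0, axis i 1))"
    by (rule conv(2)[symmetric]) (use ae(1,2) in auto)
  finally show "(LINT z|lebesgue_on ?C. (G z + c *\<^sub>R H z) $ i * \<phi> z) = - (LINT z|lebesgue_on ?C. (u z + c * v z) * frechet_derivative \<phi> (at z) (0, axis i 1))" .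
qed

text \<open>Additivity of the fractional integral is only available almost everywhere, where both slice integrals
  converge.\<close>
lemma is_weak_dt_lincomb:
  fixes u v :: "real \<times> (real^'n) \<Rightarrow> real"
  assumes p: "1 \<le> p" and \<alpha>: "\<alpha> < 1" and u: "u \<in> Lp p (cylinder T UNIV)" and v: "v \<in> Lp p (cylinder T UNIV)"
    and G: "is_weak_dt_I0 \<alpha> p T UNIV u G" and H: "is_weak_dt_I0 \<alpha> p T UNIV v H" and c: "\<bar>c\<bar> = 1"
  shows "is_weak_dt_I0 \<alpha> p T UNIV (\<lambda>z. u z + c * v z) (\<lambda>z. G z + c * H z)"
  unfolding is_weak_dt_I0_def
proof (intro conjI ballI allI)
  let ?C = "cylinder T (UNIV :: (real^'n) set)"
  have C[measurable]: "?C \<in> sets borel" by (rule cylinder_borel)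
  have p0: "0 < p" using p by simp
  have \<alpha>': "0 < 1 - \<alpha>" using \<alpha> by simp
  have GL: "G \<in> Lp p ?C" "H \<in> Lp p ?C" using G H by (auto simp: is_weak_dt_I0_def)
  show "(\<lambda>z. G z + c * H z) \<in> Lp p ?C" using Lp_lincomb(1)[OF cylinder_borel p GL c] by simp
  fix \<phi> assume \<phi>: "\<phi> \<in> test_functions ({0..<T} \<times> (UNIV :: (real^'n) set))"
  have sub: "?C \<subseteq> {0..<T} \<times> UNIV" by (auto simp: cylinder_def)
  obtain h k W K where hm[measurable]: "h \<in> borel_measurable borel" and km[measurable]: "k \<in> borel_measurable borel" and K: "bounded K"
    and bd: "\<forall>z. \<bar>h z\<bar> \<le> W \<and> \<bar>k z\<bar> \<le> W" "\<forall>z. z \<notin> K \<longrightarrow> h z = 0 \<and> k z = 0"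
    and cv: "\<forall>f f0. f0 \<in> borel_measurable borel \<longrightarrow> (AE z in lborel. z \<in> ?C \<longrightarrow> f z = f0 z) \<longrightarrow>
      (LINT z|lebesgue_on ?C. f z * \<phi> z) = (LINT z|lborel. f0 z * h z) \<and>
      (LINT z|lebesgue_on ?C. f z * frechet_derivative \<phi> (at z) (1, 0)) = (LINT z|lborel. f0 z * k z)"
    using test_pairing[OF \<phi> sub, of "(1, 0)"] by blast
  have h: "\<bar>h z\<bar> \<le> W" "z \<notin> K \<Longrightarrow> h z = 0" and k: "\<bar>k z\<bar> \<le> W" "z \<notin> K \<Longrightarrow> k z = 0" for z using bd by blast+
  note conv = cv[rule_format, THEN conjunct1] cv[rule_format, THEN conjunct2]
  obtain u0 where u0: "Lp_rep p ?C u u0" using Lp_rep_exists[OF C u p0] by blast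
  obtain v0 where v0: "Lp_rep p ?C v v0" using Lp_rep_exists[OF C v p0] by blast
  obtain G0 where G0: "Lp_rep p ?C G G0" using Lp_rep_exists[OF C GL(1) p0] by blast
  obtain H0 where H0: "Lp_rep p ?C H H0" using Lp_rep_exists[OF C GL(2) p0] by blast
  have [measurable]: "u0 \<in> borel_measurable borel" "v0 \<in> borel_measurable borel" "G0 \<in> borel_measurable borel" "H0 \<in> borel_measurable borel"
    using u0 v0 G0 H0 by (auto simp: Lp_rep_def)
  have aeG: "AE z in lborel. z \<in> ?C \<longrightarrow> G z = G0 z" "AE z in lborel. z \<in> ?C \<longrightarrow> H z = H0 z"
    using G0 H0 by (auto simp: Lp_rep_def)
  define J where "J w z = indicator ?C z * (1 / Gamma (1 - \<alpha>) * RL (1 - \<alpha>) w z)" for w z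
  have [measurable]: "J u0 \<in> borel_measurable borel" "J v0 \<in> borel_measurable borel" unfolding J_def[abs_def] by measurable
  have Ju: "AE z in lborel. z \<in> ?C \<longrightarrow> I0 (1 - \<alpha>) u z = J u0 z"
    using I0_rep(1)[OF u0 p \<alpha>'] by eventually_elim (auto simp: J_def)
  have Jv: "AE z in lborel. z \<in> ?C \<longrightarrow> I0 (1 - \<alpha>) v z = J v0 z"
    using I0_rep(1)[OF v0 p \<alpha>'] by eventually_elim (auto simp: J_def)
  have Juv: "AE z in lborel. z \<in> ?C \<longrightarrow> I0 (1 - \<alpha>) (\<lambda>z. u z + c * v z) z = J u0 z + c * J v0 z"
    using Ju Jv I0_rep(2)[OF u0 p \<alpha>'] I0_rep(2)[OF v0 p \<alpha>']
  proof eventually_elim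
    case (elim z)
    show ?case
    proof
      assume z: "z \<in> ?C"
      have "(LINT s|lebesgue_on {0<..<fst z}. (fst z - s) powr (1 - \<alpha> - 1) * (u (s, snd z) + c * v (s, snd z)))
        = (LINT s|lebesgue_on {0<..<fst z}. (fst z - s) powr (1 - \<alpha> - 1) * u (s, snd z) + c * ((fst z - s) powr (1 - \<alpha> - 1) * v (s, snd z)))"
        by (intro Bochner_Integration.integral_cong) (auto simp: algebra_simps)
      also have "\<dots> = (LINT s|lebesgue_on {0<..<fst z}. (fst z - s) powr (1 - \<alpha> - 1) * u (s, snd z)) + c * (LINT s|lebesgue_on {0<..<fst z}. (fst z - s) powr (1 - \<alpha> - 1) * v (s, snd z))"
        using elim(3,4) z by simp
      finally have "I0 (1 - \<alpha>) (\<lambda>z. u z + c * v z) z = I0 (1 - \<alpha>) u z + c * I0 (1 - \<alpha>) v z"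
        by (simp add: I0_def case_prod_beta' algebra_simps add_divide_distrib)
      then show "I0 (1 - \<alpha>) (\<lambda>z. u z + c * v z) z = J u0 z + c * J v0 z" using elim(1,2) z by simp
    qed
  qed
  have ih: "integrable lborel (\<lambda>z. f0 z * h z)" "integrable lborel (\<lambda>z. J f0 z * k z)" if "Lp_rep p ?C f f0" for f f0
  proof -
    show "integrable lborel (\<lambda>z. f0 z * h z)" using Lp_rep_times_bounded(1)[OF that p _ h K] by auto
    have "integrable lborel (\<lambda>z. 1 / Gamma (1 - \<alpha>) * (indicator ?C z * (RL (1 - \<alpha>) f0 z * k z)))"
      using Lp_rep_times_bounded(2)[OF that p _ k K \<alpha>'] by (intro integrable_mult_right) auto
    then show "integrable lborel (\<lambda>z. J f0 z * k z)" by (simp add: J_def mult_ac)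
  qed
  have wG: "(LINT z|lborel. G0 z * h z) = - (LINT z|lborel. J u0 z * k z)"
    using G \<phi> conv(1)[OF _ aeG(1)] conv(2)[OF _ Ju] by (auto simp: is_weak_dt_I0_def)
  have wH: "(LINT z|lborel. H0 z * h z) = - (LINT z|lborel. J v0 z * k z)"
    using H \<phi> conv(1)[OF _ aeG(2)] conv(2)[OF _ Jv] by (auto simp: is_weak_dt_I0_def)
  have "(LINT z|lebesgue_on ?C. (G z + c * H z) * \<phi> z) = (LINT z|lborel. (G0 z + c * H0 z) * h z)"
    by (rule conv(1)) (use aeG in auto)
  also have "\<dots> = (LINT z|lborel. G0 z * h z + c * (H0 z * h z))"
    by (intro Bochner_Integration.integral_cong) (auto simp: algebra_simps)
  also have "\<dots> = (LINT z|lborel. G0 z * h z) + c * (LINT z|lborel. H0 z * h z)"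
    using ih(1)[OF G0] ih(1)[OF H0] by simp
  also have "\<dots> = - ((LINT z|lborel. J u0 z * k z) + c * (LINT z|lborel. J v0 z * k z))" by (simp add: wG wH)
  also have "(LINT z|lborel. J u0 z * k z) + c * (LINT z|lborel. J v0 z * k z) = (LINT z|lborel. J u0 z * k z + c * (J v0 z * k z))"
    using ih(2)[OF u0] ih(2)[OF v0] by simp
  also have "\<dots> = (LINT z|lborel. (J u0 z + c * J v0 z) * k z)"
    by (intro Bochner_Integration.integral_cong) (auto simp: algebra_simps)
  also have "\<dots> = (LINT z|lebesgue_on ?C. I0 (1 - \<alpha>) (\<lambda>z. u z + c * v z) z * frechet_derivative \<phi> (at z) (1, 0))"
    by (rule conv(2)[symmetric]) (use Juv in auto)
  finally show "(LINT z|lebesgue_on ?C. (G z + c * H z) * \<phi> z) = - (LINT z|lebesgue_on ?C. I0 (1 - \<alpha>) (\<lambda>z. u z + c * v z) z * frechet_derivative \<phi> (at z) (1, 0))" .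
qed

section \<open>Interpolation for smooth functions\<close>

lemma AE_fst_finite:
  fixes f :: "real \<times> 'a::euclidean_space \<Rightarrow> ennreal"
  assumes [measurable]: "f \<in> borel_measurable borel" and fin: "(\<integral>\<^sup>+z. f z \<partial>lborel) \<le> ennreal B"
  shows "(\<lambda>t. \<integral>\<^sup>+x. f (t, x) \<partial>lborel) \<in> borel_measurable borel"
    and "(\<integral>\<^sup>+t. \<integral>\<^sup>+x. f (t, x) \<partial>lborel \<partial>lborel) = (\<integral>\<^sup>+z. f z \<partial>lborel)"
    and "AE t in lborel. (\<integral>\<^sup>+x. f (t, x) \<partial>lborel) \<noteq> \<infinity>"
proof -
  have [measurable]: "f \<in> borel_measurable (borel \<Otimes>\<^sub>M borel)" by (simp add: borel_prod)
  then have m: "f \<in> borel_measurable (lborel \<Otimes>\<^sub>M lborel)" by simp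
  show 1: "(\<lambda>t. \<integral>\<^sup>+x. f (t, x) \<partial>lborel) \<in> borel_measurable borel" by measurable
  show 2: "(\<integral>\<^sup>+t. \<integral>\<^sup>+x. f (t, x) \<partial>lborel \<partial>lborel) = (\<integral>\<^sup>+z. f z \<partial>lborel)"
    using lborel.nn_integral_fst[OF m] by (simp add: lborel_prod)
  have "(\<integral>\<^sup>+t. \<integral>\<^sup>+x. f (t, x) \<partial>lborel \<partial>lborel) \<noteq> \<infinity>" using fin unfolding 2 by (auto simp: top_unique)
  then show "AE t in lborel. (\<integral>\<^sup>+x. f (t, x) \<partial>lborel) \<noteq> \<infinity>" by (intro nn_integral_PInf_AE) (use 1 in auto)
qed

lemma nn_integral_enn2real_powr:
  fixes X :: "real \<Rightarrow> ennreal"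
  assumes X[measurable]: "X \<in> borel_measurable borel" and p: "0 < p" and fin: "AE t in lborel. X t \<noteq> \<infinity>"
  shows "(\<integral>\<^sup>+t. ennreal ((enn2real (X t) powr (1 / p)) powr p) \<partial>lborel) = (\<integral>\<^sup>+t. X t \<partial>lborel)"
proof (rule nn_integral_cong_AE)
  show "AE t in lborel. ennreal ((enn2real (X t) powr (1 / p)) powr p) = X t"
    using fin by eventually_elim (use p in \<open>simp add: powr_powr top.not_eq_extremum\<close>)
qed

text \<open>The exponents \<open>r\<close> and \<open>p\<close> for \<open>h\<close> are first combined into an intermediate exponent, then with the factor
  \<open>S\<close>. The case \<open>\<tau> = 1\<close> is the endpoint, where the first step is void.\<close>
lemma interpolate_in_time:
  fixes S h :: "real \<Rightarrow> real"
  assumes [measurable]: "S \<in> borel_measurable borel" "h \<in> borel_measurable borel"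
    and nn: "\<And>t. 0 \<le> S t" "\<And>t. 0 \<le> h t"
    and \<theta>: "0 < \<theta>" "\<theta> < 1" and \<tau>: "0 < \<tau>" "\<tau> \<le> 1" and p: "1 \<le> p" and q: "0 < q" and r: "0 < r"
    and e: "1 / q = \<theta> / p + (1 - \<theta>) * (\<tau> / r + (1 - \<tau>) / p)"
    and A: "0 < A" "(\<integral>\<^sup>+t. ennreal (S t powr p) \<partial>lborel) \<le> ennreal (A powr p)"
    and B: "0 < B" "(\<integral>\<^sup>+t. ennreal (h t powr r) \<partial>lborel) \<le> ennreal (B powr r)"
    and K: "0 < K" "(\<integral>\<^sup>+t. ennreal (h t powr p) \<partial>lborel) \<le> ennreal (K powr p)"
  shows "(\<integral>\<^sup>+t. ennreal (S t powr (\<theta> * q) * h t powr ((1 - \<theta>) * q)) \<partial>lborel)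
    \<le> ennreal ((A powr \<theta> * B powr (\<tau> * (1 - \<theta>)) * K powr ((1 - \<tau>) * (1 - \<theta>))) powr q)"
proof -
  define m where "m = 1 / (\<tau> / r + (1 - \<tau>) / p)"
  have pos: "\<tau> / r + (1 - \<tau>) / p > 0" using \<tau> r p by (intro add_pos_nonneg) auto
  then have m: "m > 0" by (simp add: m_def)
  have m1: "m * (\<tau> / r + (1 - \<tau>) / p) = 1" using pos by (simp add: m_def)
  define M where "M = B powr \<tau> * K powr (1 - \<tau>)"
  have M: "M > 0" using B K by (simp add: M_def)
  have hm: "(\<integral>\<^sup>+t. ennreal (h t powr m) \<partial>lborel) \<le> ennreal (M powr m)"
  proof (cases "\<tau> = 1")
    case True
    then have "m = r" by (simp add: m_def)
    then show ?thesis using B K True by (simp add: M_def)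
  next
    case False
    then have t1: "\<tau> < 1" using \<tau> by simp
    have ex: "r * (m * \<tau> / r) + p * (m * (1 - \<tau>) / p) = m"
    proof -
      have "r * (m * \<tau> / r) = m * \<tau>" "p * (m * (1 - \<tau>) / p) = m * (1 - \<tau>)" using r p by auto
      then show ?thesis by (simp only:) (simp add: algebra_simps)
    qed
    have "(\<integral>\<^sup>+t. ennreal (h t powr m) \<partial>lborel) = (\<integral>\<^sup>+t. ennreal ((h t powr r) powr (m * \<tau> / r) * (h t powr p) powr (m * (1 - \<tau>) / p)) \<partial>lborel)"
      by (intro nn_integral_cong arg_cong[of _ _ ennreal]) (simp only: powr_powr powr_add[symmetric] ex)
    also have "\<dots> \<le> ennreal ((B powr r) powr (m * \<tau> / r) * (K powr p) powr (m * (1 - \<tau>) / p))"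
    proof (rule nn_integral_geometric_Holder)
      show "m * \<tau> / r + m * (1 - \<tau>) / p = 1" using m1 by (simp add: distrib_left)
    qed (use B K nn m \<tau> t1 r p in auto)
    also have "(B powr r) powr (m * \<tau> / r) * (K powr p) powr (m * (1 - \<tau>) / p) = M powr m"
      using r p B K by (simp add: M_def powr_powr powr_mult mult.commute)
    finally show ?thesis .
  qed
  have sum1: "\<theta> * q / p + (1 - \<theta>) * q / m = 1"
  proof -
    have "\<theta> * q / p + (1 - \<theta>) * q * Y = q * (\<theta> / p + (1 - \<theta>) * Y)" for Y by (simp add: algebra_simps)
    from this[of "\<tau> / r + (1 - \<tau>) / p"]
    have "\<theta> * q / p + (1 - \<theta>) * q / m = q * (\<theta> / p + (1 - \<theta>) * (\<tau> / r + (1 - \<tau>) / p))" by (simp only: m_def) simp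
    then show ?thesis using q by (simp add: e[symmetric])
  qed
  have "(\<integral>\<^sup>+t. ennreal (S t powr (\<theta> * q) * h t powr ((1 - \<theta>) * q)) \<partial>lborel)
     = (\<integral>\<^sup>+t. ennreal ((S t powr p) powr (\<theta> * q / p) * (h t powr m) powr ((1 - \<theta>) * q / m)) \<partial>lborel)"
    using p m by (intro nn_integral_cong) (simp add: powr_powr)
  also have "\<dots> \<le> ennreal ((A powr p) powr (\<theta> * q / p) * (M powr m) powr ((1 - \<theta>) * q / m))"
    by (rule nn_integral_geometric_Holder) (use A hm nn m \<theta> q p M sum1 in auto)
  also have "(A powr p) powr (\<theta> * q / p) * (M powr m) powr ((1 - \<theta>) * q / m) = (A powr \<theta> * M powr (1 - \<theta>)) powr q"
    using p m A M by (simp add: powr_powr powr_mult)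
  also have "M powr (1 - \<theta>) = B powr (\<tau> * (1 - \<theta>)) * K powr ((1 - \<tau>) * (1 - \<theta>))"
    using B K by (simp add: M_def powr_mult powr_powr)
  finally show ?thesis by (simp add: mult.assoc)
qed

lemma smooth_rep:
  fixes U :: "real \<times> (real^'n) \<Rightarrow> real"
  assumes U: "U \<in> Lp p (cylinder T UNIV)" and c: "continuous_on (cylinder T UNIV) U" and p: "0 < p"
  shows "Lp_rep p (cylinder T UNIV) U (\<lambda>z. indicator (cylinder T UNIV) z * U z)"
proof -
  obtain u0 where u0: "Lp_rep p (cylinder T UNIV) U u0" using Lp_rep_exists[OF cylinder_borel U p] by blast
  have m: "(\<lambda>z. indicator (cylinder T UNIV) z * U z) \<in> borel_measurable borel"
    using borel_measurable_continuous_on_indicator[OF cylinder_borel c] by simp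
  have "(\<integral>\<^sup>+z. ennreal (norm (indicator (cylinder T UNIV) z * U z) powr p) \<partial>lborel) = (\<integral>\<^sup>+z. ennreal (norm (u0 z) powr p) \<partial>lborel)"
  proof (rule nn_integral_cong_AE)
    have ae: "AE z in lborel. z \<in> cylinder T UNIV \<longrightarrow> U z = u0 z" using u0 by (simp add: Lp_rep_def)
    have zero: "u0 z = 0" if "z \<notin> cylinder T UNIV" for z using u0 that unfolding Lp_rep_def by blast
    from ae show "AE z in lborel. ennreal (norm (indicator (cylinder T UNIV) z * U z) powr p) = ennreal (norm (u0 z) powr p)"
      by eventually_elim (auto simp: zero split: split_indicator)
  qed
  then show ?thesis using u0 m by (auto simp: Lp_rep_def)
qed

lemma abs_RL_le: "ennreal \<bar>RL \<beta> u z\<bar> \<le> (\<integral>\<^sup>+s. ennreal ((fst z - s) powr (\<beta> - 1) * indicator {0<..<fst z} s * \<bar>u (s, snd z)\<bar>) \<partial>lborel)"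
proof (cases "integrable lborel (\<lambda>s. (fst z - s) powr (\<beta> - 1) * indicator {0<..<fst z} s * u (s, snd z))")
  case True
  have "ennreal \<bar>RL \<beta> u z\<bar> \<le> (\<integral>\<^sup>+s. ennreal (norm ((fst z - s) powr (\<beta> - 1) * indicator {0<..<fst z} s * u (s, snd z))) \<partial>lborel)"
    unfolding RL_def real_norm_def[symmetric] by (rule integral_norm_bound_ennreal[OF True])
  then show ?thesis by (simp add: abs_mult)
next
  case False
  then show ?thesis by (simp add: RL_def not_integrable_integral_eq)
qed

text \<open>The estimate for the smooth approximants, with arbitrary positive upper bounds in place of the norms. For almost
  every \<open>t\<close>, Hoelder in \<open>x\<close> between the Sobolev exponent \<open>ps\<close> and \<open>p\<close> bounds the \<open>q\<close>-norm of the slice by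
  \<open>S(t)\<close>, the norm of its gradient, and \<open>h(t)\<close>, its own \<open>p\<close>-norm. The function \<open>S\<close> has exponent \<open>p\<close> in time; \<open>h\<close> has
  the exponents \<open>p\<close> and, by \<open>time_representation\<close> and \<open>fractional_integral_bound\<close>, also \<open>r\<close>.\<close>
theorem smooth_interpolation:
  fixes \<alpha> p q \<theta> \<tau> :: real
  assumes \<alpha>: "0 < \<alpha>" "\<alpha> < 1" and p: "1 < p" "p < 1 / \<alpha>" "p < real CARD('n::finite)"
    and \<theta>: "0 < \<theta>" "\<theta> < 1" and \<tau>: "0 < \<tau>" "\<tau> \<le> 1" and q: "0 < q"
    and e1: "1 / q = 1 / p - \<theta> / real CARD('n)" and e2: "1 / q = 1 / p - \<tau> * (1 - \<theta>) * \<alpha>"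
  shows "\<exists>N>0. \<forall>T>0. \<forall>(U :: real \<times> (real^'n) \<Rightarrow> real) G g. \<forall>A>0. \<forall>B>0. \<forall>K>0. \<forall>R.
    U \<in> Lp p (cylinder T UNIV) \<longrightarrow> Cinf_on ({0..T} \<times> UNIV) U \<longrightarrow>
    (\<forall>t\<in>{0..T}. \<forall>x. R < norm x \<longrightarrow> U (t, x) = 0) \<longrightarrow>
    is_weak_Dx p T UNIV U G \<longrightarrow> is_weak_dt_I0 \<alpha> p T UNIV U g \<longrightarrow>
    Lp_norm p (cylinder T UNIV) G \<le> A \<longrightarrow> Lp_norm p (cylinder T UNIV) g \<le> B \<longrightarrow> Lp_norm p (cylinder T UNIV) U \<le> K \<longrightarrow>
    (\<integral>\<^sup>+z. ennreal (\<bar>indicator (cylinder T UNIV) z * U z\<bar> powr q) \<partial>lborel)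
      \<le> ennreal ((N * (A powr \<theta> * B powr (\<tau> * (1 - \<theta>)) * K powr ((1 - \<tau>) * (1 - \<theta>)))) powr q)"
proof -
  define d where "d = real CARD('n)"
  define ps where "ps = 1 / (1 / p - 1 / d)"
  define r where "r = 1 / (1 / p - \<alpha>)"
  have pd: "1 / d < 1 / p" using p unfolding d_def by (intro divide_strict_left_mono) auto
  then have ps0: "0 < ps" and pse: "1 / ps = 1 / p - 1 / d" by (simp_all add: ps_def)
  have "\<alpha> < 1 / p" using p \<alpha> by (simp add: field_simps)
  then have r0: "0 < r" and re: "1 / r = 1 / p - \<alpha>" by (simp_all add: r_def)
  have dim: "real DIM(real^'n) = d" by (simp add: d_def)
  obtain C1 where C1: "0 < C1" and "\<forall>(v :: real^'n \<Rightarrow> real) v' g R. \<forall>F>0. (\<forall>x. (v has_derivative v' x) (at x)) \<longrightarrow>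
      (\<forall>h. continuous_on UNIV (\<lambda>x. v' x h)) \<longrightarrow> (\<forall>x h. \<bar>v' x h\<bar> \<le> g x * norm h) \<longrightarrow>
      (\<forall>x. R < norm x \<longrightarrow> v x = 0) \<longrightarrow> (\<forall>x. 0 \<le> g x) \<longrightarrow> g \<in> borel_measurable borel \<longrightarrow>
      (\<integral>\<^sup>+x. ennreal (g x powr p) \<partial>lborel) \<le> ennreal (F powr p) \<longrightarrow>
      (\<integral>\<^sup>+x. ennreal (\<bar>v x\<bar> powr ps) \<partial>lborel) \<le> ennreal ((C1 * F) powr ps)"
    using sobolev_inequality[where 'a = "real^'n", of p ps] p pse unfolding dim by (auto simp: d_def)
  note sob = this(2)[rule_format]
  obtain C2 where C2: "0 < C2" and "\<forall>T>0. \<forall>(u :: real \<times> (real^'n) \<Rightarrow> real) \<in> borel_measurable borel. \<forall>g\<in>borel_measurable borel. \<forall>h\<in>borel_measurable borel. \<forall>F>0.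
     (\<forall>t. 0 \<le> h t) \<longrightarrow> (\<forall>t. t \<notin> {0<..<T} \<longrightarrow> h t = 0) \<longrightarrow>
     (\<forall>t. ennreal (h t powr p) \<le> (\<integral>\<^sup>+x. ennreal (\<bar>u (t, x)\<bar> powr p) \<partial>lborel)) \<longrightarrow>
     (AE z in lborel. fst z \<in> {0<..<T} \<longrightarrow> ennreal \<bar>u z\<bar> \<le> (\<integral>\<^sup>+s. ennreal ((fst z - s) powr (\<alpha> - 1) * indicator {0<..<fst z} s * \<bar>g (s, snd z)\<bar>) \<partial>lborel)) \<longrightarrow>
     (\<integral>\<^sup>+z. ennreal (\<bar>g z\<bar> powr p) \<partial>lborel) \<le> ennreal (F powr p) \<longrightarrow>
     (\<integral>\<^sup>+t. ennreal (h t powr r) \<partial>lborel) \<le> ennreal ((C2 * F) powr r)"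
    using fractional_integral_bound[OF \<alpha> p(1,2) re, where 'a = "real^'n"] by blast
  note frac = this(2)[rule_format]
  have \<Gamma>: "Gamma \<alpha> > 0" using \<alpha> by (intro Gamma_real_pos)
  define N where "N = (2 * C1) powr \<theta> * (C2 / Gamma \<alpha>) powr (\<tau> * (1 - \<theta>))"
  have N0: "N > 0" using C1 C2 \<Gamma> by (simp add: N_def)
  show ?thesis
  proof (intro exI[of _ N] conjI allI impI N0)
    fix T A B K R :: real and U g :: "real \<times> (real^'n) \<Rightarrow> real" and G :: "real \<times> (real^'n) \<Rightarrow> real^'n"
    let ?C = "cylinder T (UNIV :: (real^'n) set)"
    assume T: "0 < T" and A: "0 < A" and B: "0 < B" and K: "0 < K"
      and UL: "U \<in> Lp p ?C" and Cinf: "Cinf_on ({0..T} \<times> UNIV) U"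
      and supp: "\<forall>t\<in>{0..T}. \<forall>x. R < norm x \<longrightarrow> U (t, x) = 0"
      and wG: "is_weak_Dx p T UNIV U G" and wg: "is_weak_dt_I0 \<alpha> p T UNIV U g"
      and GA: "Lp_norm p ?C G \<le> A" and gB: "Lp_norm p ?C g \<le> B" and UK: "Lp_norm p ?C U \<le> K"
    have p1: "1 \<le> p" and p0: "0 < p" using p by auto
    have C: "?C \<in> sets borel" by (rule cylinder_borel)
    have sub: "?C \<subseteq> {0..T} \<times> UNIV" by (auto simp: cylinder_def)
    have "Ck_on (Suc 0) ({0..T} \<times> UNIV) U" using Cinf unfolding Cinf_on_def by blast
    then obtain U' where U': "\<And>z. z \<in> {0..T} \<times> UNIV \<Longrightarrow> (U has_derivative U' z) (at z within {0..T} \<times> UNIV)"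
      and cU': "\<And>v. continuous_on ({0..T} \<times> UNIV) (\<lambda>z. U' z v)" by auto
    have cU: "continuous_on ({0..T} \<times> UNIV) U" using U' by (rule has_derivative_continuous_on)
    define u where "u z = indicator ?C z * U z" for z
    have ru: "Lp_rep p ?C U u" unfolding u_def[abs_def] by (rule smooth_rep[OF UL continuous_on_subset[OF cU sub] p0])
    obtain G0 where G0: "Lp_rep p ?C G G0" using Lp_rep_exists[OF C _ p0] wG unfolding is_weak_Dx_def by blast
    obtain g0 where g0: "Lp_rep p ?C g g0" using Lp_rep_exists[OF C _ p0] wg unfolding is_weak_dt_I0_def by blast
    have um[measurable]: "u \<in> borel_measurable borel" and gm[measurable]: "g0 \<in> borel_measurable borel"
      using ru g0 by (auto simp: Lp_rep_def)
    have le_p: "ennreal (x powr p) \<le> ennreal (y powr p)" if "0 \<le> x" "x \<le> y" for x y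
      using that p0 by (intro ennreal_leI powr_mono2) auto
    have uK: "(\<integral>\<^sup>+z. ennreal (\<bar>u z\<bar> powr p) \<partial>lborel) \<le> ennreal (K powr p)"
      using ru le_p[OF _ UK] by (auto simp: Lp_rep_def Lp_norm_def)
    have gB': "(\<integral>\<^sup>+z. ennreal (\<bar>g0 z\<bar> powr p) \<partial>lborel) \<le> ennreal (B powr p)"
      using g0 le_p[OF _ gB] by (auto simp: Lp_rep_def Lp_norm_def)
    define gr where "gr z = indicator ?C z * norm (\<chi> i. U' z (0, axis i 1))" for z
    have gr_nn: "0 \<le> gr z" for z by (simp add: gr_def)
    have "continuous_on ?C (\<lambda>z. norm (\<chi> i. U' z (0, axis i 1)))"
      by (intro continuous_on_norm continuous_on_vec_lambda continuous_on_subset[OF cU' sub])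
    then have [measurable]: "gr \<in> borel_measurable borel"
      using borel_measurable_continuous_on_indicator[OF C, of "\<lambda>z. norm (\<chi> i. U' z (0, axis i 1))"] by (simp add: gr_def[abs_def])
    have gradient: "AE z in lborel. z \<in> ?C \<longrightarrow> (\<forall>i. G0 z $ i = U' z (0, axis i 1))"
      by (rule gradient_unique[OF _ cU' wG p1 G0]) (rule U')
    have "(\<integral>\<^sup>+z. ennreal (gr z powr p) \<partial>lborel) = (\<integral>\<^sup>+z. ennreal (norm (G0 z) powr p) \<partial>lborel)"
    proof (rule nn_integral_cong_AE)
      show "AE z in lborel. ennreal (gr z powr p) = ennreal (norm (G0 z) powr p)"
        using gradient
      proof eventually_elim
        case (elim z)
        show ?case
        proof (cases "z \<in> ?C")
          case True
          then have "(\<chi> i. U' z (0, axis i 1)) = G0 z" using elim by (simp add: vec_eq_iff)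
          then show ?thesis using True by (simp add: gr_def)
        next
          case False
          then have "G0 z = 0" using G0 unfolding Lp_rep_def by blast
          then show ?thesis using False by (simp add: gr_def)
        qed
      qed
    qed
    also have "\<dots> \<le> ennreal (A powr p)" using G0 le_p[OF _ GA] by (auto simp: Lp_rep_def Lp_norm_def)
    finally have grA: "(\<integral>\<^sup>+z. ennreal (gr z powr p) \<partial>lborel) \<le> ennreal (A powr p)" .
    define Gr where "Gr t = (\<integral>\<^sup>+x. ennreal (gr (t, x) powr p) \<partial>lborel)" for t
    have Grm[measurable]: "Gr \<in> borel_measurable borel" and Gri: "(\<integral>\<^sup>+t. Gr t \<partial>lborel) \<le> ennreal (A powr p)"
      and Grf: "AE t in lborel. Gr t \<noteq> \<infinity>"
      unfolding Gr_def using AE_fst_finite[OF _ grA] grA by auto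
    \<comment> \<open>Adding \<open>\<epsilon>\<close> makes \<open>S\<close> positive on \<open>(0,T)\<close> and at most doubles its \<open>p\<close>-th power integral, whatever \<open>T\<close> is.\<close>
    define \<epsilon> where "\<epsilon> = A powr p / T"
    have \<epsilon>: "\<epsilon> > 0" using A T by (simp add: \<epsilon>_def)
    define S where "S t = indicator {0<..<T} t * (enn2real (Gr t) + \<epsilon>) powr (1 / p)" for t
    have [measurable]: "S \<in> borel_measurable borel" unfolding S_def by measurable
    have S0: "0 \<le> S t" for t by (simp add: S_def)
    have SA: "(\<integral>\<^sup>+t. ennreal (S t powr p) \<partial>lborel) \<le> ennreal ((2 * A) powr p)"
    proof -
      have "(\<integral>\<^sup>+t. ennreal (S t powr p) \<partial>lborel) \<le> (\<integral>\<^sup>+t. Gr t + ennreal \<epsilon> * indicator {0<..<T} t \<partial>lborel)"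
      proof (rule nn_integral_mono_AE)
        show "AE t in lborel. ennreal (S t powr p) \<le> Gr t + ennreal \<epsilon> * indicator {0<..<T} t"
          using Grf
        proof eventually_elim
          case (elim t)
          have "Gr t = ennreal (enn2real (Gr t))" using elim by (simp add: top.not_eq_extremum)
          then have "ennreal (enn2real (Gr t) + \<epsilon>) = Gr t + ennreal \<epsilon>" using \<epsilon> by (metis enn2real_nonneg ennreal_plus less_imp_le)
          moreover have "0 < enn2real (Gr t) + \<epsilon>" using \<epsilon> enn2real_nonneg[of "Gr t"] by linarith
          ultimately show ?case using p0 by (auto simp: S_def powr_powr split: split_indicator)
        qed
      qed
      also have "\<dots> = (\<integral>\<^sup>+t. Gr t \<partial>lborel) + ennreal \<epsilon> * ennreal T"
        using T by (subst nn_integral_add) (auto simp: nn_integral_cmult_indicator)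
      also have "\<dots> \<le> ennreal (A powr p) + ennreal \<epsilon> * ennreal T" by (intro add_mono Gri) auto
      also have "\<dots> = ennreal (2 powr 1 * A powr p)" using T A \<epsilon> by (simp add: \<epsilon>_def flip: ennreal_mult ennreal_plus)
      also have "\<dots> \<le> ennreal (2 powr p * A powr p)" using p by (intro ennreal_leI mult_right_mono powr_mono) auto
      finally show ?thesis using A by (simp add: powr_mult)
    qed
    have sobS: "AE t in lborel. t \<in> {0<..<T} \<longrightarrow> (\<integral>\<^sup>+x. ennreal (\<bar>u (t, x)\<bar> powr ps) \<partial>lborel) \<le> ennreal ((C1 * S t) powr ps)"
      using Grf
    proof eventually_elim
      case (elim t)
      show ?case
      proof
        assume t: "t \<in> {0<..<T}"
        have ut: "u (t, x) = U (t, x)" for x using t by (simp add: u_def cylinder_def)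
        have "(\<integral>\<^sup>+x. ennreal (\<bar>U (t, x)\<bar> powr ps) \<partial>lborel) \<le> ennreal ((C1 * S t) powr ps)"
        proof (rule sob[where v' = "\<lambda>x h. U' (t, x) (0, h)" and g = "\<lambda>x. gr (t, x)" and R = R])
          have "0 < enn2real (Gr t) + \<epsilon>" using \<epsilon> enn2real_nonneg[of "Gr t"] by linarith
          then show "0 < S t" using t by (simp add: S_def)
          have "Gr t = ennreal (enn2real (Gr t))" using elim by (simp add: top.not_eq_extremum)
          also have "\<dots> \<le> ennreal (enn2real (Gr t) + \<epsilon>)" using \<epsilon> by (intro ennreal_leI) simp
          also have "enn2real (Gr t) + \<epsilon> = S t powr p" using t p0 \<open>0 < enn2real (Gr t) + \<epsilon>\<close> by (simp add: S_def powr_powr)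
          finally show "(\<integral>\<^sup>+x. ennreal (gr (t, x) powr p) \<partial>lborel) \<le> ennreal (S t powr p)" by (simp add: Gr_def)
          show "U (t, x) = 0" if "R < norm x" for x using supp t that by auto
          show "(\<lambda>x. gr (t, x)) \<in> borel_measurable borel"
            by (rule measurable_compose[OF _ \<open>gr \<in> borel_measurable borel\<close>]) (simp add: borel_prod[symmetric])
          fix x :: "real^'n"
          have tx: "(t, x) \<in> {0..T} \<times> UNIV" using t by auto
          have "((\<lambda>x. U (t, x)) has_derivative (\<lambda>h. U' (t, x) (0, h))) (at x within UNIV)"
            by (rule has_derivative_in_compose2[where t = "{0..T} \<times> UNIV" and g = U and f = "\<lambda>x. (t, x)" and g' = U'])
              (use U' t in \<open>auto intro!: derivative_eq_intros\<close>)
          then show "((\<lambda>x. U (t, x)) has_derivative (\<lambda>h. U' (t, x) (0, h))) (at x)" by simp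
          show "0 \<le> gr (t, x)" by (rule gr_nn)
          fix h :: "real^'n"
          have lin: "linear (U' (t, x))" using U'[OF tx] by (rule has_derivative_linear)
          have "(0, h) = (\<Sum>i\<in>UNIV. h $ i *\<^sub>R ((0::real), axis i (1::real)))"
            by (simp add: prod_eq_iff fst_sum snd_sum scaleR_Pair vec_eq_iff axis_def if_distrib[of "\<lambda>x. _ * x"] cong: if_cong)
          then have "U' (t, x) (0, h) = U' (t, x) (\<Sum>i\<in>UNIV. h $ i *\<^sub>R ((0::real), axis i (1::real)))" by (rule arg_cong)
          also have "\<dots> = (\<Sum>i\<in>UNIV. h $ i * U' (t, x) (0, axis i 1))"
            by (simp only: linear_sum[OF lin] linear_scale[OF lin] real_scaleR_def)
          also have "\<dots> = (\<chi> i. U' (t, x) (0, axis i 1)) \<bullet> h" by (simp add: inner_vec_def mult.commute)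
          finally have "\<bar>U' (t, x) (0, h)\<bar> \<le> norm (\<chi> i. U' (t, x) (0, axis i 1)) * norm h" using Cauchy_Schwarz_ineq2 by simp
          then show "\<bar>U' (t, x) (0, h)\<bar> \<le> gr (t, x) * norm h" using t by (simp add: gr_def cylinder_def)
        next
          fix h :: "real^'n"
          show "continuous_on UNIV (\<lambda>x. U' (t, x) (0, h))"
            by (rule continuous_on_compose2[OF cU']) (use t in \<open>auto intro!: continuous_intros\<close>)
        qed
        then show "(\<integral>\<^sup>+x. ennreal (\<bar>u (t, x)\<bar> powr ps) \<partial>lborel) \<le> ennreal ((C1 * S t) powr ps)" by (simp add: ut)
      qed
    qed
    define X where "X t = (\<integral>\<^sup>+x. ennreal (\<bar>u (t, x)\<bar> powr p) \<partial>lborel)" for t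
    have Xm[measurable]: "X \<in> borel_measurable borel" and Xi: "(\<integral>\<^sup>+t. X t \<partial>lborel) \<le> ennreal (K powr p)"
      and Xf: "AE t in lborel. X t \<noteq> \<infinity>"
      unfolding X_def using AE_fst_finite[OF _ uK] uK by auto
    define h where "h t = enn2real (X t) powr (1 / p)" for t
    have [measurable]: "h \<in> borel_measurable borel" unfolding h_def by measurable
    have h0: "0 \<le> h t" for t by (simp add: h_def)
    have hp: "h t powr p = enn2real (X t)" for t using p0 by (simp add: h_def powr_powr)
    have hK: "(\<integral>\<^sup>+t. ennreal (h t powr p) \<partial>lborel) \<le> ennreal (K powr p)"
      unfolding h_def using nn_integral_enn2real_powr[OF Xm p0 Xf] Xi by simp
    have hB: "(\<integral>\<^sup>+t. ennreal (h t powr r) \<partial>lborel) \<le> ennreal ((C2 * (B / Gamma \<alpha>)) powr r)"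
    proof (rule frac[where u = u and g = "\<lambda>z. g0 z / Gamma \<alpha>", OF T])
      show "h t = 0" if "t \<notin> {0<..<T}" for t
      proof -
        have "u (t, x) = 0" for x using that by (auto simp: u_def cylinder_def)
        then show ?thesis using p0 by (simp add: h_def X_def)
      qed
      show "ennreal (h t powr p) \<le> (\<integral>\<^sup>+x. ennreal (\<bar>u (t, x)\<bar> powr p) \<partial>lborel)" for t
        unfolding hp X_def[symmetric] by (cases "X t") auto
      show "AE z in lborel. fst z \<in> {0<..<T} \<longrightarrow> ennreal \<bar>u z\<bar> \<le> (\<integral>\<^sup>+s. ennreal ((fst z - s) powr (\<alpha> - 1) * indicator {0<..<fst z} s * \<bar>g0 (s, snd z) / Gamma \<alpha>\<bar>) \<partial>lborel)"
        using time_representation[OF \<alpha> p1 ru g0 wg]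
      proof eventually_elim
        case (elim z)
        show ?case
        proof
          assume "fst z \<in> {0<..<T}"
          then have "u z = RL \<alpha> (\<lambda>z. g0 z / Gamma \<alpha>) z" using elim \<Gamma> by (simp add: cylinder_UNIV_iff RL_def field_simps)
          then show "ennreal \<bar>u z\<bar> \<le> (\<integral>\<^sup>+s. ennreal ((fst z - s) powr (\<alpha> - 1) * indicator {0<..<fst z} s * \<bar>g0 (s, snd z) / Gamma \<alpha>\<bar>) \<partial>lborel)"
            using abs_RL_le[of \<alpha> "\<lambda>z. g0 z / Gamma \<alpha>" z] by simp
        qed
      qed
      have "(\<integral>\<^sup>+z. ennreal (\<bar>g0 z / Gamma \<alpha>\<bar> powr p) \<partial>lborel) = (\<integral>\<^sup>+z. ennreal (1 / Gamma \<alpha> powr p) * ennreal (\<bar>g0 z\<bar> powr p) \<partial>lborel)"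
        using \<Gamma> by (intro nn_integral_cong) (simp add: powr_divide flip: ennreal_mult)
      also have "\<dots> \<le> ennreal (1 / Gamma \<alpha> powr p) * ennreal (B powr p)"
        using gB' by (subst nn_integral_cmult) (auto intro: mult_left_mono)
      also have "\<dots> = ennreal ((B / Gamma \<alpha>) powr p)" using \<Gamma> B by (simp add: powr_divide flip: ennreal_mult)
      finally show "(\<integral>\<^sup>+z. ennreal (\<bar>g0 z / Gamma \<alpha>\<bar> powr p) \<partial>lborel) \<le> ennreal ((B / Gamma \<alpha>) powr p)" .
    qed (use B \<Gamma> h0 in auto)
    have sl: "AE t in lborel. (\<integral>\<^sup>+x. ennreal (\<bar>u (t, x)\<bar> powr q) \<partial>lborel) \<le> ennreal (C1 powr (\<theta> * q)) * ennreal (S t powr (\<theta> * q) * h t powr ((1 - \<theta>) * q))"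
      using sobS Xf
    proof eventually_elim
      case (elim t)
      show ?case
      proof (cases "t \<in> {0<..<T}")
        case True
        have [measurable]: "(\<lambda>x. u (t, x)) \<in> borel_measurable borel"
          by (rule measurable_compose[OF _ um]) (simp add: borel_prod[symmetric])
        have sum1: "\<theta> * q / ps + (1 - \<theta>) * q / p = 1"
        proof -
          have "\<theta> * q / ps + (1 - \<theta>) * q / p = q * (\<theta> * (1 / ps) + (1 - \<theta>) * (1 / p))" by (simp add: algebra_simps)
          also have "\<theta> * (1 / ps) + (1 - \<theta>) * (1 / p) = 1 / q" unfolding pse e1 by (simp add: algebra_simps d_def diff_divide_distrib)
          finally show ?thesis using q by simp
        qed
        have ex: "ps * (\<theta> * q / ps) + p * ((1 - \<theta>) * q / p) = q"
        proof -
          have "ps * (\<theta> * q / ps) = \<theta> * q" "p * ((1 - \<theta>) * q / p) = (1 - \<theta>) * q" using ps0 p0 by auto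
          then show ?thesis by (simp only:) (simp add: algebra_simps)
        qed
        have "(\<integral>\<^sup>+x. ennreal (\<bar>u (t, x)\<bar> powr q) \<partial>lborel) = (\<integral>\<^sup>+x. ennreal ((\<bar>u (t, x)\<bar> powr ps) powr (\<theta> * q / ps) * (\<bar>u (t, x)\<bar> powr p) powr ((1 - \<theta>) * q / p)) \<partial>lborel)"
          by (intro nn_integral_cong arg_cong[of _ _ ennreal]) (simp only: powr_powr powr_add[symmetric] ex)
        also have "\<dots> \<le> ennreal (((C1 * S t) powr ps) powr (\<theta> * q / ps) * (h t powr p) powr ((1 - \<theta>) * q / p))"
        proof (rule nn_integral_geometric_Holder)
          have "(\<integral>\<^sup>+x. ennreal (\<bar>u (t, x)\<bar> powr p) \<partial>lborel) = ennreal (h t powr p)"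
            unfolding hp X_def[symmetric] using elim(2) by (simp add: top.not_eq_extremum)
          then show "(\<integral>\<^sup>+x. ennreal (\<bar>u (t, x)\<bar> powr p) \<partial>lborel) \<le> ennreal (h t powr p)" by simp
          show "(\<integral>\<^sup>+x. ennreal (\<bar>u (t, x)\<bar> powr ps) \<partial>lborel) \<le> ennreal ((C1 * S t) powr ps)" using elim(1) True by blast
        qed (use sum1 \<theta> q ps0 p0 in auto)
        also have "((C1 * S t) powr ps) powr (\<theta> * q / ps) * (h t powr p) powr ((1 - \<theta>) * q / p) = C1 powr (\<theta> * q) * (S t powr (\<theta> * q) * h t powr ((1 - \<theta>) * q))"
          using ps0 p0 C1 S0[of t] by (simp add: powr_powr powr_mult)
        finally show ?thesis by (simp add: ennreal_mult)
      next
        case False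
        then have "u (t, x) = 0" for x by (auto simp: u_def cylinder_def)
        then show ?thesis by simp
      qed
    qed
    have A2: "0 < 2 * A" and B2: "0 < C2 * (B / Gamma \<alpha>)" using A B C2 \<Gamma> by auto
    have e3: "1 / q = \<theta> / p + (1 - \<theta>) * (\<tau> / r + (1 - \<tau>) / p)"
    proof -
      have "\<tau> / r + (1 - \<tau>) / p = \<tau> * (1 / r) + (1 - \<tau>) * (1 / p)" by simp
      also have "\<dots> = 1 / p - \<tau> * \<alpha>" unfolding re by (simp add: algebra_simps diff_divide_distrib)
      finally have Y: "\<tau> / r + (1 - \<tau>) / p = 1 / p - \<tau> * \<alpha>" .
      show ?thesis unfolding e2 Y by (simp add: algebra_simps diff_divide_distrib)
    qed
    have [measurable]: "(\<lambda>z. ennreal (\<bar>u z\<bar> powr q)) \<in> borel_measurable (lborel \<Otimes>\<^sub>M lborel)" by (simp add: lborel_prod)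
    have "(\<integral>\<^sup>+z. ennreal (\<bar>u z\<bar> powr q) \<partial>lborel) = (\<integral>\<^sup>+t. \<integral>\<^sup>+x. ennreal (\<bar>u (t, x)\<bar> powr q) \<partial>lborel \<partial>lborel)"
      using lborel.nn_integral_fst[of "\<lambda>z. ennreal (\<bar>u z\<bar> powr q)" lborel] by (simp add: lborel_prod)
    also have "\<dots> \<le> (\<integral>\<^sup>+t. ennreal (C1 powr (\<theta> * q)) * ennreal (S t powr (\<theta> * q) * h t powr ((1 - \<theta>) * q)) \<partial>lborel)"
      by (rule nn_integral_mono_AE[OF sl])
    also have "\<dots> = ennreal (C1 powr (\<theta> * q)) * (\<integral>\<^sup>+t. ennreal (S t powr (\<theta> * q) * h t powr ((1 - \<theta>) * q)) \<partial>lborel)"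
      by (rule nn_integral_cmult) measurable
    also have "\<dots> \<le> ennreal (C1 powr (\<theta> * q)) * ennreal (((2 * A) powr \<theta> * (C2 * (B / Gamma \<alpha>)) powr (\<tau> * (1 - \<theta>)) * K powr ((1 - \<tau>) * (1 - \<theta>))) powr q)"
      by (intro mult_left_mono interpolate_in_time[where p = p and r = r]) (use S0 h0 \<theta> \<tau> p1 q r0 e3 A2 SA B2 hB K hK in auto)
    also have "\<dots> = ennreal ((C1 powr \<theta> * ((2 * A) powr \<theta> * (C2 * (B / Gamma \<alpha>)) powr (\<tau> * (1 - \<theta>)) * K powr ((1 - \<tau>) * (1 - \<theta>)))) powr q)"
      by (simp add: powr_mult[of "C1 powr \<theta>"] powr_powr flip: ennreal_mult)
    also have "C1 powr \<theta> * ((2 * A) powr \<theta> * (C2 * (B / Gamma \<alpha>)) powr (\<tau> * (1 - \<theta>)) * K powr ((1 - \<tau>) * (1 - \<theta>)))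
       = N * (A powr \<theta> * B powr (\<tau> * (1 - \<theta>)) * K powr ((1 - \<tau>) * (1 - \<theta>)))"
    proof -
      have "(C2 * (B / Gamma \<alpha>)) powr (\<tau> * (1 - \<theta>)) = (C2 / Gamma \<alpha>) powr (\<tau> * (1 - \<theta>)) * B powr (\<tau> * (1 - \<theta>))"
        using C2 B \<Gamma> by (subst powr_mult[symmetric]) (auto simp: mult.commute)
      moreover have "C1 powr \<theta> * (2 * A) powr \<theta> = (2 * C1) powr \<theta> * A powr \<theta>"
        using C1 A by (simp add: powr_mult)
      ultimately show ?thesis by (simp add: N_def)
    qed
    finally show "(\<integral>\<^sup>+z. ennreal (\<bar>indicator ?C z * U z\<bar> powr q) \<partial>lborel)
      \<le> ennreal ((N * (A powr \<theta> * B powr (\<tau> * (1 - \<theta>)) * K powr ((1 - \<tau>) * (1 - \<theta>)))) powr q)"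
      by (simp add: u_def)
  qed
qed

section \<open>Passage to the limit\<close>

lemma Lp_norm_nonneg: "0 \<le> Lp_norm p D f"
  by (simp add: Lp_norm_def)

lemma nn_integral_Fatou_bound:
  fixes f :: "nat \<Rightarrow> 'a \<Rightarrow> real"
  assumes [measurable]: "\<And>n. f n \<in> borel_measurable M" and g: "g \<in> borel_measurable M"
    and lim: "AE z in M. (\<lambda>n. f n z) \<longlonglongrightarrow> g z"
    and le: "\<forall>\<^sub>F n in sequentially. (\<integral>\<^sup>+z. ennreal (\<bar>f n z\<bar> powr q) \<partial>M) \<le> B" and q: "0 < q"
  shows "(\<integral>\<^sup>+z. ennreal (\<bar>g z\<bar> powr q) \<partial>M) \<le> B"
proof -
  have "(\<integral>\<^sup>+z. ennreal (\<bar>g z\<bar> powr q) \<partial>M) = (\<integral>\<^sup>+z. liminf (\<lambda>n. ennreal (\<bar>f n z\<bar> powr q)) \<partial>M)"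
  proof (rule nn_integral_cong_AE)
    show "AE z in M. ennreal (\<bar>g z\<bar> powr q) = liminf (\<lambda>n. ennreal (\<bar>f n z\<bar> powr q))"
      using lim
    proof eventually_elim
      case (elim z)
      have "(\<lambda>n. \<bar>f n z\<bar> powr q) \<longlonglongrightarrow> \<bar>g z\<bar> powr q"
        by (rule tendsto_powr'[OF tendsto_rabs[OF elim] tendsto_const]) (use q in auto)
      then have "(\<lambda>n. ennreal (\<bar>f n z\<bar> powr q)) \<longlonglongrightarrow> ennreal (\<bar>g z\<bar> powr q)" by (rule tendsto_ennrealI)
      then show ?case by (intro lim_imp_Liminf[symmetric]) auto
    qed
  qed
  also have "\<dots> \<le> liminf (\<lambda>n. \<integral>\<^sup>+z. ennreal (\<bar>f n z\<bar> powr q) \<partial>M)"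
    by (rule nn_integral_liminf) measurable
  also have "\<dots> \<le> liminf (\<lambda>n. B)" by (rule Liminf_mono[OF le])
  also have "\<dots> = B" by (simp add: Liminf_const)
  finally show ?thesis .
qed

lemma H_space_weak:
  assumes "u \<in> H_space \<alpha> p T \<Omega>"
  shows "u \<in> Lp p (cylinder T \<Omega>)" "is_weak_Dx p T \<Omega> u (weak_Dx p T \<Omega> u)" "is_weak_dt_I0 \<alpha> p T \<Omega> u (dt_alpha \<alpha> p T \<Omega> u)"
proof -
  have "\<exists>G. is_weak_Dx p T \<Omega> u G" "\<exists>g. is_weak_dt_I0 \<alpha> p T \<Omega> u g" using assms by (auto simp: H_space_def)
  from this[THEN someI_ex] show "is_weak_Dx p T \<Omega> u (weak_Dx p T \<Omega> u)" "is_weak_dt_I0 \<alpha> p T \<Omega> u (dt_alpha \<alpha> p T \<Omega> u)"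
    unfolding weak_Dx_def dt_alpha_def .
  show "u \<in> Lp p (cylinder T \<Omega>)" using assms by (simp add: H_space_def)
qed

lemma H_space_diff:
  assumes p: "1 \<le> p" and \<alpha>: "\<alpha> < 1"
    and u: "u \<in> H_space \<alpha> p T (UNIV :: (real^'n) set)" and v: "v \<in> H_space \<alpha> p T UNIV"
  shows "(\<lambda>z. u z - v z) \<in> H_space \<alpha> p T UNIV"
proof -
  note U = H_space_weak[OF u]
  note V = H_space_weak[OF v]
  have c: "\<bar>- 1 :: real\<bar> = 1" by simp
  show ?thesis unfolding H_space_def
    using Lp_lincomb(1)[OF cylinder_borel p U(1) V(1) c] is_weak_Dx_lincomb[OF p U(1) V(1) U(2) V(2) c]
      is_weak_dt_lincomb[OF p \<alpha> U(1) V(1) U(3) V(3) c]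
    by auto
qed

text \<open>The weak derivatives chosen for \<open>u - v\<close> and for \<open>v\<close> add up to weak derivatives of \<open>u\<close>. Their norms are controlled
  even if they differ from those chosen for \<open>u\<close> on a null set.\<close>
lemma H_space_triangle:
  assumes p: "1 \<le> p" and \<alpha>: "\<alpha> < 1"
    and u: "u \<in> H_space \<alpha> p T (UNIV :: (real^'n) set)" and v: "v \<in> H_space \<alpha> p T UNIV"
  obtains G g where "is_weak_Dx p T UNIV u G" "is_weak_dt_I0 \<alpha> p T UNIV u g"
    "Lp_norm p (cylinder T UNIV) G \<le> 4 * (H_norm \<alpha> p T UNIV (\<lambda>z. u z - v z) + Lp_norm p (cylinder T UNIV) (weak_Dx p T UNIV v))"
    "Lp_norm p (cylinder T UNIV) g \<le> 4 * (H_norm \<alpha> p T UNIV (\<lambda>z. u z - v z) + Lp_norm p (cylinder T UNIV) (dt_alpha \<alpha> p T UNIV v))"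
    "Lp_norm p (cylinder T UNIV) u \<le> 4 * (H_norm \<alpha> p T UNIV (\<lambda>z. u z - v z) + Lp_norm p (cylinder T UNIV) v)"
proof -
  let ?C = "cylinder T (UNIV :: (real^'n) set)"
  define w where "w z = u z - v z" for z
  have wH: "w \<in> H_space \<alpha> p T UNIV" using H_space_diff[OF assms] by (simp add: w_def[abs_def])
  note V = H_space_weak[OF v]
  note W = H_space_weak[OF wH]
  have c: "\<bar>1 :: real\<bar> = 1" by simp
  have e: "(\<lambda>z. w z + 1 * v z) = u" "(\<lambda>z. w z + 1 *\<^sub>R v z) = u" by (auto simp: w_def)
  have n: "Lp_norm p ?C (weak_Dx p T UNIV w) \<le> H_norm \<alpha> p T UNIV w" "Lp_norm p ?C (dt_alpha \<alpha> p T UNIV w) \<le> H_norm \<alpha> p T UNIV w"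
    "Lp_norm p ?C w \<le> H_norm \<alpha> p T UNIV w"
    using Lp_norm_nonneg[of p ?C "weak_Dx p T UNIV w"] Lp_norm_nonneg[of p ?C "dt_alpha \<alpha> p T UNIV w"] Lp_norm_nonneg[of p ?C w]
    by (auto simp: H_norm_def)
  have mono4: "x \<le> 4 * (a + b) \<Longrightarrow> a \<le> h \<Longrightarrow> x \<le> 4 * (h + b)" for x a b h :: real by argo
  have L: "weak_Dx p T UNIV w \<in> Lp p ?C" "weak_Dx p T UNIV v \<in> Lp p ?C" "dt_alpha \<alpha> p T UNIV w \<in> Lp p ?C" "dt_alpha \<alpha> p T UNIV v \<in> Lp p ?C"
    using V W by (auto simp: is_weak_Dx_def is_weak_dt_I0_def)
  show thesis
  proof (rule that)
    show "is_weak_Dx p T UNIV u (\<lambda>z. weak_Dx p T UNIV w z + 1 *\<^sub>R weak_Dx p T UNIV v z)"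
      using is_weak_Dx_lincomb[OF p W(1) V(1) W(2) V(2) c] unfolding e .
    show "is_weak_dt_I0 \<alpha> p T UNIV u (\<lambda>z. dt_alpha \<alpha> p T UNIV w z + 1 *\<^sub>R dt_alpha \<alpha> p T UNIV v z)"
      using is_weak_dt_lincomb[OF p \<alpha> W(1) V(1) W(3) V(3) c] unfolding e by simp
    show "Lp_norm p ?C (\<lambda>z. weak_Dx p T UNIV w z + 1 *\<^sub>R weak_Dx p T UNIV v z) \<le> 4 * (H_norm \<alpha> p T UNIV (\<lambda>z. u z - v z) + Lp_norm p ?C (weak_Dx p T UNIV v))"
      using mono4[OF Lp_lincomb(2)[OF cylinder_borel p L(1,2) c] n(1)] unfolding w_def[abs_def, symmetric] .
    show "Lp_norm p ?C (\<lambda>z. dt_alpha \<alpha> p T UNIV w z + 1 *\<^sub>R dt_alpha \<alpha> p T UNIV v z) \<le> 4 * (H_norm \<alpha> p T UNIV (\<lambda>z. u z - v z) + Lp_norm p ?C (dt_alpha \<alpha> p T UNIV v))"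
      using mono4[OF Lp_lincomb(2)[OF cylinder_borel p L(3,4) c] n(2)] unfolding w_def[abs_def, symmetric] .
    show "Lp_norm p ?C u \<le> 4 * (H_norm \<alpha> p T UNIV (\<lambda>z. u z - v z) + Lp_norm p ?C v)"
      using mono4[OF Lp_lincomb(2)[OF cylinder_borel p W(1) V(1) c] n(3)] unfolding w_def[abs_def, symmetric] e .
  qed
qed

lemma Lp_limit_AE_subseq:
  fixes U :: "nat \<Rightarrow> real \<times> (real^'n) \<Rightarrow> real"
  assumes p: "1 \<le> p" and U: "\<And>n. U n \<in> Lp p (cylinder T UNIV)" and \<psi>: "\<psi> \<in> Lp p (cylinder T UNIV)"
    and lim: "(\<lambda>n. Lp_norm p (cylinder T UNIV) (\<lambda>z. U n z - \<psi> z)) \<longlonglongrightarrow> 0"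
  shows "\<exists>s::nat \<Rightarrow> nat. strict_mono s \<and> (AE z in lborel. z \<in> cylinder T UNIV \<longrightarrow> (\<lambda>n. U (s n) z) \<longlonglongrightarrow> \<psi> z)"
proof -
  let ?C = "cylinder T (UNIV :: (real^'n) set)"
  have p0: "0 < p" using p by simp
  have D: "(\<lambda>z. U n z - \<psi> z) \<in> Lp p ?C" for n
    using Lp_lincomb(1)[OF cylinder_borel p U[of n] \<psi>, of "-1"] by simp
  have "\<exists>d0. Lp_rep p ?C (\<lambda>z. U n z - \<psi> z) d0" for n by (rule Lp_rep_exists[OF cylinder_borel D p0])
  then obtain d0 where d0: "\<And>n. Lp_rep p ?C (\<lambda>z. U n z - \<psi> z) (d0 n)" by metis
  have dm[measurable]: "d0 n \<in> borel_measurable borel" for n using d0[of n] by (simp add: Lp_rep_def)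
  have I: "(\<integral>\<^sup>+z. ennreal (norm (d0 n z) powr p) \<partial>lborel) = ennreal (Lp_norm p ?C (\<lambda>z. U n z - \<psi> z) powr p)" for n
    using d0[of n] unfolding Lp_rep_def by blast
  have int: "integrable lborel (\<lambda>z. norm (d0 n z) powr p)" for n
    by (rule integrableI_bounded) (use I[of n] in auto)
  have "(LINT z|lborel. norm (norm (d0 n z) powr p)) = Lp_norm p ?C (\<lambda>z. U n z - \<psi> z) powr p" for n
    using I[of n] by (subst integral_eq_nn_integral) auto
  moreover have "(\<lambda>n. Lp_norm p ?C (\<lambda>z. U n z - \<psi> z) powr p) \<longlonglongrightarrow> 0 powr p"
    by (rule tendsto_powr'[OF lim tendsto_const]) (use p0 in \<open>auto simp: Lp_norm_nonneg\<close>)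
  ultimately have "(\<lambda>n. LINT z|lborel. norm (norm (d0 n z) powr p)) \<longlonglongrightarrow> 0" by simp
  from tendsto_L1_AE_subseq[OF int this] obtain s :: "nat \<Rightarrow> nat" where s: "strict_mono s"
    and ae: "AE z in lborel. (\<lambda>n. norm (d0 (s n) z) powr p) \<longlonglongrightarrow> 0" by blast
  have "AE z in lborel. \<forall>n. z \<in> ?C \<longrightarrow> U n z - \<psi> z = d0 n z"
    using d0 unfolding Lp_rep_def by (subst AE_all_countable) blast
  with ae have "AE z in lborel. z \<in> ?C \<longrightarrow> (\<lambda>n. U (s n) z) \<longlonglongrightarrow> \<psi> z"
  proof eventually_elim
    case (elim z)
    show ?case
    proof
      assume z: "z \<in> ?C"
      have "(\<lambda>n. (norm (d0 (s n) z) powr p) powr (1 / p)) \<longlonglongrightarrow> 0 powr (1 / p)"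
        by (rule tendsto_powr'[OF elim(1) tendsto_const]) (use p0 in auto)
      then have "(\<lambda>n. norm (d0 (s n) z)) \<longlonglongrightarrow> 0" using p0 by (simp add: powr_powr)
      then have "(\<lambda>n. d0 (s n) z) \<longlonglongrightarrow> 0" by (rule tendsto_norm_zero_cancel)
      then have "(\<lambda>n. U (s n) z - \<psi> z) \<longlonglongrightarrow> 0" using elim(2) z by simp
      then show "(\<lambda>n. U (s n) z) \<longlonglongrightarrow> \<psi> z" by (rule Lim_null[THEN iffD2])
    qed
  qed
  then show ?thesis using s by blast
qed

text \<open>The approximants converge almost everywhere along a subsequence, so Fatou's lemma transfers the bound. Strict upper
  bounds \<open>A\<close>, \<open>B\<close>, \<open>K\<close> hold for almost all approximants and keep the right-hand side fixed. They are positive, so that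
  at the endpoint \<open>\<tau> = 1\<close> the factor \<open>K powr 0\<close> equals one.\<close>
theorem H0_interpolation:
  fixes \<alpha> p q \<theta> \<tau> :: real
  assumes \<alpha>: "0 < \<alpha>" "\<alpha> < 1" and p: "1 < p" "p < 1 / \<alpha>" "p < real CARD('n::finite)"
    and \<theta>: "0 < \<theta>" "\<theta> < 1" and \<tau>: "0 < \<tau>" "\<tau> \<le> 1" and q: "0 < q"
    and e1: "1 / q = 1 / p - \<theta> / real CARD('n)" and e2: "1 / q = 1 / p - \<tau> * (1 - \<theta>) * \<alpha>"
  shows "\<exists>N>0. \<forall>T>0. \<forall>\<psi>\<in>H0_space \<alpha> p T (UNIV :: (real^'n) set).
    \<forall>A > 4 * Lp_norm p (cylinder T UNIV) (weak_Dx p T UNIV \<psi>).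
    \<forall>B > 4 * Lp_norm p (cylinder T UNIV) (dt_alpha \<alpha> p T UNIV \<psi>).
    \<forall>K > 4 * Lp_norm p (cylinder T UNIV) \<psi>.
      \<psi> \<in> Lp q (cylinder T UNIV) \<and>
      Lp_norm q (cylinder T UNIV) \<psi> \<le> N * (A powr \<theta> * B powr (\<tau> * (1 - \<theta>)) * K powr ((1 - \<tau>) * (1 - \<theta>)))"
proof -
  obtain N where N: "N > 0" and "\<forall>T>0. \<forall>(U :: real \<times> (real^'n) \<Rightarrow> real) G g. \<forall>A>0. \<forall>B>0. \<forall>K>0. \<forall>R.
    U \<in> Lp p (cylinder T UNIV) \<longrightarrow> Cinf_on ({0..T} \<times> UNIV) U \<longrightarrow>
    (\<forall>t\<in>{0..T}. \<forall>x. R < norm x \<longrightarrow> U (t, x) = 0) \<longrightarrow>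
    is_weak_Dx p T UNIV U G \<longrightarrow> is_weak_dt_I0 \<alpha> p T UNIV U g \<longrightarrow>
    Lp_norm p (cylinder T UNIV) G \<le> A \<longrightarrow> Lp_norm p (cylinder T UNIV) g \<le> B \<longrightarrow> Lp_norm p (cylinder T UNIV) U \<le> K \<longrightarrow>
    (\<integral>\<^sup>+z. ennreal (\<bar>indicator (cylinder T UNIV) z * U z\<bar> powr q) \<partial>lborel)
      \<le> ennreal ((N * (A powr \<theta> * B powr (\<tau> * (1 - \<theta>)) * K powr ((1 - \<tau>) * (1 - \<theta>)))) powr q)"
    using smooth_interpolation[OF assms] by blast
  note smooth = this(2)[rule_format]
  show ?thesis
  proof (intro exI[of _ N] conjI[OF N] allI ballI impI)
    fix T A B K :: real and \<psi> :: "real \<times> (real^'n) \<Rightarrow> real"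
    let ?C = "cylinder T (UNIV :: (real^'n) set)"
    assume T: "0 < T" and \<psi>: "\<psi> \<in> H0_space \<alpha> p T (UNIV :: (real^'n) set)"
      and A: "4 * Lp_norm p ?C (weak_Dx p T UNIV \<psi>) < A"
      and B: "4 * Lp_norm p ?C (dt_alpha \<alpha> p T UNIV \<psi>) < B"
      and K: "4 * Lp_norm p ?C \<psi> < K"
    have p1: "1 \<le> p" and p0: "0 < p" using p by auto
    define M where "M = N * (A powr \<theta> * B powr (\<tau> * (1 - \<theta>)) * K powr ((1 - \<tau>) * (1 - \<theta>)))"
    have M0: "0 \<le> M" using N by (simp add: M_def)
    have ABK: "0 < A" "0 < B" "0 < K"
      using A B K Lp_norm_nonneg[of p ?C "weak_Dx p T UNIV \<psi>"] Lp_norm_nonneg[of p ?C "dt_alpha \<alpha> p T UNIV \<psi>"] Lp_norm_nonneg[of p ?C \<psi>] by linarith+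
    obtain U where \<psi>H: "\<psi> \<in> H_space \<alpha> p T UNIV" and U: "\<And>n. U n \<in> H_space \<alpha> p T UNIV" "\<And>n. Cinf_on ({0..T} \<times> UNIV) (U n)"
      "\<And>n. \<exists>R. \<forall>t\<in>{0..T}. \<forall>x. R < norm x \<longrightarrow> U n (t, x) = 0"
      and lim: "(\<lambda>n. H_norm \<alpha> p T UNIV (\<lambda>z. U n z - \<psi> z)) \<longlonglongrightarrow> 0"
      using \<psi> unfolding H0_space_def by auto
    have \<psi>L: "\<psi> \<in> Lp p ?C" by (rule H_space_weak(1)[OF \<psi>H])
    have UL: "U n \<in> Lp p ?C" for n by (rule H_space_weak(1)[OF U(1)])
    have rep: "Lp_rep p ?C (U n) (\<lambda>z. indicator ?C z * U n z)" for n
    proof (rule smooth_rep[OF UL _ p0])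
      have "Ck_on 0 ({0..T} \<times> UNIV) (U n)" using U(2)[of n] unfolding Cinf_on_def by blast
      then have "continuous_on ({0..T} \<times> UNIV) (U n)" by simp
      then show "continuous_on ?C (U n)" by (rule continuous_on_subset) (auto simp: cylinder_def)
    qed
    define \<delta> where "\<delta> = min (A / 4 - Lp_norm p ?C (weak_Dx p T UNIV \<psi>)) (min (B / 4 - Lp_norm p ?C (dt_alpha \<alpha> p T UNIV \<psi>)) (K / 4 - Lp_norm p ?C \<psi>))"
    have \<delta>: "0 < \<delta>" using A B K by (simp add: \<delta>_def)
    have small: "x \<le> 4 * (h + a) \<Longrightarrow> h < \<delta> \<Longrightarrow> \<delta> \<le> b / 4 - a \<Longrightarrow> x \<le> b" for x h a b :: real by argo
    have "\<forall>\<^sub>F n in sequentially. H_norm \<alpha> p T UNIV (\<lambda>z. U n z - \<psi> z) < \<delta>" by (rule order_tendstoD(2)[OF lim \<delta>])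
    then have ev: "\<forall>\<^sub>F n in sequentially. (\<integral>\<^sup>+z. ennreal (\<bar>indicator ?C z * U n z\<bar> powr q) \<partial>lborel) \<le> ennreal (M powr q)"
    proof eventually_elim
      case (elim n)
      obtain R where R: "\<And>t x. t \<in> {0..T} \<Longrightarrow> R < norm x \<Longrightarrow> U n (t, x) = 0" using U(3)[of n] by blast
      show ?case
      proof (rule H_space_triangle[OF p1 \<alpha>(2) U(1)[of n] \<psi>H])
        fix G g
        assume G: "is_weak_Dx p T UNIV (U n) G" and g: "is_weak_dt_I0 \<alpha> p T UNIV (U n) g"
          and n: "Lp_norm p ?C G \<le> 4 * (H_norm \<alpha> p T UNIV (\<lambda>z. U n z - \<psi> z) + Lp_norm p ?C (weak_Dx p T UNIV \<psi>))"
          "Lp_norm p ?C g \<le> 4 * (H_norm \<alpha> p T UNIV (\<lambda>z. U n z - \<psi> z) + Lp_norm p ?C (dt_alpha \<alpha> p T UNIV \<psi>))"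
          "Lp_norm p ?C (U n) \<le> 4 * (H_norm \<alpha> p T UNIV (\<lambda>z. U n z - \<psi> z) + Lp_norm p ?C \<psi>)"
        have d: "\<delta> \<le> A / 4 - Lp_norm p ?C (weak_Dx p T UNIV \<psi>)" "\<delta> \<le> B / 4 - Lp_norm p ?C (dt_alpha \<alpha> p T UNIV \<psi>)" "\<delta> \<le> K / 4 - Lp_norm p ?C \<psi>"
          by (auto simp: \<delta>_def)
        show ?thesis unfolding M_def
          by (rule smooth[OF T ABK UL U(2) R G g small[OF n(1) elim d(1)] small[OF n(2) elim d(2)] small[OF n(3) elim d(3)]])
      qed
    qed
    have "(\<lambda>n. Lp_norm p ?C (\<lambda>z. U n z - \<psi> z)) \<longlonglongrightarrow> 0"
    proof (rule tendsto_sandwich[OF _ _ tendsto_const lim])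
      show "\<forall>\<^sub>F n in sequentially. Lp_norm p ?C (\<lambda>z. U n z - \<psi> z) \<le> H_norm \<alpha> p T UNIV (\<lambda>z. U n z - \<psi> z)"
        by (intro always_eventually allI) (simp add: H_norm_def Lp_norm_nonneg)
    qed (simp add: Lp_norm_nonneg)
    from Lp_limit_AE_subseq[OF p1 UL \<psi>L this] obtain s :: "nat \<Rightarrow> nat" where s: "strict_mono s"
      and ae: "AE z in lborel. z \<in> ?C \<longrightarrow> (\<lambda>n. U (s n) z) \<longlonglongrightarrow> \<psi> z" by blast
    obtain \<psi>0 where \<psi>0: "Lp_rep p ?C \<psi> \<psi>0" using Lp_rep_exists[OF cylinder_borel \<psi>L p0] by blast
    then have ae\<psi>: "AE z in lborel. z \<in> ?C \<longrightarrow> \<psi> z = \<psi>0 z" and z\<psi>: "\<And>z. z \<notin> ?C \<Longrightarrow> \<psi>0 z = 0"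
      and m\<psi>: "\<psi>0 \<in> borel_measurable borel" unfolding Lp_rep_def by blast+
    have le: "(\<integral>\<^sup>+z. ennreal (\<bar>\<psi>0 z\<bar> powr q) \<partial>lborel) \<le> ennreal (M powr q)"
    proof (rule nn_integral_Fatou_bound[where f = "\<lambda>n z. indicator ?C z * U (s n) z", OF _ _ _ _ q])
      show "(\<lambda>z. indicator ?C z * U (s n) z) \<in> borel_measurable lborel" for n using rep[of "s n"] by (simp add: Lp_rep_def)
      show "AE z in lborel. (\<lambda>n. indicator ?C z * U (s n) z) \<longlonglongrightarrow> \<psi>0 z"
        using ae ae\<psi>
      proof eventually_elim
        case (elim z)
        then show ?case using z\<psi>[of z] by (cases "z \<in> ?C") auto
      qed
      show "\<forall>\<^sub>F n in sequentially. (\<integral>\<^sup>+z. ennreal (\<bar>indicator ?C z * U (s n) z\<bar> powr q) \<partial>lborel) \<le> ennreal (M powr q)"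
        by (rule eventually_subseq[OF s ev])
    qed (use m\<psi> in simp)
    note L = Lp_I[OF cylinder_borel m\<psi> _ ae\<psi> q M0]
    have mem: "\<psi> \<in> Lp q ?C" by (rule L(1)) (use z\<psi> le in auto)
    have "Lp_norm q ?C \<psi> \<le> N * (A powr \<theta> * B powr (\<tau> * (1 - \<theta>)) * K powr ((1 - \<tau>) * (1 - \<theta>)))"
      unfolding M_def[symmetric] by (rule L(2)) (use z\<psi> le in auto)
    with mem show "\<psi> \<in> Lp q ?C \<and> Lp_norm q ?C \<psi> \<le> N * (A powr \<theta> * B powr (\<tau> * (1 - \<theta>)) * K powr ((1 - \<tau>) * (1 - \<theta>)))" ..
  qed
qed

lemma tendsto_powr_shift:
  fixes a x :: real
  assumes "0 \<le> a" "0 < x"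
  shows "(\<lambda>n. (4 * a + inverse (real (Suc n))) powr x) \<longlonglongrightarrow> 4 powr x * a powr x"
proof -
  have "(\<lambda>n. 4 * a + inverse (real (Suc n))) \<longlonglongrightarrow> 4 * a + 0"
    by (intro tendsto_add tendsto_const LIMSEQ_inverse_real_of_nat)
  then have "(\<lambda>n. 4 * a + inverse (real (Suc n))) \<longlonglongrightarrow> 4 * a" by simp
  then have "(\<lambda>n. (4 * a + inverse (real (Suc n))) powr x) \<longlonglongrightarrow> (4 * a) powr x"
    by (rule tendsto_powr'[OF _ tendsto_const]) (use assms in auto)
  then show ?thesis using assms by (simp add: powr_mult)
qed

theorem theoremA1:
  fixes \<alpha> p q d qs \<theta> \<tau> :: real
  assumes "0 < \<alpha>" "\<alpha> < 1" "1 < p" "1 < q"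
    and "d = real CARD('n::finite)"
    and "p < min (1 / \<alpha>) d"
    and "qs = (1 / \<alpha> + d) / (1 / (\<alpha> * p) + d / p - 1)"
    and "\<theta> = d * (1 / p - 1 / q)"
    and "\<tau> = 1 / (\<alpha> * d) * (\<theta> / (1 - \<theta>))"
  shows "(p < q \<and> q < qs \<longrightarrow>
      \<theta> \<in> {0<..<1} \<and> \<tau> \<in> {0<..<1} \<and>
      (\<exists>N. \<forall>T>0. \<forall>\<psi> \<in> H0_space \<alpha> p T (UNIV :: (real^'n) set).
        \<psi> \<in> Lp q (cylinder T UNIV) \<and>
        Lp_norm q (cylinder T UNIV) \<psi> \<le>
          N * Lp_norm p (cylinder T UNIV) (weak_Dx p T UNIV \<psi>) powr \<theta>
            * Lp_norm p (cylinder T UNIV) (dt_alpha \<alpha> p T UNIV \<psi>) powr (\<tau> * (1 - \<theta>))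
            * Lp_norm p (cylinder T UNIV) \<psi> powr ((1 - \<tau>) * (1 - \<theta>))))
    \<and> (q = qs \<longrightarrow>
      (\<exists>N. \<forall>T>0. \<forall>\<psi> \<in> H0_space \<alpha> p T (UNIV :: (real^'n) set).
        \<psi> \<in> Lp q (cylinder T UNIV) \<and>
        Lp_norm q (cylinder T UNIV) \<psi> \<le>
          N * Lp_norm p (cylinder T UNIV) (weak_Dx p T UNIV \<psi>) powr (\<alpha> * d / (1 + \<alpha> * d))
            * Lp_norm p (cylinder T UNIV) (dt_alpha \<alpha> p T UNIV \<psi>) powr (1 / (1 + \<alpha> * d))))"
proof -
  have \<alpha>: "0 < \<alpha>" "\<alpha> < 1" and p1: "1 < p" and q0: "0 < q" using assms by auto
  have p2: "p < 1 / \<alpha>" and p3: "p < real CARD('n)" and pd: "p < d" using assms by auto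
  have d0: "d > 0" using pd p1 by simp
  have ad: "\<alpha> * d > 0" using \<alpha> d0 by simp
  define \<kappa> where "\<kappa> = \<alpha> * d / (1 + \<alpha> * d)"
  have \<kappa>: "0 < \<kappa>" "\<kappa> < 1" "1 - \<kappa> = 1 / (1 + \<alpha> * d)" using ad by (auto simp: \<kappa>_def field_simps)
  have "1 < d / p" using pd p1 by simp
  then have den: "1 / (\<alpha> * p) + d / p - 1 > 0"
  proof -
    have "1 / (\<alpha> * p) > 0" using \<alpha> p1 by simp
    then show ?thesis using \<open>1 < d / p\<close> by linarith
  qed
  have qs: "1 / qs = 1 / p - \<kappa> / d"
  proof -
    have "1 / qs = (1 / (\<alpha> * p) + d / p - 1) / (1 / \<alpha> + d)" using assms(7) by simp
    also have "\<dots> = (\<alpha> * (1 / (\<alpha> * p) + d / p - 1)) / (\<alpha> * (1 / \<alpha> + d))" using \<alpha> by simp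
    also have "\<alpha> * (1 / (\<alpha> * p) + d / p - 1) = (1 + \<alpha> * d) / p - \<alpha>" using \<alpha> by (simp add: algebra_simps add_divide_distrib)
    also have "\<alpha> * (1 / \<alpha> + d) = 1 + \<alpha> * d" using \<alpha> by (simp add: field_simps)
    also have "((1 + \<alpha> * d) / p - \<alpha>) / (1 + \<alpha> * d) = 1 / p - \<alpha> / (1 + \<alpha> * d)" using ad p1 by (simp add: diff_divide_distrib)
    also have "\<alpha> / (1 + \<alpha> * d) = \<kappa> / d" using d0 by (simp add: \<kappa>_def)
    finally show ?thesis .
  qed
  have qs0: "qs > 0" using assms(7) den \<alpha> d0 by (simp add: add_pos_pos)
  have e1: "1 / q = 1 / p - \<theta> / real CARD('n)" using assms(5,8) d0 by simp
  have th_tau: "\<tau> * (1 - \<theta>) * \<alpha> = \<theta> / d" if "\<theta> < 1" using that \<alpha> d0 by (simp add: assms(9))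
  let ?nD = "\<lambda>T \<psi>. Lp_norm p (cylinder T UNIV) (weak_Dx p T (UNIV :: (real^'n) set) \<psi>)"
  let ?nt = "\<lambda>T \<psi>. Lp_norm p (cylinder T UNIV) (dt_alpha \<alpha> p T (UNIV :: (real^'n) set) \<psi>)"
  let ?n = "\<lambda>T (\<psi> :: real \<times> (real^'n) \<Rightarrow> real). Lp_norm p (cylinder T UNIV) \<psi>"
  have pos: "0 < inverse (real (Suc n))" for n by simp
  show ?thesis
  proof (intro conjI impI)
    assume pq: "p < q \<and> q < qs"
    have "1 / q < 1 / p" using pq p1 by (intro divide_strict_left_mono) auto
    then have th0: "0 < \<theta>" using d0 assms(8) by simp
    have "1 / qs < 1 / q" using pq qs0 q0 by (intro divide_strict_left_mono) auto
    then have "\<theta> / d < \<kappa> / d" using qs e1 assms(5) by simp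
    then have th\<kappa>: "\<theta> < \<kappa>" using d0 by (simp add: divide_less_cancel)
    then have th1: "\<theta> < 1" using \<kappa> by simp
    have tau0: "0 < \<tau>" using th0 th1 ad by (simp add: assms(9))
    have "\<theta> * (1 + \<alpha> * d) < \<alpha> * d" using th\<kappa> ad by (simp add: \<kappa>_def pos_less_divide_eq)
    then have "\<theta> < (1 - \<theta>) * (\<alpha> * d)" by (simp add: algebra_simps)
    then have "\<theta> / (1 - \<theta>) < \<alpha> * d" using th1 by (simp add: pos_divide_less_eq mult.commute)
    then have "(\<theta> / (1 - \<theta>)) / (\<alpha> * d) < 1" using ad by (subst pos_divide_less_eq) auto
    then have tau1: "\<tau> < 1" unfolding assms(9) by (simp only: times_divide_eq_left mult_1_left)
    show "\<theta> \<in> {0<..<1}" "\<tau> \<in> {0<..<1}" using th0 th1 tau0 tau1 by auto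
    have e2: "1 / q = 1 / p - \<tau> * (1 - \<theta>) * \<alpha>" using th_tau[OF th1] e1 assms(5) by simp
    obtain N where N: "N > 0" and "\<forall>T>0. \<forall>\<psi>\<in>H0_space \<alpha> p T (UNIV :: (real^'n) set).
      \<forall>A > 4 * ?nD T \<psi>. \<forall>B > 4 * ?nt T \<psi>. \<forall>K > 4 * ?n T \<psi>.
      \<psi> \<in> Lp q (cylinder T UNIV) \<and>
      Lp_norm q (cylinder T UNIV) \<psi> \<le> N * (A powr \<theta> * B powr (\<tau> * (1 - \<theta>)) * K powr ((1 - \<tau>) * (1 - \<theta>)))"
      using H0_interpolation[OF \<alpha> p1 p2 p3 th0 th1 tau0 less_imp_le[OF tau1] q0 e1 e2] by blast
    note bound = this(2)[rule_format]
    define M where "M = N * (4 powr \<theta> * 4 powr (\<tau> * (1 - \<theta>)) * 4 powr ((1 - \<tau>) * (1 - \<theta>)))"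
    show "\<exists>N. \<forall>T>0. \<forall>\<psi> \<in> H0_space \<alpha> p T (UNIV :: (real^'n) set).
        \<psi> \<in> Lp q (cylinder T UNIV) \<and>
        Lp_norm q (cylinder T UNIV) \<psi> \<le> N * ?nD T \<psi> powr \<theta> * ?nt T \<psi> powr (\<tau> * (1 - \<theta>)) * ?n T \<psi> powr ((1 - \<tau>) * (1 - \<theta>))"
    proof (intro exI[of _ M] allI impI ballI)
      fix T :: real and \<psi> assume T: "0 < T" and \<psi>: "\<psi> \<in> H0_space \<alpha> p T (UNIV :: (real^'n) set)"
      let ?e = "\<lambda>n. inverse (real (Suc n))"
      have b: "\<psi> \<in> Lp q (cylinder T UNIV) \<and> Lp_norm q (cylinder T UNIV) \<psi> \<le> N * ((4 * ?nD T \<psi> + ?e n) powr \<theta> * (4 * ?nt T \<psi> + ?e n) powr (\<tau> * (1 - \<theta>)) * (4 * ?n T \<psi> + ?e n) powr ((1 - \<tau>) * (1 - \<theta>)))" for n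
        using pos[of n] by (intro bound[OF T \<psi>]) linarith+
      have "(\<lambda>n. N * ((4 * ?nD T \<psi> + ?e n) powr \<theta> * (4 * ?nt T \<psi> + ?e n) powr (\<tau> * (1 - \<theta>)) * (4 * ?n T \<psi> + ?e n) powr ((1 - \<tau>) * (1 - \<theta>))))
        \<longlonglongrightarrow> N * ((4 powr \<theta> * ?nD T \<psi> powr \<theta>) * (4 powr (\<tau> * (1 - \<theta>)) * ?nt T \<psi> powr (\<tau> * (1 - \<theta>))) * (4 powr ((1 - \<tau>) * (1 - \<theta>)) * ?n T \<psi> powr ((1 - \<tau>) * (1 - \<theta>))))"
        by (intro tendsto_mult tendsto_const tendsto_powr_shift Lp_norm_nonneg) (use th0 th1 tau0 tau1 in auto)
      then have "Lp_norm q (cylinder T UNIV) \<psi> \<le> N * ((4 powr \<theta> * ?nD T \<psi> powr \<theta>) * (4 powr (\<tau> * (1 - \<theta>)) * ?nt T \<psi> powr (\<tau> * (1 - \<theta>))) * (4 powr ((1 - \<tau>) * (1 - \<theta>)) * ?n T \<psi> powr ((1 - \<tau>) * (1 - \<theta>))))"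
        by (rule LIMSEQ_le_const) (use b in blast)
      also have "\<dots> = M * ?nD T \<psi> powr \<theta> * ?nt T \<psi> powr (\<tau> * (1 - \<theta>)) * ?n T \<psi> powr ((1 - \<tau>) * (1 - \<theta>))"
        by (simp only: M_def mult_ac)
      finally show "\<psi> \<in> Lp q (cylinder T UNIV) \<and> Lp_norm q (cylinder T UNIV) \<psi> \<le> M * ?nD T \<psi> powr \<theta> * ?nt T \<psi> powr (\<tau> * (1 - \<theta>)) * ?n T \<psi> powr ((1 - \<tau>) * (1 - \<theta>))"
        using b[of 0] by blast
    qed
  next
    assume qq: "q = qs"
    have "\<theta> / d = \<kappa> / d" using qs e1 assms(5) qq by simp
    then have th: "\<theta> = \<kappa>" using d0 by simp
    have th0: "0 < \<theta>" and th1: "\<theta> < 1" using th \<kappa> by auto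
    have e2: "1 / q = 1 / p - 1 * (1 - \<theta>) * \<alpha>"
    proof -
      have "(1 - \<theta>) * \<alpha> = \<theta> / d" unfolding th \<kappa>(3) using d0 by (simp add: \<kappa>_def)
      then show ?thesis using e1 assms(5) by simp
    qed
    obtain N where N: "N > 0" and "\<forall>T>0. \<forall>\<psi>\<in>H0_space \<alpha> p T (UNIV :: (real^'n) set).
      \<forall>A > 4 * ?nD T \<psi>. \<forall>B > 4 * ?nt T \<psi>. \<forall>K > 4 * ?n T \<psi>.
      \<psi> \<in> Lp q (cylinder T UNIV) \<and>
      Lp_norm q (cylinder T UNIV) \<psi> \<le> N * (A powr \<theta> * B powr (1 * (1 - \<theta>)) * K powr ((1 - 1) * (1 - \<theta>)))"
      using H0_interpolation[OF \<alpha> p1 p2 p3 th0 th1 zero_less_one order.refl q0 e1 e2] by blast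
    note bound = this(2)[rule_format]
    define M where "M = N * (4 powr \<theta> * 4 powr (1 - \<theta>))"
    have ex: "\<alpha> * d / (1 + \<alpha> * d) = \<theta>" "1 / (1 + \<alpha> * d) = 1 - \<theta>" using th \<kappa>(3) by (simp_all add: \<kappa>_def)
    show "\<exists>N. \<forall>T>0. \<forall>\<psi> \<in> H0_space \<alpha> p T (UNIV :: (real^'n) set).
        \<psi> \<in> Lp q (cylinder T UNIV) \<and>
        Lp_norm q (cylinder T UNIV) \<psi> \<le> N * ?nD T \<psi> powr (\<alpha> * d / (1 + \<alpha> * d)) * ?nt T \<psi> powr (1 / (1 + \<alpha> * d))"
      unfolding ex
    proof (intro exI[of _ M] allI impI ballI)
      fix T :: real and \<psi> assume T: "0 < T" and \<psi>: "\<psi> \<in> H0_space \<alpha> p T (UNIV :: (real^'n) set)"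
      let ?e = "\<lambda>n. inverse (real (Suc n))"
      have b: "\<psi> \<in> Lp q (cylinder T UNIV) \<and> Lp_norm q (cylinder T UNIV) \<psi> \<le> N * ((4 * ?nD T \<psi> + ?e n) powr \<theta> * (4 * ?nt T \<psi> + ?e n) powr (1 - \<theta>))" for n
      proof -
        have K: "0 < 4 * ?n T \<psi> + ?e n" using pos[of n] Lp_norm_nonneg[of p "cylinder T UNIV" \<psi>] by linarith
        have "\<psi> \<in> Lp q (cylinder T UNIV) \<and> Lp_norm q (cylinder T UNIV) \<psi> \<le> N * ((4 * ?nD T \<psi> + ?e n) powr \<theta> * (4 * ?nt T \<psi> + ?e n) powr (1 * (1 - \<theta>)) * (4 * ?n T \<psi> + ?e n) powr ((1 - 1) * (1 - \<theta>)))"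
          using pos[of n] by (intro bound[OF T \<psi>]) linarith+
        then show ?thesis using K by simp
      qed
      have "(\<lambda>n. N * ((4 * ?nD T \<psi> + ?e n) powr \<theta> * (4 * ?nt T \<psi> + ?e n) powr (1 - \<theta>)))
        \<longlonglongrightarrow> N * ((4 powr \<theta> * ?nD T \<psi> powr \<theta>) * (4 powr (1 - \<theta>) * ?nt T \<psi> powr (1 - \<theta>)))"
        by (intro tendsto_mult tendsto_const tendsto_powr_shift Lp_norm_nonneg) (use th0 th1 in auto)
      then have "Lp_norm q (cylinder T UNIV) \<psi> \<le> N * ((4 powr \<theta> * ?nD T \<psi> powr \<theta>) * (4 powr (1 - \<theta>) * ?nt T \<psi> powr (1 - \<theta>)))"
        by (rule LIMSEQ_le_const) (use b in blast)
      also have "\<dots> = M * ?nD T \<psi> powr \<theta> * ?nt T \<psi> powr (1 - \<theta>)"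
        by (simp only: M_def mult_ac)
      finally show "\<psi> \<in> Lp q (cylinder T UNIV) \<and> Lp_norm q (cylinder T UNIV) \<psi> \<le> M * ?nD T \<psi> powr \<theta> * ?nt T \<psi> powr (1 - \<theta>)"
        using b[of 0] by blast
    qed
  qed
qed

end
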